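(* There is an algorithm which takes as input: an unweighted undirected graph $G=(V,E)$ with $m$ edges (parallel edges allowed, no self loops); positive integers $h\ge 1$ and $F\ge 1$; a source function $\Delta:V\to\mathbb{Z}_{\ge 0}$ with $\Delta(v)\le F\deg(v)$ for all $v\in V$; and a sink function $T:V\to\mathbb{Z}_{\ge 0}$ with $T(v)\le \deg(v)$ for all $v$ and $|\Delta(\cdot)|\le |T(\cdot)|$. In time $O(hF(|\Delta(\cdot)|+|\overline{T}(\cdot)|)\log m)$ the algorithm returns a source-feasible preflow $f$ with congestion $\mathrm{cong}(f)\le 2hF$ together with $|ex_f(\cdot)|$, and moreover either (Case 1) $|ex_f(\cdot)|=0$, i.e. $f$ is a flow, or (Case 2) the algorithm returns (outputs all nodes of) a set $S\subseteq V$ with $\phi_G(S)<\frac1h$ and $\mathrm{vol}(S)\ge \frac{|ex_f(\cdot)|}{F}$.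
   Context: For a graph $G=(V,E)$ and $S\subseteq V$: $\mathrm{vol}(S)=\sum_{v\in S}\deg(v)$, $\delta(S)$ is the number of edges with exactly one endpoint in $S$, and $\phi_G(S)=\delta(S)/\min\{\mathrm{vol}(S),\mathrm{vol}(V\setminus S)\}$. Given source and sink functions $\Delta,T:V\to\mathbb{Z}_{\ge0}$, a preflow is a function $f:V\times V\to\mathbb{Z}$ with $f(u,v)=-f(v,u)$ for all $u,v$ and $f(u,v)=0$ whenever $(u,v)\notin E$. Define $f(v)=\Delta(v)+\sum_{u\in V}f(u,v)$. $f$ is source-feasible if $\sum_u f(v,u)\le\Delta(v)$ for every $v$, sink-feasible if $f(v)\le T(v)$ for every $v$, and a flow if both. The congestion is $\mathrm{cong}(f)=\max_{(u,v)}f(u,v)$. The excess is $ex_f(v)=\max\{f(v)-T(v),0\}$, and $|ex_f(\cdot)|=\sum_v ex_f(v)$, $|\Delta(\cdot)|=\sum_v\Delta(v)$, $|T(\cdot)|=\sum_vT(v)$, $\overline{T}(v)=\deg(v)-T(v)$, $|\overline{T}(\cdot)|=\sum_v\overline{T}(v)=2m-|T(\cdot)|$. Input/output model (relevant since the running time can be sublinear in the graph size): the graph is given as a pointer to an adjacency list (constant-time access to the head of each node's incidence list, plus a list of nodes of degree at least 1); $\Delta$ and $T$ are given as the sets $\{(v,\Delta(v)):\Delta(v)>0\}$ and $\{(v,T(v)):T(v)<\deg(v)\}$; the preflow is output as the set $\{((u,v),f(u,v)):f(u,v)\ne0\}$.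
   Formalization: With parallel edges, the preflow, its output and cong(f) ≤ 2hF are taken per individual edge instead of per vertex pair (the per-pair claim is false); the time bound is read as 1 + hF(|Δ|+|T̄|)·max(1, log m), since the literal one can be 0. *)

theory Defs
  imports Complex_Main
begin

section \<open>Multigraphs, volumes and cuts\<close>

text \<open>Edges have identities of their own, so that parallel edges are distinct edges with equal sets
  of endpoints.\<close>

record ('v, 'e) mgraph =
  verts :: "'v set"
  edges :: "'e set"
  ends :: "'e \<Rightarrow> 'v set"

definition multigraph :: "('v, 'e) mgraph \<Rightarrow> bool" where
  "multigraph G \<longleftrightarrow> finite (verts G) \<and> finite (edges G) \<and>
     (\<forall>e\<in>edges G. ends G e \<subseteq> verts G \<and> card (ends G e) = 2)"

definition deg :: "('v, 'e) mgraph \<Rightarrow> 'v \<Rightarrow> nat" where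
  "deg G v = card {e \<in> edges G. v \<in> ends G e}"

definition vol :: "('v, 'e) mgraph \<Rightarrow> 'v set \<Rightarrow> nat" where
  "vol G S = (\<Sum>v\<in>S. deg G v)"

definition cut_size :: "('v, 'e) mgraph \<Rightarrow> 'v set \<Rightarrow> nat" where
  "cut_size G S = card {e \<in> edges G. card (ends G e \<inter> S) = 1}"

text \<open>The conductance is meaningful only if both sides of the cut have positive volume; elsewhere the
  quotient below is the HOL convention \<open>x / 0 = 0\<close>, so users must assert positivity separately.\<close>

definition conductance :: "('v, 'e) mgraph \<Rightarrow> 'v set \<Rightarrow> real" where
  "conductance G S = real (cut_size G S) / real (min (vol G S) (vol G (verts G - S)))"


section \<open>Preflows\<close>

text \<open>The value \<open>f e u v\<close> is the flow sent from \<open>u\<close> to \<open>v\<close> along the edge \<open>e\<close>. In a graph without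
  parallel edges this is just a function on \<open>V \<times> V\<close>. With parallel edges the value, and hence the
  congestion, has to be counted for each edge separately: with \<open>k\<close> parallel edges between \<open>u\<close> and
  \<open>v\<close>, up to \<open>k\<close> times the congestion can be sent from \<open>u\<close> to \<open>v\<close>.\<close>

type_synonym ('v, 'e) flow_fun = "'e \<Rightarrow> 'v \<Rightarrow> 'v \<Rightarrow> int"

definition preflow :: "('v, 'e) mgraph \<Rightarrow> ('v, 'e) flow_fun \<Rightarrow> bool" where
  "preflow G f \<longleftrightarrow>
     (\<forall>e u v. f e u v = - f e v u) \<and>
     (\<forall>e u v. \<not> (e \<in> edges G \<and> ends G e = {u, v}) \<longrightarrow> f e u v = 0)"

definition amount ::
  "('v, 'e) mgraph \<Rightarrow> ('v \<Rightarrow> nat) \<Rightarrow> ('v, 'e) flow_fun \<Rightarrow> 'v \<Rightarrow> int" where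
  "amount G \<Delta> f v = int (\<Delta> v) + (\<Sum>u\<in>verts G. \<Sum>e\<in>edges G. f e u v)"

definition source_feasible ::
  "('v, 'e) mgraph \<Rightarrow> ('v \<Rightarrow> nat) \<Rightarrow> ('v, 'e) flow_fun \<Rightarrow> bool" where
  "source_feasible G \<Delta> f \<longleftrightarrow>
     (\<forall>v\<in>verts G. (\<Sum>u\<in>verts G. \<Sum>e\<in>edges G. f e v u) \<le> int (\<Delta> v))"

definition sink_feasible ::
  "('v, 'e) mgraph \<Rightarrow> ('v \<Rightarrow> nat) \<Rightarrow> ('v \<Rightarrow> nat) \<Rightarrow> ('v, 'e) flow_fun \<Rightarrow> bool" where
  "sink_feasible G \<Delta> T f \<longleftrightarrow> (\<forall>v\<in>verts G. amount G \<Delta> f v \<le> int (T v))"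

definition is_flow ::
  "('v, 'e) mgraph \<Rightarrow> ('v \<Rightarrow> nat) \<Rightarrow> ('v \<Rightarrow> nat) \<Rightarrow> ('v, 'e) flow_fun \<Rightarrow> bool" where
  "is_flow G \<Delta> T f \<longleftrightarrow> preflow G f \<and> source_feasible G \<Delta> f \<and> sink_feasible G \<Delta> T f"

text \<open>The maximum ranges over all pairs of vertices, including the pairs \<open>(u, u)\<close> of value \<open>0\<close>; the
  inserted \<open>0\<close> only matters when there is no edge to range over.\<close>

definition congestion :: "('v, 'e) mgraph \<Rightarrow> ('v, 'e) flow_fun \<Rightarrow> int" where
  "congestion G f =
     Max (insert 0 {f e u v | e u v. e \<in> edges G \<and> u \<in> verts G \<and> v \<in> verts G})"

definition excess ::
  "('v, 'e) mgraph \<Rightarrow> ('v \<Rightarrow> nat) \<Rightarrow> ('v \<Rightarrow> nat) \<Rightarrow> ('v, 'e) flow_fun \<Rightarrow> 'v \<Rightarrow> int" where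
  "excess G \<Delta> T f v = max (amount G \<Delta> f v - int (T v)) 0"

definition total_excess ::
  "('v, 'e) mgraph \<Rightarrow> ('v \<Rightarrow> nat) \<Rightarrow> ('v \<Rightarrow> nat) \<Rightarrow> ('v, 'e) flow_fun \<Rightarrow> int" where
  "total_excess G \<Delta> T f = (\<Sum>v\<in>verts G. excess G \<Delta> T f v)"


section \<open>A random access machine\<close>

text \<open>Algorithms are programs of a structured unit-cost RAM with finitely many integer registers and
  finitely many memory arrays that are accessed at a computed index in constant time. As in the
  uniform-cost RAM of Cook and Reckhow, addition and subtraction are the only arithmetic operations;
  multiplication is left out because it would make unit cost unrealistic. An assignment or a test
  takes one time unit: the expressions occurring in a fixed program have bounded size, so charging
  for each single operation would change the time by a constant factor only.\<close>

datatype aexp =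
    Const int
  | Reg string
  | Read string aexp
  | Add aexp aexp
  | Sub aexp aexp

datatype bexp =
    Less aexp aexp
  | Not bexp
  | And bexp bexp

datatype com =
    Skip
  | Assign string aexp
  | Write string aexp aexp
  | Seq com com
  | Cond bexp com com
  | While bexp com

record state =
  reg :: "string \<Rightarrow> int"
  arr :: "string \<Rightarrow> int \<Rightarrow> int"

fun aval :: "aexp \<Rightarrow> state \<Rightarrow> int" where
  "aval (Const k) \<sigma> = k"
| "aval (Reg x) \<sigma> = reg \<sigma> x"
| "aval (Read a i) \<sigma> = arr \<sigma> a (aval i \<sigma>)"
| "aval (Add p q) \<sigma> = aval p \<sigma> + aval q \<sigma>"
| "aval (Sub p q) \<sigma> = aval p \<sigma> - aval q \<sigma>"

fun bval :: "bexp \<Rightarrow> state \<Rightarrow> bool" where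
  "bval (Less p q) \<sigma> \<longleftrightarrow> aval p \<sigma> < aval q \<sigma>"
| "bval (Not b) \<sigma> \<longleftrightarrow> \<not> bval b \<sigma>"
| "bval (And b c) \<sigma> \<longleftrightarrow> bval b \<sigma> \<and> bval c \<sigma>"

text \<open>\<open>exec c \<sigma> t \<sigma>'\<close>: started in \<open>\<sigma>\<close>, the program \<open>c\<close> terminates in \<open>\<sigma>'\<close> after exactly \<open>t\<close> steps.\<close>

inductive exec :: "com \<Rightarrow> state \<Rightarrow> nat \<Rightarrow> state \<Rightarrow> bool" where
  Skip: "exec Skip \<sigma> 1 \<sigma>"
| Assign: "exec (Assign x p) \<sigma> 1 (\<sigma>\<lparr>reg := (reg \<sigma>)(x := aval p \<sigma>)\<rparr>)"
| Write: "exec (Write a i p) \<sigma> 1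
    (\<sigma>\<lparr>arr := (arr \<sigma>)(a := (arr \<sigma> a)(aval i \<sigma> := aval p \<sigma>))\<rparr>)"
| Seq: "\<lbrakk>exec c \<sigma> t \<sigma>'; exec d \<sigma>' t' \<sigma>''\<rbrakk> \<Longrightarrow> exec (Seq c d) \<sigma> (t + t') \<sigma>''"
| Cond_True: "\<lbrakk>bval b \<sigma>; exec c \<sigma> t \<sigma>'\<rbrakk> \<Longrightarrow> exec (Cond b c d) \<sigma> (1 + t) \<sigma>'"
| Cond_False: "\<lbrakk>\<not> bval b \<sigma>; exec d \<sigma> t \<sigma>'\<rbrakk> \<Longrightarrow> exec (Cond b c d) \<sigma> (1 + t) \<sigma>'"
| While_False: "\<not> bval b \<sigma> \<Longrightarrow> exec (While b c) \<sigma> 1 \<sigma>"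
| While_True: "\<lbrakk>bval b \<sigma>; exec c \<sigma> t \<sigma>'; exec (While b c) \<sigma>' t' \<sigma>''\<rbrakk>
    \<Longrightarrow> exec (While b c) \<sigma> (1 + t + t') \<sigma>''"

inductive_cases exec_SkipE: "exec Skip \<sigma> t \<sigma>'"
inductive_cases exec_AssignE: "exec (Assign x p) \<sigma> t \<sigma>'"
inductive_cases exec_WriteE: "exec (Write a i p) \<sigma> t \<sigma>'"
inductive_cases exec_SeqE: "exec (Seq c d) \<sigma> t \<sigma>'"
inductive_cases exec_CondE: "exec (Cond b c d) \<sigma> t \<sigma>'"
inductive_cases exec_WhileE: "exec (While b c) \<sigma> t \<sigma>'"

lemma exec_deterministic:
  "exec c \<sigma> t \<sigma>' \<Longrightarrow> exec c \<sigma> s \<tau> \<Longrightarrow> s = t \<and> \<tau> = \<sigma>'"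
proof (induction arbitrary: s \<tau> rule: exec.induct)
  case (Skip \<sigma>)
  then show ?case by (rule exec_SkipE) simp
next
  case (Assign x p \<sigma>)
  then show ?case by (rule exec_AssignE) simp
next
  case (Write a i p \<sigma>)
  then show ?case by (rule exec_WriteE) simp
next
  case (Seq c \<sigma> t \<sigma>' d t' \<sigma>'')
  from Seq.prems show ?case by (rule exec_SeqE) (metis Seq.IH)
next
  case (Cond_True b \<sigma> c t \<sigma>' d)
  from Cond_True.prems show ?case
    by (rule exec_CondE) (simp_all add: Cond_True.hyps Cond_True.IH)
next
  case (Cond_False b \<sigma> d t \<sigma>' c)
  from Cond_False.prems show ?case
    by (rule exec_CondE) (simp_all add: Cond_False.hyps Cond_False.IH)
next
  case (While_False b \<sigma> c)
  from While_False.prems show ?case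
    by (rule exec_WhileE) (simp_all add: While_False.hyps)
next
  case (While_True b \<sigma> c t \<sigma>' t' \<sigma>'')
  from While_True.prems show ?case
  proof (rule exec_WhileE)
    assume "\<not> bval b \<sigma>"
    with While_True.hyps show ?case by simp
  next
    fix r \<rho> r'
    assume s: "s = Suc (r + r')" and "exec c \<sigma> r \<rho>" and rest: "exec (While b c) \<rho> r' \<tau>"
    then have "r = t" "\<rho> = \<sigma>'" using While_True.IH(1) by auto
    with s rest While_True.IH(2) show ?case by simp
  qed
qed


section \<open>Input and output\<close>

text \<open>Vertices and edges are named by natural numbers. A list is held in one array, or, if its entries
  are tuples, in one array per component, with its length in a register.\<close>

definition holds_list :: "state \<Rightarrow> string \<Rightarrow> nat list \<Rightarrow> bool" where
  "holds_list \<sigma> a xs \<longleftrightarrow> (\<forall>i<length xs. arr \<sigma> a (int i) = int (xs ! i))"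

fun linked_list :: "(int \<Rightarrow> int) \<Rightarrow> int \<Rightarrow> int list \<Rightarrow> bool" where
  "linked_list nxt p [] \<longleftrightarrow> p = 0"
| "linked_list nxt p (c # cs) \<longleftrightarrow> p = c \<and> c \<noteq> 0 \<and> linked_list nxt (nxt c) cs"

text \<open>The entry \<open>v\<close> of the array \<open>head\<close> is a pointer to the incidence list of \<open>v\<close>, and \<open>0\<close> is the null
  pointer. A cell of that list contains the name of an incident edge, the other endpoint of this
  edge, and a pointer to the next cell. Degrees and the numbers of vertices and edges are not part
  of the input.\<close>

definition holds_incidence_lists :: "(nat, nat) mgraph \<Rightarrow> state \<Rightarrow> bool" where
  "holds_incidence_lists G \<sigma> \<longleftrightarrow>
     (\<forall>v\<in>verts G. \<exists>cs es.
        linked_list (arr \<sigma> ''next'') (arr \<sigma> ''head'' (int v)) cs \<and>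
        distinct es \<and> set es = {e \<in> edges G. v \<in> ends G e} \<and>
        length cs = length es \<and>
        (\<forall>i<length cs. arr \<sigma> ''edge'' (cs ! i) = int (es ! i) \<and>
           (\<exists>u. arr \<sigma> ''nbr'' (cs ! i) = int u \<and> ends G (es ! i) = {v, u})))"

text \<open>All working memory is zero initially. Entries of input arrays that do not belong to the input
  (such as \<open>head\<close> at a number that is not a vertex) are arbitrary.\<close>

definition is_input ::
  "(nat, nat) mgraph \<Rightarrow> nat \<Rightarrow> nat \<Rightarrow> (nat \<Rightarrow> nat) \<Rightarrow> (nat \<Rightarrow> nat) \<Rightarrow> state \<Rightarrow> bool" where
  "is_input G h F \<Delta> T \<sigma> \<longleftrightarrow>
     holds_incidence_lists G \<sigma> \<and>
     (\<exists>ns. distinct ns \<and> set ns = {v \<in> verts G. deg G v \<ge> 1} \<and>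
        reg \<sigma> ''nodes_len'' = int (length ns) \<and> holds_list \<sigma> ''nodes'' ns) \<and>
     (\<exists>ds. distinct ds \<and> set ds = {(v, \<Delta> v) | v. v \<in> verts G \<and> \<Delta> v > 0} \<and>
        reg \<sigma> ''source_len'' = int (length ds) \<and>
        holds_list \<sigma> ''source_node'' (map fst ds) \<and>
        holds_list \<sigma> ''source_val'' (map snd ds)) \<and>
     (\<exists>ts. distinct ts \<and> set ts = {(v, T v) | v. v \<in> verts G \<and> T v < deg G v} \<and>
        reg \<sigma> ''sink_len'' = int (length ts) \<and>
        holds_list \<sigma> ''sink_node'' (map fst ts) \<and>
        holds_list \<sigma> ''sink_val'' (map snd ts)) \<and>
     reg \<sigma> ''h'' = int h \<and> reg \<sigma> ''F'' = int F \<and>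
     (\<forall>x. x \<notin> {''h'', ''F'', ''nodes_len'', ''source_len'', ''sink_len''} \<longrightarrow> reg \<sigma> x = 0) \<and>
     (\<forall>a. a \<notin> {''head'', ''next'', ''edge'', ''nbr'', ''nodes'', ''source_node'', ''source_val'',
        ''sink_node'', ''sink_val''} \<longrightarrow> arr \<sigma> a = (\<lambda>i. 0))"

definition outputs_preflow :: "(nat, nat) flow_fun \<Rightarrow> state \<Rightarrow> bool" where
  "outputs_preflow f \<sigma> \<longleftrightarrow>
     (\<exists>xs. distinct xs \<and> set xs = {(e, u, v) | e u v. f e u v \<noteq> 0} \<and>
        reg \<sigma> ''flow_len'' = int (length xs) \<and>
        holds_list \<sigma> ''flow_edge'' (map (\<lambda>(e, u, v). e) xs) \<and>
        holds_list \<sigma> ''flow_from'' (map (\<lambda>(e, u, v). u) xs) \<and>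
        holds_list \<sigma> ''flow_to'' (map (\<lambda>(e, u, v). v) xs) \<and>
        (\<forall>i<length xs. case xs ! i of (e, u, v) \<Rightarrow> arr \<sigma> ''flow_val'' (int i) = f e u v))"

definition outputs_set :: "nat set \<Rightarrow> state \<Rightarrow> bool" where
  "outputs_set S \<sigma> \<longleftrightarrow>
     (\<exists>xs. distinct xs \<and> set xs = S \<and>
        reg \<sigma> ''cut_len'' = int (length xs) \<and> holds_list \<sigma> ''cut'' xs)"

text \<open>\<open>h F (|\<Delta>| + |T'|) log m\<close> where \<open>T' v = deg v - T v\<close>. The maximum with \<open>1\<close> only
  matters for \<open>m \<le> 1\<close>, where the logarithm vanishes or is undefined; the summand \<open>1\<close> only matters
  if \<open>|\<Delta>| + |T'| = 0\<close>, where otherwise no time at all would be allowed.\<close>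

definition time_bound ::
  "(nat, nat) mgraph \<Rightarrow> nat \<Rightarrow> nat \<Rightarrow> (nat \<Rightarrow> nat) \<Rightarrow> (nat \<Rightarrow> nat) \<Rightarrow> real" where
  "time_bound G h F \<Delta> T =
     1 + real (h * F * ((\<Sum>v\<in>verts G. \<Delta> v) + (\<Sum>v\<in>verts G. deg G v - T v)))
       * max 1 (log 2 (real (card (edges G))))"

end

theory Submission
  imports Defs
begin

text \<open>The algorithm is push-relabel with unit pushes along edges of capacity \<open>2 h F\<close>, where only nodes
  whose sink is full ever leave level \<open>0\<close>, and an active node of lowest level is always served first.
  A pushed unit therefore arrives at a node without excess, so every excess stays below
  \<open>F deg(v)\<close>. Nodes of positive level absorb \<open>T(v)\<close>, hence their total volume is at most
  \<open>|\<Delta>| + |T'|\<close>, and the potential \<open>\<Sum> (F deg(v) - excess(v)) level(v)\<close>, which each push increases,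
  bounds the number of pushes.

  The height is not fixed in advance, because \<open>m\<close> is unknown and cannot be computed in time: it is \<open>8 h k\<close> for the
  least \<open>k \<ge> 1\<close> such that \<open>2 ^ k\<close> exceeds the number of incidences seen so far, which is at least the
  volume of the nodes of positive level. If excess remains when the lowest active level reaches the height, a region growing
  argument from both sides yields a level set \<open>S\<close> such that fewer than
  \<open>min (vol S) (vol (V - S)) / (4 h)\<close> edges leave \<open>S\<close> by dropping exactly one level. All other cut
  edges are saturated, so their number is bounded by the supply of \<open>S\<close> divided by \<open>2 h F\<close>.\<close>


section \<open>Running time of programs\<close>

text \<open>Origin of the constants: of the edges leaving a level set, the \<open>z\<close> that
  drop one level may carry flow inwards at full capacity, all others carry \<open>2 h F\<close>
  outwards. The net outflow is at most \<open>F\<close> times the smaller volume, so the cut has at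
  most \<open>2 z\<close> edges plus that volume over \<open>2 h\<close>. The target
  \<open>1 / h\<close> leaves the other half for \<open>2 z\<close>, whence the condition that
  \<open>4 h z\<close> is below the volume. Where it fails, the smaller side grows by a factor of at
  least 1 + 1/(4h) per level and doubles within \<open>4 h\<close> levels. Either side may be the
  smaller one, which makes \<open>8 h\<close> levels per doubling.

  The volume of \<open>V - S\<close> cannot be computed in time. It is replaced by the volume of the
  positive levels outside \<open>S\<close> plus 1. The 1 stands for level 0, whose volume is
  positive while excess remains, since the supply does not exceed the sinks.

  The machine has neither multiplication nor degrees at hand. Products are therefore maintained by
  additions, and scanning a list at level 0 serves to measure a degree before the node may
  rise.\<close>

definition reaches :: "com \<Rightarrow> state \<Rightarrow> nat \<Rightarrow> (state \<Rightarrow> bool) \<Rightarrow> bool" where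
  "reaches c \<sigma> K Q \<longleftrightarrow> (\<exists>t \<sigma>'. exec c \<sigma> t \<sigma>' \<and> t \<le> K \<and> Q \<sigma>')"

lemma reaches_weaken:
  "reaches c \<sigma> K Q \<Longrightarrow> K \<le> K' \<Longrightarrow> (\<And>\<sigma>'. Q \<sigma>' \<Longrightarrow> Q' \<sigma>') \<Longrightarrow> reaches c \<sigma> K' Q'"
  unfolding reaches_def by (meson order_trans)

lemma reaches_Seq:
  assumes "reaches c \<sigma> K Q" "\<And>\<sigma>'. Q \<sigma>' \<Longrightarrow> reaches d \<sigma>' K' R"
  shows "reaches (Seq c d) \<sigma> (K + K') R"
proof -
  obtain t \<sigma>' where 1: "exec c \<sigma> t \<sigma>'" "t \<le> K" "Q \<sigma>'"
    using assms(1) unfolding reaches_def by blast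
  obtain t' \<sigma>'' where 2: "exec d \<sigma>' t' \<sigma>''" "t' \<le> K'" "R \<sigma>''"
    using assms(2)[OF 1(3)] unfolding reaches_def by blast
  show ?thesis
    unfolding reaches_def using exec.Seq[OF 1(1) 2(1)] 1 2 by (meson add_mono)
qed

lemma reaches_Cond:
  assumes "bval b \<sigma> \<Longrightarrow> reaches c \<sigma> K Q" "\<not> bval b \<sigma> \<Longrightarrow> reaches d \<sigma> K Q"
  shows "reaches (Cond b c d) \<sigma> (Suc K) Q"
  using assms unfolding reaches_def
  by (cases "bval b \<sigma>") (force intro: exec.Cond_True exec.Cond_False)+

lemma reaches_Skip: "Q \<sigma> \<Longrightarrow> reaches Skip \<sigma> 1 Q"
  unfolding reaches_def by (metis exec.Skip order_refl)

text \<open>The variant lives on a ghost value \<open>a\<close> related to the state by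
  \<open>I\<close>, since the abstract configuration is not a function of the memory. Each round
  pays for the body and one test, the last 1 for the failing test.\<close>

lemma reaches_While:
  fixes I :: "'a \<Rightarrow> state \<Rightarrow> bool" and \<mu> :: "'a \<Rightarrow> nat"
  assumes body: "\<And>a \<sigma>. I a \<sigma> \<Longrightarrow> bval b \<sigma> \<Longrightarrow> reaches c \<sigma> K (\<lambda>\<sigma>'. \<exists>a'. I a' \<sigma>' \<and> \<mu> a' < \<mu> a)"
    and "I a \<sigma>"
  shows "reaches (While b c) \<sigma> (\<mu> a * Suc K + 1) (\<lambda>\<sigma>'. \<not> bval b \<sigma>' \<and> (\<exists>a'. I a' \<sigma>'))"
  using assms(2)
proof (induction "\<mu> a" arbitrary: a \<sigma> rule: less_induct)
  case less
  show ?case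
  proof (cases "bval b \<sigma>")
    case False
    then show ?thesis
      using exec.While_False[OF False, of c] less.prems unfolding reaches_def by force
  next
    case True
    obtain t \<sigma>' a' where 1: "exec c \<sigma> t \<sigma>'" "t \<le> K" "I a' \<sigma>'" "\<mu> a' < \<mu> a"
      using body[OF less.prems True] unfolding reaches_def by blast
    obtain t' \<sigma>'' where 2: "exec (While b c) \<sigma>' t' \<sigma>''" "t' \<le> \<mu> a' * Suc K + 1"
      "\<not> bval b \<sigma>''" "\<exists>a'. I a' \<sigma>''"
      using less.hyps[OF 1(4,3)] unfolding reaches_def by blast
    have "Suc (\<mu> a') * Suc K \<le> \<mu> a * Suc K"
      using 1(4) by (intro mult_right_mono) auto
    then have "1 + t + t' \<le> \<mu> a * Suc K + 1" using 1(2) 2(2) by simp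
    then show ?thesis
      unfolding reaches_def using exec.While_True[OF True 1(1) 2(1)] 2(3,4) by blast
  qed
qed

section \<open>Loop-free code as a state transformer\<close>

fun loop_free :: "com \<Rightarrow> bool" where
  "loop_free (Seq c d) \<longleftrightarrow> loop_free c \<and> loop_free d"
| "loop_free (Cond b c d) \<longleftrightarrow> loop_free c \<and> loop_free d"
| "loop_free (While b c) \<longleftrightarrow> False"
| "loop_free _ \<longleftrightarrow> True"

fun steps :: "com \<Rightarrow> nat" where
  "steps (Seq c d) = steps c + steps d"
| "steps (Cond b c d) = 1 + max (steps c) (steps d)"
| "steps _ = 1"

text \<open>Loop-free code becomes a function that the simplifier evaluates, so that only loops need
  invariants. A loop gets the identity as a dummy value, which \<open>loop_free\<close> screens
  out.\<close>

fun effect :: "com \<Rightarrow> state \<Rightarrow> state" where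
  "effect (Assign x p) \<sigma> = \<sigma>\<lparr>reg := (reg \<sigma>)(x := aval p \<sigma>)\<rparr>"
| "effect (Write a i p) \<sigma> = \<sigma>\<lparr>arr := (arr \<sigma>)(a := (arr \<sigma> a)(aval i \<sigma> := aval p \<sigma>))\<rparr>"
| "effect (Seq c d) \<sigma> = effect d (effect c \<sigma>)"
| "effect (Cond b c d) \<sigma> = (if bval b \<sigma> then effect c \<sigma> else effect d \<sigma>)"
| "effect _ \<sigma> = \<sigma>"

lemma exec_loop_free: "loop_free c \<Longrightarrow> \<exists>t \<le> steps c. exec c \<sigma> t (effect c \<sigma>)"
proof (induction c arbitrary: \<sigma>)
  case (Seq c d)
  obtain t where t: "t \<le> steps c" "exec c \<sigma> t (effect c \<sigma>)" using Seq by auto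
  obtain t' where t': "t' \<le> steps d" "exec d (effect c \<sigma>) t' (effect d (effect c \<sigma>))"
    using Seq by auto
  show ?case using exec.Seq[OF t(2) t'(2)] t(1) t'(1) by (intro exI[of _ "t + t'"]) simp
next
  case (Cond b c d)
  obtain t where t: "t \<le> steps c" "exec c \<sigma> t (effect c \<sigma>)" using Cond by auto
  obtain t' where t': "t' \<le> steps d" "exec d \<sigma> t' (effect d \<sigma>)" using Cond by auto
  show ?case
  proof (cases "bval b \<sigma>")
    case True
    then show ?thesis using exec.Cond_True[OF True t(2)] t(1) by (intro exI[of _ "1 + t"]) simp
  next
    case False
    then show ?thesis using exec.Cond_False[OF False t'(2)] t'(1) by (intro exI[of _ "1 + t'"]) simp
  qed
next
  case Skip
  show ?case using exec.Skip[of \<sigma>] by auto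
next
  case (Assign x p)
  show ?case using exec.Assign[of x p \<sigma>] by auto
next
  case (Write a i p)
  show ?case using exec.Write[of a i p \<sigma>] by auto
qed simp

lemma reaches_loop_free: "loop_free c \<Longrightarrow> Q (effect c \<sigma>) \<Longrightarrow> reaches c \<sigma> (steps c) Q"
  using exec_loop_free[of c \<sigma>] unfolding reaches_def by blast

lemma reaches_loop_free_Seq:
  assumes "loop_free c" "reaches d (effect c \<sigma>) K Q"
  shows "reaches (Seq c d) \<sigma> (steps c + K) Q"
proof (rule reaches_Seq)
  show "reaches c \<sigma> (steps c) (\<lambda>\<tau>. \<tau> = effect c \<sigma>)" using assms(1) by (rule reaches_loop_free) simp
qed (use assms(2) in simp)

text \<open>The number of rounds is known in advance, so the invariant is indexed by the round and
  no separate variant is needed.\<close>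

lemma reaches_for:
  assumes "loop_free c" and guard: "\<And>i \<tau>. J i \<tau> \<Longrightarrow> bval b \<tau> \<longleftrightarrow> i < (n::nat)"
    and J0: "J 0 \<sigma>" and step: "\<And>i \<tau>. J i \<tau> \<Longrightarrow> i < n \<Longrightarrow> J (Suc i) (effect c \<tau>)"
  shows "reaches (While b c) \<sigma> (n * Suc (steps c) + 1) (J n)"
proof -
  let ?J = "\<lambda>i \<tau>. J i \<tau> \<and> i \<le> n"
  have "reaches (While b c) \<sigma> ((n - 0) * Suc (steps c) + 1) (\<lambda>\<tau>. \<not> bval b \<tau> \<and> (\<exists>i. ?J i \<tau>))"
  proof (rule reaches_While[where \<mu> = "\<lambda>i. n - i" and I = ?J])
    fix i \<tau> assume *: "?J i \<tau>" "bval b \<tau>"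
    then have i: "i < n" using guard by blast
    then have "?J (Suc i) (effect c \<tau>) \<and> n - Suc i < n - i" using * step by auto
    then show "reaches c \<tau> (steps c) (\<lambda>\<tau>'. \<exists>i'. ?J i' \<tau>' \<and> n - i' < n - i)"
      using assms(1) by (intro reaches_loop_free) blast+
  qed (use J0 in simp)
  then show ?thesis
  proof (rule reaches_weaken)
    fix \<tau> assume "\<not> bval b \<tau> \<and> (\<exists>i. ?J i \<tau>)"
    then obtain i where "J i \<tau>" "i \<le> n" "\<not> i < n" using guard by blast
    then show "J n \<tau>" by (simp add: not_less le_antisym)
  qed simp
qed


section \<open>Flows and level cuts in multigraphs\<close>

text \<open>One integer per edge, read as the flow from the smaller to the larger endpoint:
  antisymmetry holds by construction and a push changes a single memory cell.\<close>

definition edge_flow :: "(nat, nat) mgraph \<Rightarrow> (nat \<Rightarrow> int) \<Rightarrow> (nat, nat) flow_fun" where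
  "edge_flow G fl e u v =
     (if e \<in> edges G \<and> ends G e = {u, v} then (if u < v then fl e else if v < u then - fl e else 0) else 0)"

lemma preflow_edge_flow: "preflow G (edge_flow G fl)"
  unfolding preflow_def edge_flow_def by (auto simp: insert_commute)

lemma preflow_antisym: "preflow G f \<Longrightarrow> f e u v = - f e v u"
  unfolding preflow_def by blast

lemma sum_preflow_inside:
  assumes "preflow G f"
  shows "(\<Sum>v\<in>S. \<Sum>u\<in>S. \<Sum>e\<in>E. f e v u) = 0"
proof -
  have "(\<Sum>v\<in>S. \<Sum>u\<in>S. \<Sum>e\<in>E. f e v u) = (\<Sum>v\<in>S. \<Sum>u\<in>S. \<Sum>e\<in>E. f e u v)"
    by (rule sum.swap)
  also have "\<dots> = (\<Sum>v\<in>S. \<Sum>u\<in>S. \<Sum>e\<in>E. - f e v u)"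
    using preflow_antisym[OF assms] by (intro sum.cong refl) metis
  finally show ?thesis by (simp add: sum_negf)
qed

lemma amount_eq:
  assumes "preflow G f"
  shows "amount G \<Delta> f v = int (\<Delta> v) - (\<Sum>u\<in>verts G. \<Sum>e\<in>edges G. f e v u)"
proof -
  have "(\<Sum>u\<in>verts G. \<Sum>e\<in>edges G. f e u v) = (\<Sum>u\<in>verts G. \<Sum>e\<in>edges G. - f e v u)"
    using preflow_antisym[OF assms] by (intro sum.cong refl) metis
  then show ?thesis unfolding amount_def by (simp add: sum_negf)
qed

lemma sum_amount:
  assumes "preflow G f"
  shows "(\<Sum>v\<in>verts G. amount G \<Delta> f v) = (\<Sum>v\<in>verts G. int (\<Delta> v))"
  by (simp add: amount_eq[OF assms] sum_subtractf sum_preflow_inside[OF assms])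

lemma source_feasible_iff:
  assumes "preflow G f"
  shows "source_feasible G \<Delta> f \<longleftrightarrow> (\<forall>v\<in>verts G. amount G \<Delta> f v \<ge> 0)"
  unfolding source_feasible_def by (auto simp: amount_eq[OF assms])

text \<open>\<open>inc v j\<close> and \<open>nb v j\<close> are the edge and the far endpoint in
  the \<open>j\<close>-th cell of the list of \<open>v\<close>. Fixing this order makes the position
  of a scan a plain number.\<close>

locale incidence =
  fixes G :: "(nat, nat) mgraph" and inc nb :: "nat \<Rightarrow> nat \<Rightarrow> nat"
  assumes multigraph: "multigraph G"
    and inc_bij: "v \<in> verts G \<Longrightarrow> bij_betw (inc v) {..<deg G v} {e \<in> edges G. v \<in> ends G e}"
    and ends_inc: "v \<in> verts G \<Longrightarrow> j < deg G v \<Longrightarrow> ends G (inc v j) = {v, nb v j}"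
begin

abbreviation "V \<equiv> verts G"
abbreviation "E \<equiv> edges G"

lemma finite_V [simp]: "finite V" and finite_E [simp]: "finite E"
  using multigraph unfolding multigraph_def by auto

lemma inc_E: "v \<in> V \<Longrightarrow> j < deg G v \<Longrightarrow> inc v j \<in> E"
  using inc_bij[of v] unfolding bij_betw_def by auto

lemma nb_V: assumes "v \<in> V" "j < deg G v" shows "nb v j \<in> V" and "nb v j \<noteq> v"
proof -
  have "ends G (inc v j) \<subseteq> V" "card (ends G (inc v j)) = 2"
    using multigraph inc_E[OF assms] unfolding multigraph_def by auto
  then show "nb v j \<in> V" "nb v j \<noteq> v" using ends_inc[OF assms] by auto
qed

text \<open>An edge at \<open>v\<close> carries flow from \<open>v\<close> to its other endpoint
  only, so the double sum collapses to one term per list cell.\<close>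

lemma sum_incident:
  assumes v: "v \<in> V" and "W \<subseteq> V" and f: "preflow G f"
  shows "(\<Sum>u\<in>W. \<Sum>e\<in>E. f e v u) = (\<Sum>j | j < deg G v \<and> nb v j \<in> W. f (inc v j) v (nb v j))"
proof -
  have W: "finite W" using assms(2) finite_V finite_subset by blast
  have "(\<Sum>u\<in>W. \<Sum>e\<in>E. f e v u) = (\<Sum>e\<in>E. \<Sum>u\<in>W. f e v u)" by (rule sum.swap)
  also have "\<dots> = (\<Sum>e\<in>{e \<in> E. v \<in> ends G e}. \<Sum>u\<in>W. f e v u)"
  proof (rule sum.mono_neutral_right)
    have "f e v u = 0" if "e \<in> E - {e \<in> E. v \<in> ends G e}" for e u
    proof -
      have "ends G e \<noteq> {v, u}" using that by auto
      then show ?thesis using f unfolding preflow_def by blast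
    qed
    then show "\<forall>e\<in>E - {e \<in> E. v \<in> ends G e}. (\<Sum>u\<in>W. f e v u) = 0" by simp
  qed auto
  also have "\<dots> = (\<Sum>j<deg G v. \<Sum>u\<in>W. f (inc v j) v u)"
    using sum.reindex_bij_betw[OF inc_bij[OF v], of "\<lambda>e. \<Sum>u\<in>W. f e v u"] by simp
  also have "\<dots> = (\<Sum>j<deg G v. if nb v j \<in> W then f (inc v j) v (nb v j) else 0)"
  proof (intro sum.cong refl)
    fix j assume "j \<in> {..<deg G v}"
    then have j: "j < deg G v" by simp
    have z: "f (inc v j) v u = 0" if "u \<noteq> nb v j" for u
    proof -
      have "ends G (inc v j) \<noteq> {v, u}"
        using ends_inc[OF v j] nb_V(2)[OF v j] that by auto
      then show ?thesis using f unfolding preflow_def by blast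
    qed
    have "(\<Sum>u\<in>W. f (inc v j) v u) = (\<Sum>u\<in>W. if u = nb v j then f (inc v j) v u else 0)"
      using z by (intro sum.cong) auto
    then show "(\<Sum>u\<in>W. f (inc v j) v u) = (if nb v j \<in> W then f (inc v j) v (nb v j) else 0)"
      using W by simp
  qed
  also have "\<dots> = (\<Sum>j\<in>{j \<in> {..<deg G v}. nb v j \<in> W}. f (inc v j) v (nb v j))"
    by (rule sum.inter_filter[symmetric]) simp
  finally show ?thesis by simp
qed

text \<open>A cut edge has exactly one endpoint in \<open>S\<close> and is therefore represented by
  exactly one cell, the one in the list of that endpoint.\<close>

lemma cut_size_eq:
  assumes "S \<subseteq> V"
  shows "cut_size G S = (\<Sum>v\<in>S. card {j. j < deg G v \<and> nb v j \<in> V - S})"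
proof -
  have S: "finite S" using assms finite_V finite_subset by blast
  let ?A = "SIGMA v:S. {j. j < deg G v \<and> nb v j \<in> V - S}"
  have "bij_betw (\<lambda>(v, j). inc v j) ?A {e \<in> E. card (ends G e \<inter> S) = 1}"
    unfolding bij_betw_def
  proof
    show "inj_on (\<lambda>(v, j). inc v j) ?A"
    proof (rule inj_onI, clarify)
      fix v j v' j'
      assume *: "v \<in> S" "j < deg G v" "nb v j \<notin> S" "v' \<in> S" "j' < deg G v'"
        "nb v' j' \<notin> S" "inc v j = inc v' j'"
      then have "{v, nb v j} = {v', nb v' j'}" using assms ends_inc by (metis subsetD)
      then have "v = v'" using * by blast
      moreover have "inj_on (inc v) {..<deg G v}"
        using inc_bij[of v] * assms unfolding bij_betw_def by auto
      ultimately show "v = v' \<and> j = j'" using * by (auto dest: inj_onD)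
    qed
    show "(\<lambda>(v, j). inc v j) ` ?A = {e \<in> E. card (ends G e \<inter> S) = 1}"
    proof (intro equalityI subsetI)
      fix e assume "e \<in> (\<lambda>(v, j). inc v j) ` ?A"
      then obtain v j where *: "v \<in> S" "j < deg G v" "nb v j \<notin> S" "e = inc v j" by auto
      then have "ends G e \<inter> S = {v}" using ends_inc assms by auto
      then show "e \<in> {e \<in> E. card (ends G e \<inter> S) = 1}" using * inc_E assms by auto
    next
      fix e assume "e \<in> {e \<in> E. card (ends G e \<inter> S) = 1}"
      then obtain v where e: "e \<in> E" and v: "ends G e \<inter> S = {v}"
        by (auto simp: card_1_singleton_iff)
      then have vS: "v \<in> S" "v \<in> V" using assms by auto
      then obtain j where j: "j < deg G v" "e = inc v j"
        using inc_bij[of v] e v unfolding bij_betw_def by (smt (verit) IntE image_iff insertI1 lessThan_iff mem_Collect_eq)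
      have "nb v j \<in> V" "nb v j \<noteq> v" using nb_V[OF vS(2) j(1)] .
      moreover from this have "nb v j \<notin> S" using ends_inc[OF vS(2) j(1)] v j(2) by blast
      ultimately have "nb v j \<notin> S" "nb v j \<in> V" by auto
      then show "e \<in> (\<lambda>(v, j). inc v j) ` ?A" using j vS by force
    qed
  qed
  then have "card ?A = card {e \<in> E. card (ends G e \<inter> S) = 1}" by (rule bij_betw_same_card)
  then have "cut_size G S = card ?A" unfolding cut_size_def by simp
  then show ?thesis using S by simp
qed

text \<open>Every cut edge that drops at least two levels is saturated outwards, so the net flow out of a
  level set \<open>S\<close> bounds their number in terms of the supply \<open>\<Delta>(S) - T(S)\<close> and the number of edges that
  drop exactly one level. Since \<open>\<Delta>(S) \<le> F vol(S)\<close> and \<open>\<Delta>(V) \<le> T(V)\<close>, that supply is at most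
  \<open>F vol(S)\<close> and at most \<open>vol(V - S)\<close>.\<close>

lemma level_cut_sparse:
  fixes h F i :: nat and lev \<Delta> T :: "nat \<Rightarrow> nat"
  defines "S \<equiv> {v \<in> V. i \<le> lev v}"
  defines "z \<equiv> (\<Sum>v | v \<in> V \<and> lev v = i. card {j. j < deg G v \<and> Suc (lev (nb v j)) = i})"
  assumes f: "preflow G f" and hF: "h \<ge> 1" "F \<ge> 1" and i: "i \<ge> 1"
    and cap: "\<And>e u v. - (2 * int h * int F) \<le> f e u v"
    and steep: "\<And>v j. v \<in> V \<Longrightarrow> j < deg G v \<Longrightarrow> lev (nb v j) + 2 \<le> lev v \<Longrightarrow>
       f (inc v j) v (nb v j) = 2 * int h * int F"
    and am: "\<And>v. v \<in> S \<Longrightarrow> amount G \<Delta> f v \<ge> int (T v)"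
    and \<Delta>: "\<And>v. v \<in> V \<Longrightarrow> \<Delta> v \<le> F * deg G v" and T: "\<And>v. v \<in> V \<Longrightarrow> T v \<le> deg G v"
    and \<Delta>T: "(\<Sum>v\<in>V. \<Delta> v) \<le> (\<Sum>v\<in>V. T v)"
    and z1: "4 * h * z < vol G S" and z2: "4 * h * z < vol G (V - S)"
  shows "conductance G S < 1 / real h"
proof -
  let ?U = "2 * int h * int F"
  have SV: "S \<subseteq> V" unfolding S_def by auto
  then have S: "finite S" using finite_V finite_subset by blast
  define C where "C v = {j. j < deg G v \<and> nb v j \<in> V - S}" for v
  \<comment> \<open>Of the cut cells \<open>C v\<close>, those in \<open>B v\<close> drop exactly
    one level; no others can fail to be saturated.\<close>
  define B where "B v = (if lev v = i then {j. j < deg G v \<and> Suc (lev (nb v j)) = i} else {})" for v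
  have BC: "B v \<subseteq> C v" if "v \<in> V" for v
    using that nb_V unfolding B_def C_def S_def by auto
  have finC: "finite (C v)" for v unfolding C_def by simp
  have z: "z = (\<Sum>v\<in>S. card (B v))"
  proof -
    have "(\<Sum>v\<in>S. card (B v)) = (\<Sum>v\<in>{v \<in> S. lev v = i}. card {j. j < deg G v \<and> Suc (lev (nb v j)) = i})"
      unfolding B_def using S by (subst sum.inter_filter) (auto intro!: sum.cong)
    also have "{v \<in> S. lev v = i} = {v. v \<in> V \<and> lev v = i}" unfolding S_def by auto
    finally show ?thesis unfolding z_def by simp
  qed
  have cs: "cut_size G S = (\<Sum>v\<in>S. card (C v))" using cut_size_eq[OF SV] unfolding C_def .
  have out: "(\<Sum>v\<in>S. \<Sum>u\<in>V. \<Sum>e\<in>E. f e v u) = (\<Sum>v\<in>S. \<Sum>j\<in>C v. f (inc v j) v (nb v j))"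
  proof -
    have "(\<Sum>v\<in>S. \<Sum>u\<in>V. \<Sum>e\<in>E. f e v u) =
      (\<Sum>v\<in>S. (\<Sum>u\<in>V - S. \<Sum>e\<in>E. f e v u) + (\<Sum>u\<in>S. \<Sum>e\<in>E. f e v u))"
      using SV by (intro sum.cong refl sum.subset_diff) auto
    also have "\<dots> = (\<Sum>v\<in>S. (\<Sum>u\<in>V - S. \<Sum>e\<in>E. f e v u))"
      by (simp add: sum.distrib sum_preflow_inside[OF f])
    also have "\<dots> = (\<Sum>v\<in>S. \<Sum>j\<in>C v. f (inc v j) v (nb v j))"
      unfolding C_def using SV f by (intro sum.cong refl sum_incident) auto
    finally show ?thesis .
  qed
  \<comment> \<open>Cells outside \<open>B v\<close> contribute \<open>?U\<close>, those in
    \<open>B v\<close> at least \<open>- ?U\<close>. Each cell in \<open>B v\<close> thus costs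
    twice the capacity, whence the factor 2.\<close>
  have low: "?U * (int (card (C v)) - 2 * int (card (B v))) \<le> (\<Sum>j\<in>C v. f (inc v j) v (nb v j))"
    if v: "v \<in> S" for v
  proof -
    have vV: "v \<in> V" using v SV by auto
    have "f (inc v j) v (nb v j) = ?U" if j: "j \<in> C v - B v" for j
    proof (rule steep)
      have "i \<le> lev v" "lev (nb v j) < i" "j < deg G v" "\<not> (lev v = i \<and> Suc (lev (nb v j)) = i)"
        using v j unfolding S_def C_def B_def by auto
      then show "v \<in> V" "j < deg G v" "lev (nb v j) + 2 \<le> lev v" using vV by auto
    qed
    then have "(\<Sum>j\<in>C v - B v. f (inc v j) v (nb v j)) = ?U * int (card (C v - B v))" by simp
    moreover have "(\<Sum>j\<in>B v. f (inc v j) v (nb v j)) \<ge> (\<Sum>j\<in>B v. - ?U)"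
      by (intro sum_mono cap)
    moreover have "(\<Sum>j\<in>C v. f (inc v j) v (nb v j)) =
      (\<Sum>j\<in>C v - B v. f (inc v j) v (nb v j)) + (\<Sum>j\<in>B v. f (inc v j) v (nb v j))"
      using BC[OF vV] finC by (intro sum.subset_diff) auto
    moreover have "int (card (C v - B v)) = int (card (C v)) - int (card (B v))"
      using BC[OF vV] finC[of v] by (metis card_Diff_subset card_mono finite_subset of_nat_diff)
    ultimately show ?thesis by (simp add: algebra_simps)
  qed
  have "?U * (int (cut_size G S) - 2 * int z) = (\<Sum>v\<in>S. ?U * (int (card (C v)) - 2 * int (card (B v))))"
    unfolding cs z by (simp add: sum_distrib_left sum_subtractf algebra_simps)
  also have "\<dots> \<le> (\<Sum>v\<in>S. \<Sum>u\<in>V. \<Sum>e\<in>E. f e v u)"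
    unfolding out by (intro sum_mono low)
  also have "\<dots> = (\<Sum>v\<in>S. int (\<Delta> v) - amount G \<Delta> f v)"
    by (simp add: amount_eq[OF f])
  also have "\<dots> \<le> (\<Sum>v\<in>S. int (\<Delta> v) - int (T v))"
    using am by (intro sum_mono) auto
  finally have net: "?U * (int (cut_size G S) - 2 * int z) \<le> int (\<Sum>v\<in>S. \<Delta> v) - int (\<Sum>v\<in>S. T v)"
    by (simp add: sum_subtractf)
  have "(\<Sum>v\<in>S. \<Delta> v) \<le> F * vol G S"
    unfolding vol_def sum_distrib_left using \<Delta> SV by (intro sum_mono) auto
  then have n1: "?U * (int (cut_size G S) - 2 * int z) \<le> int F * int (vol G S)"
    using net by (smt (verit) of_nat_0_le_iff of_nat_le_iff of_nat_mult)
  \<comment> \<open>Seen from the complement: \<Delta>(S) - T(S) \<le> \<Delta>(V) - T(S) \<le> T(V)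
    - T(S) = T(V - S).\<close>
  have "(\<Sum>v\<in>V - S. T v) \<le> vol G (V - S)"
    unfolding vol_def using T by (intro sum_mono) auto
  moreover have "(\<Sum>v\<in>V. T v) = (\<Sum>v\<in>V - S. T v) + (\<Sum>v\<in>S. T v)"
    using SV by (intro sum.subset_diff) auto
  moreover have "(\<Sum>v\<in>S. \<Delta> v) \<le> (\<Sum>v\<in>V. \<Delta> v)" using SV by (intro sum_mono2) auto
  ultimately have "int (\<Sum>v\<in>S. \<Delta> v) - int (\<Sum>v\<in>S. T v) \<le> int (vol G (V - S))"
    using \<Delta>T by linarith
  also have "\<dots> \<le> int F * int (vol G (V - S))" using hF by (simp add: mult_le_cancel_right1)
  finally have n2: "?U * (int (cut_size G S) - 2 * int z) \<le> int F * int (vol G (V - S))"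
    using net by linarith
  let ?m = "min (vol G S) (vol G (V - S))"
  have m: "4 * h * z < ?m" using z1 z2 by simp
  have "int F * (2 * int h * (int (cut_size G S) - 2 * int z)) \<le> int F * int ?m"
    using n1 n2 by (auto simp: min_def algebra_simps)
  then have "2 * int h * (int (cut_size G S) - 2 * int z) \<le> int ?m"
    using hF by (auto simp only: mult_le_cancel_left) 
  \<comment> \<open>Here the factor 4 in \<open>z1\<close> and \<open>z2\<close> is spent: the
    right-hand side is below \<open>2 * ?m\<close>.\<close>
  then have "2 * int (h * cut_size G S) \<le> int ?m + int (4 * h * z)"
    by (simp add: algebra_simps)
  then have "h * cut_size G S < ?m" using m by linarith
  then have "real (cut_size G S) * real h < real ?m"
    by (metis mult.commute of_nat_less_iff of_nat_mult)
  then show ?thesis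
    unfolding conductance_def using hF m by (auto simp: divide_simps mult.commute)
qed

end

section \<open>Region growing over the levels\<close>

lemma doubling:
  fixes g :: "nat \<Rightarrow> nat"
  assumes "\<And>j. j < c * k \<Longrightarrow> c * g j + g j \<le> c * g (Suc j)" and "0 < c"
  shows "2 ^ k * g 0 \<le> g (c * k)"
  using assms(1)
proof (induction k)
  case (Suc k)
  \<comment> \<open>The hypothesis is growth by the factor 1 + 1/c, multiplied by \<open>c\<close>
    to stay within the natural numbers.\<close>
  have step: "c * g (c * k + n) + g (c * k + n) \<le> c * g (c * k + Suc n)" if "n < c" for n
    using Suc.prems[of "c * k + n"] that by simp
  have mono: "g (c * k) \<le> g (c * k + n)" if "n \<le> c" for n
    using that
  proof (induction n)
    case (Suc n)
    then have "c * g (c * k + n) \<le> c * g (c * k + Suc n)" using step[of n] by linarith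
    then show ?case using Suc assms(2) by simp
  qed simp
  \<comment> \<open>Bernoulli: by monotonicity each of the \<open>c\<close> increments is at least
    \<open>g (c * k) / c\<close>, so together they double the value.\<close>
  have "c * g (c * k) + n * g (c * k) \<le> c * g (c * k + n)" if "n \<le> c" for n
    using that
  proof (induction n)
    case (Suc n)
    then show ?case using mono[of n] step[of n] by simp
  qed simp
  moreover have "c * g (c * k) + c * g (c * k) = c * (2 * g (c * k))" "c * k + c = c * Suc k" by simp_all
  ultimately have "c * (2 * g (c * k)) \<le> c * g (c * Suc k)" using order_refl[of c] by metis
  then have "2 * g (c * k) \<le> g (c * Suc k)" by (simp only: nat_mult_le_cancel1[OF assms(2)])
  moreover have "2 ^ k * g 0 \<le> g (c * k)" using Suc by simp
  ultimately show ?case by simp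
qed simp

text \<open>If no level is good, then \<open>a\<close> doubles every \<open>c\<close> levels on the way down as long as it is the smaller
  of the two sides, and \<open>1 + a 1 - a i\<close> does so on the way up as long as it is the smaller side; one of
  the two happens on \<open>c * k\<close> levels.\<close>

lemma good_level:
  fixes a z :: "nat \<Rightarrow> nat"
  assumes anti: "\<And>i. 1 \<le> i \<Longrightarrow> a (Suc i) + z (Suc i) \<le> a i"
    and top: "1 \<le> a L" and bot: "a 1 < 2 ^ k" and L: "2 * (c * k) \<le> L" and c: "0 < c" and k: "0 < k"
  shows "\<exists>i. 1 \<le> i \<and> i \<le> L \<and> c * z i < a i \<and> c * z i < 1 + a 1 - a i"
proof (rule ccontr)
  assume "\<not> ?thesis"
  then have bad: "a i \<le> c * z i \<or> 1 + a 1 - a i \<le> c * z i" if "1 \<le> i" "i \<le> L" for i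
    using that by (meson not_le)
  have step: "a j \<le> a i" if "1 \<le> i" "i \<le> j" for i j
    using that(2,1)
  proof (induction rule: dec_induct)
    case (step n)
    then show ?case using anti[of n] by auto
  qed simp
  have ck: "0 < c * k" using c k by simp
  show False
  \<comment> \<open>The split asks which side is smaller after the first \<open>c * k\<close> steps.
    If it is \<open>a\<close>, it stays smaller on all higher levels and at least
    \<open>c * k\<close> of them remain; otherwise the complement was smaller on all levels so
    far.\<close>
  proof (cases "2 * a (Suc (c * k)) \<le> 1 + a 1")
    case True
    define g where "g j = a (L - j)" for j
    have "2 ^ k * g 0 \<le> g (c * k)"
    proof (rule doubling[OF _ c])
      fix j assume j: "j < c * k"
      define i where "i = L - Suc j"
      have i: "Suc i \<le> L" "c * k \<le> i" "1 \<le> i" "Suc i = L - j"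
        using j L ck unfolding i_def by linarith+
      have "2 * a (Suc i) \<le> 1 + a 1" using step[of "Suc (c * k)" "Suc i"] i True by auto
      then have "a (Suc i) \<le> c * z (Suc i)" using bad[of "Suc i"] i by auto
      moreover have "c * (a (Suc i) + z (Suc i)) \<le> c * a i" using anti[OF i(3)] by (rule mult_left_mono) simp
      ultimately show "c * g j + g j \<le> c * g (Suc j)"
        unfolding g_def i(4)[symmetric] i_def[symmetric] by (simp add: algebra_simps)
    qed
    moreover have "g (c * k) \<le> a 1" unfolding g_def using step[of 1 "L - c * k"] L ck by linarith
    moreover have "2 ^ k * 1 \<le> 2 ^ k * g 0" unfolding g_def using top by simp
    ultimately show False using bot by linarith
  next
    case False
    define g where "g j = 1 + a 1 - a (Suc j)" for j
    have "2 ^ k * g 0 \<le> g (c * k)"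
    proof (rule doubling[OF _ c])
      fix j assume j: "j < c * k"
      have "a (Suc (c * k)) \<le> a (Suc (Suc j))" using step[of "Suc (Suc j)" "Suc (c * k)"] j by auto
      then have "\<not> 2 * a (Suc (Suc j)) \<le> 1 + a 1" using False by linarith
      then have "1 + a 1 - a (Suc (Suc j)) \<le> c * z (Suc (Suc j))"
        using bad[of "Suc (Suc j)"] j L by auto
      moreover have A: "a (Suc (Suc j)) + z (Suc (Suc j)) \<le> a (Suc j)" "a (Suc j) \<le> a 1"
        using anti[of "Suc j"] step[of 1 "Suc j"] by auto
      have "g j + z (Suc (Suc j)) \<le> g (Suc j)" using A unfolding g_def by linarith
      then have "c * (g j + z (Suc (Suc j))) \<le> c * g (Suc j)" by (rule mult_left_mono) simp
      moreover have "g j \<le> g (Suc j)" using A unfolding g_def by linarith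
      ultimately show "c * g j + g j \<le> c * g (Suc j)"
        unfolding g_def by (simp add: algebra_simps)
    qed
    \<comment> \<open>The added 1 is essential for the growth of the complement, which would
      otherwise start at 0.\<close>
    moreover have "g 0 = 1" unfolding g_def by simp
    ultimately show False using False bot unfolding g_def by simp
  qed
qed


section \<open>The unit push-relabel algorithm\<close>

lemma sum_change:
  fixes g g' :: "'a \<Rightarrow> nat"
  assumes "finite A" "x \<in> A" "\<And>v. v \<in> A \<Longrightarrow> v \<noteq> x \<Longrightarrow> g' v = g v"
  shows "sum g' A + g x = sum g A + g' x"
proof -
  have "sum g' (A - {x}) = sum g (A - {x})" using assms(3) by (intro sum.cong) auto
  then show ?thesis using sum.remove[OF assms(1,2), of g] sum.remove[OF assms(1,2), of g'] by simp
qed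

text \<open>The queue consists of the active nodes in the order of their levels. Units are taken from the
  front of the queue and moved one at a time, \<open>node\<close> being the position of the current unit. The level
  of the front of the queue is \<open>base\<close> until that node is relabelled. No node with units
  below \<open>base\<close> exists apart from \<open>node\<close>, so that units never move to a node with a positive pile.\<close>

record conf =
  level :: "nat \<Rightarrow> nat"
  scanned :: "nat \<Rightarrow> nat"
  absorbed :: "nat \<Rightarrow> nat"
  pile :: "nat \<Rightarrow> nat"
  flow :: "nat \<Rightarrow> int"
  queue :: "nat list"
  node :: nat
  base :: nat
  seen :: nat
  expo :: nat
  pops :: nat
  marked :: "nat list"

text \<open>One increment of \<open>expo\<close> suffices: \<open>seen c < 2 ^ expo c\<close> can
  break only by reaching equality.\<close>

definition grow :: "conf \<Rightarrow> conf" where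
  "grow c = c\<lparr>seen := Suc (seen c), expo := (if 2 ^ expo c \<le> Suc (seen c) then Suc (expo c) else expo c)\<rparr>"

definition advance :: "conf \<Rightarrow> conf" where
  "advance c = c\<lparr>scanned := (scanned c)(node c := Suc (scanned c (node c)))\<rparr>"

definition absorb :: "conf \<Rightarrow> conf" where
  "absorb c = c\<lparr>pile := (pile c)(node c := pile c (node c) - 1),
     absorbed := (absorbed c)(node c := Suc (absorbed c (node c))), node := hd (queue c)\<rparr>"

definition pop :: "conf \<Rightarrow> conf" where
  "pop c = (let c' = c\<lparr>queue := tl (queue c), pops := Suc (pops c)\<rparr> in
     if tl (queue c) = [] then c'
     else c'\<lparr>node := hd (tl (queue c)), base := level c (hd (tl (queue c)))\<rparr>)"

text \<open>Below \<open>base\<close> the current unit keeps climbing with its node. A node raised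
  above \<open>base\<close> is appended; since no level exceeds \<open>Suc (base c)\<close>, the
  queue remains sorted. If this node is the front itself, its old entry becomes stale and is popped
  next.\<close>

definition relabel :: "conf \<Rightarrow> conf" where
  "relabel c = (let x = node c;
       c' = c\<lparr>level := (level c)(x := Suc (level c x)), scanned := (scanned c)(x := 0),
         marked := (if level c x = 0 then marked c @ [x] else marked c)\<rparr> in
     if level c x < base c then c' else c'\<lparr>queue := queue c @ [x], node := hd (queue c)\<rparr>)"

definition push :: "nat \<Rightarrow> nat \<Rightarrow> conf \<Rightarrow> conf" where
  "push e u c = (let x = node c in
     c\<lparr>flow := (flow c)(e := (if x < u then flow c e + 1 else flow c e - 1)),
       pile := (pile c)(x := pile c x - 1, u := Suc (pile c u)), node := u\<rparr>)"

lemma grow_simps [simp]: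
  "level (grow c) = level c" "scanned (grow c) = scanned c" "absorbed (grow c) = absorbed c"
  "pile (grow c) = pile c" "flow (grow c) = flow c" "queue (grow c) = queue c"
  "node (grow c) = node c" "base (grow c) = base c" "seen (grow c) = Suc (seen c)"
  "expo (grow c) = (if 2 ^ expo c \<le> Suc (seen c) then Suc (expo c) else expo c)"
  "pops (grow c) = pops c" "marked (grow c) = marked c"
  by (simp_all add: grow_def)

lemma advance_simps [simp]:
  "level (advance c) = level c"
  "scanned (advance c) = (scanned c)(node c := Suc (scanned c (node c)))"
  "absorbed (advance c) = absorbed c" "pile (advance c) = pile c" "flow (advance c) = flow c"
  "queue (advance c) = queue c" "node (advance c) = node c" "base (advance c) = base c"
  "seen (advance c) = seen c" "expo (advance c) = expo c" "pops (advance c) = pops c"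
  "marked (advance c) = marked c"
  by (simp_all add: advance_def)

lemma absorb_simps [simp]:
  "level (absorb c) = level c" "scanned (absorb c) = scanned c"
  "absorbed (absorb c) = (absorbed c)(node c := Suc (absorbed c (node c)))"
  "pile (absorb c) = (pile c)(node c := pile c (node c) - 1)" "flow (absorb c) = flow c"
  "queue (absorb c) = queue c" "node (absorb c) = hd (queue c)" "base (absorb c) = base c"
  "seen (absorb c) = seen c" "expo (absorb c) = expo c" "pops (absorb c) = pops c"
  "marked (absorb c) = marked c"
  by (simp_all add: absorb_def)

lemmas ops = grow_simps advance_simps absorb_simps

section \<open>Invariants and the progress measure\<close>

locale flow_instance = incidence +
  fixes h F :: nat and \<Delta> T :: "nat \<Rightarrow> nat"
  assumes h: "h \<ge> 1" and F: "F \<ge> 1"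
    and \<Delta>: "\<And>v. v \<in> verts G \<Longrightarrow> \<Delta> v \<le> F * deg G v"
    and T: "\<And>v. v \<in> verts G \<Longrightarrow> T v \<le> deg G v"
    and \<Delta>T: "(\<Sum>v\<in>verts G. \<Delta> v) \<le> (\<Sum>v\<in>verts G. T v)"
begin

abbreviation "U \<equiv> 2 * int h * int F"
abbreviation "ef c \<equiv> edge_flow G (flow c)"

text \<open>The field \<open>scanned\<close> has two roles. At level 0 it counts incidences: a node
  with \<open>T v = deg v\<close> scans one cell per absorbed unit, any other node scans only once
  its sink is full. At positive level it is the current arc, and no earlier cell admits a push. The
  clause on edges within level 0 allows the output to ignore all nodes there.\<close>

definition flow_inv :: "conf \<Rightarrow> bool" where
  "flow_inv c \<longleftrightarrow>
     (\<forall>v\<in>V. absorbed c v \<le> T v \<and> scanned c v \<le> deg G v \<and> pile c v \<le> F * deg G v \<and>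
        amount G \<Delta> (ef c) v = int (absorbed c v + pile c v) \<and>
        (0 < level c v \<longrightarrow> absorbed c v = T v \<and> 0 < deg G v) \<and>
        (level c v = 0 \<longrightarrow> T v = deg G v \<longrightarrow> absorbed c v = scanned c v) \<and>
        (level c v = 0 \<longrightarrow> T v < deg G v \<longrightarrow> 0 < scanned c v \<longrightarrow> absorbed c v = T v) \<and>
        (\<forall>j<deg G v. level c (nb v j) + 2 \<le> level c v \<or> j < scanned c v \<and> level c (nb v j) < level c v \<longrightarrow>
           ef c (inc v j) v (nb v j) = U) \<and>
        (\<forall>j<deg G v. level c v = 0 \<longrightarrow> level c (nb v j) = 0 \<longrightarrow> flow c (inc v j) = 0)) \<and>
     (\<forall>e. \<bar>flow c e\<bar> \<le> U)"

text \<open>The front is kept apart from the rest \<open>Q\<close>: it may have run dry, or have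
  been raised, and then it occurs in \<open>Q\<close> again if it holds units. If
  \<open>node c\<close> differs from the front, it carries exactly one travelling unit. The last
  disjunction records the only way to reach the height: a front popped at exactly that level, with
  units, and with no node higher.\<close>

definition queue_inv :: "conf \<Rightarrow> bool" where
  "queue_inv c \<longleftrightarrow> (case queue c of
       [] \<Rightarrow> \<forall>y\<in>V. pile c y = 0
     | v # Q \<Rightarrow> v \<in> V \<and> node c \<in> V \<and> set Q \<subseteq> V \<and> distinct Q \<and>
        (\<forall>y\<in>set Q. 0 < pile c y \<and> base c \<le> level c y) \<and>
        sorted_wrt (\<lambda>y z. level c y \<le> level c z) Q \<and>
        base c \<le> level c v \<and> (\<forall>y\<in>V. level c y \<le> Suc (base c)) \<and>
        (\<forall>y\<in>V. 0 < pile c y \<longrightarrow> y = node c \<or> y = v \<or> y \<in> set Q) \<and>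
        (node c \<noteq> v \<longrightarrow> node c \<notin> set Q \<and> level c (node c) \<le> base c \<and> pile c (node c) = 1) \<and>
        (level c v = base c \<longrightarrow> v \<notin> set Q) \<and>
        (level c v \<noteq> base c \<longrightarrow> 0 < pile c v \<longrightarrow> v \<in> set Q) \<and>
        (base c < 8 * h * expo c \<or>
         base c = 8 * h * expo c \<and> node c = v \<and> 0 < pile c v \<and> level c v = base c \<and>
           (\<forall>y\<in>V. level c y \<le> base c)))"

text \<open>Relabelling resets \<open>scanned\<close>. A node of positive level still counts with
  its full degree, because its list was scanned to the end before it left level 0.\<close>

definition visited :: "(nat \<Rightarrow> nat) \<Rightarrow> (nat \<Rightarrow> nat) \<Rightarrow> nat" where
  "visited lev sc = (\<Sum>v\<in>V. if 0 < lev v then deg G v else sc v)"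

text \<open>Minimality of \<open>expo\<close> bounds the height from above,
  \<open>seen c < 2 ^ expo c\<close> makes the height sufficient. The last clause holds because
  every queue entry is a source or stems from a relabelling.\<close>

definition count_inv :: "conf \<Rightarrow> bool" where
  "count_inv c \<longleftrightarrow>
     distinct (marked c) \<and> set (marked c) = {v \<in> V. 0 < level c v} \<and>
     seen c = visited (level c) (scanned c) \<and>
     1 \<le> expo c \<and> seen c < 2 ^ expo c \<and> (expo c = 1 \<or> 2 ^ (expo c - 1) \<le> seen c) \<and>
     (\<forall>y\<in>V. level c y \<le> 8 * h * expo c) \<and>
     pops c + length (queue c) \<le> (\<Sum>v\<in>V. \<Delta> v) + (\<Sum>v\<in>V. level c v)"

definition inv :: "conf \<Rightarrow> bool" where
  "inv c \<longleftrightarrow> flow_inv c \<and> queue_inv c \<and> count_inv c"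

definition running :: "conf \<Rightarrow> bool" where
  "running c \<longleftrightarrow> queue c \<noteq> [] \<and> base c < 8 * h * expo c"

definition active :: "conf \<Rightarrow> bool" where
  "active c \<longleftrightarrow> 0 < pile c (node c) \<and> level c (node c) \<le> base c"

text \<open>The summands pay, in this order, for pops, absorptions, scans, relabellings and pushes,
  and none ever decreases: relabelling trades \<open>scanned = deg\<close> for one more level, and
  absorption happens at level 0, where the potential has weight 0.\<close>

definition progress :: "conf \<Rightarrow> nat" where
  "progress c = pops c + (\<Sum>v\<in>V. absorbed c v) + (\<Sum>v\<in>V. level c v * deg G v + scanned c v) +
     (\<Sum>v\<in>V. level c v) + (\<Sum>v\<in>V. (F * deg G v - pile c v) * level c v)"

section \<open>Each step keeps the invariant and raises the progress\<close>

lemma count_inv_absorb: "count_inv (absorb c) \<longleftrightarrow> count_inv c"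
  unfolding count_inv_def ops ..

lemma pop_simps [simp]:
  "level (pop c) = level c" "scanned (pop c) = scanned c" "absorbed (pop c) = absorbed c"
  "pile (pop c) = pile c" "flow (pop c) = flow c" "queue (pop c) = tl (queue c)"
  "seen (pop c) = seen c" "expo (pop c) = expo c" "pops (pop c) = Suc (pops c)" "marked (pop c) = marked c"
  by (simp_all add: pop_def Let_def)

lemma node_V: "inv c \<Longrightarrow> running c \<Longrightarrow> node c \<in> V"
  unfolding inv_def queue_inv_def running_def by (auto split: list.splits)

lemma deg_node: assumes "inv c" "running c" "active c" shows "0 < deg G (node c)"
  using node_V[OF assms(1,2)] assms unfolding inv_def flow_inv_def active_def
  by (metis bot_nat_0.extremum_unique mult_0_right neq0_conv)

lemma sum_V_change:
  assumes "x \<in> V" "\<And>v. v \<noteq> x \<Longrightarrow> g' v = g v"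
  shows "sum g' V + g x = sum g V + (g' x :: nat)"
  using sum_change[of V x g' g] assms by simp

text \<open>Inactivity forces \<open>node c\<close> to be the front, since a travelling unit is
  always active. The front is then empty, or it was raised and queued again; dropping the entry
  loses no units.\<close>

lemma inv_pop:
  assumes I: "inv c" and r: "running c" and a: "\<not> active c"
  shows "inv (pop c) \<and> progress c < progress (pop c)"
proof -
  obtain v Q where q: "queue c = v # Q" using r unfolding running_def by (cases "queue c") auto
  have Q: "queue_inv c" using I unfolding inv_def by simp
  have x: "node c = v" using Q a unfolding queue_inv_def q active_def by auto
  have "flow_inv (pop c)"
    using I unfolding inv_def flow_inv_def pop_def Let_def by simp
  moreover have "count_inv (pop c)"
    using I unfolding inv_def count_inv_def pop_simps q by auto
  moreover have "queue_inv (pop c)"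
  proof (cases Q)
    case Nil
    then show ?thesis
      using Q a x unfolding queue_inv_def q pop_def active_def by (auto simp: not_less)
  next
    case (Cons w Q')
    then show ?thesis
      using Q a x r unfolding queue_inv_def q pop_def active_def running_def
      by (auto simp: not_less Let_def)
  qed
  moreover have "progress c < progress (pop c)"
    unfolding progress_def pop_def Let_def by simp
  ultimately show ?thesis unfolding inv_def by simp
qed

lemma queue_inv_absorb:
  assumes Q: "queue_inv c" and r: "running c" and a: "active c"
  shows "queue_inv (absorb c)"
proof -
  obtain v Q where q: "queue c = v # Q" using r unfolding running_def by (cases "queue c") auto
  show ?thesis
    using Q a r unfolding queue_inv_def q active_def running_def ops by auto
qed

lemma progress_absorb:
  assumes x: "node c \<in> V" and lev: "level c (node c) = 0"
  shows "progress (absorb c) = Suc (progress c)"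
proof -
  have "sum (absorbed (absorb c)) V = Suc (sum (absorbed c) V)"
    using sum_V_change[OF x, of "absorbed (absorb c)" "absorbed c"] by simp
  moreover have "(\<Sum>v\<in>V. (F * deg G v - pile (absorb c) v) * level c v) =
      (\<Sum>v\<in>V. (F * deg G v - pile c v) * level c v)"
    using lev by (intro sum.cong) auto
  ultimately show ?thesis unfolding progress_def by (simp del: absorb_simps(3,4))
qed

lemma inv_absorb:
  assumes I: "inv c" and r: "running c" and a: "active c"
    and lev: "level c (node c) = 0" and T: "T (node c) < deg G (node c)"
    and room: "absorbed c (node c) < T (node c)"
  shows "inv (absorb c) \<and> progress c < progress (absorb c)"
proof -
  note x = node_V[OF I r]
  have "flow_inv (absorb c)"
    using I lev T room a unfolding inv_def flow_inv_def active_def ops by auto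
  moreover have "count_inv (absorb c)"
    using I unfolding inv_def count_inv_absorb by simp
  moreover have "progress c < progress (absorb c)" using progress_absorb[of c] x lev by simp
  ultimately show ?thesis using queue_inv_absorb[OF _ r a] I unfolding inv_def by simp
qed

lemma queue_inv_advance: "queue_inv (advance c) \<longleftrightarrow> queue_inv c"
  unfolding queue_inv_def ops ..

lemma queue_inv_grow: "queue_inv c \<Longrightarrow> running c \<Longrightarrow> queue_inv (grow c)"
proof -
  assume Q: "queue_inv c" and r: "running c"
  obtain v W where q: "queue c = v # W" using r unfolding running_def by (cases "queue c") auto
  have "8 * h * expo c \<le> 8 * h * expo (grow c)" by simp
  then have "base c < 8 * h * expo (grow c)" using r unfolding running_def by linarith
  then show ?thesis using Q unfolding queue_inv_def grow_simps(1,4,6-8) q by simp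
qed

text \<open>At level 0 every scanned cell is a new incidence. Later scans of the same list reveal
  nothing, as \<open>visited\<close> already contains the full degree.\<close>

lemma count_inv_scan_0:
  assumes "count_inv c" "node c \<in> V" "level c (node c) = 0"
  shows "count_inv (grow (advance c))"
proof -
  have "visited (level c) (scanned (advance c)) = Suc (visited (level c) (scanned c))"
    using sum_V_change[OF assms(2), of "\<lambda>v. if 0 < level c v then deg G v else scanned (advance c) v"
       "\<lambda>v. if 0 < level c v then deg G v else scanned c v"] assms(3)
    unfolding visited_def ops by simp
  moreover have "level c y \<le> 8 * h * Suc (expo c)" if "level c y \<le> 8 * h * expo c" for y
    using that by simp
  ultimately show ?thesis
    using assms(1) unfolding count_inv_def ops by auto
qed

lemma progress_scan:
  assumes "node c \<in> V"
  shows "progress (advance c) = Suc (progress c)"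
  using sum_V_change[OF assms, of "\<lambda>v. level c v * deg G v + scanned (advance c) v"
    "\<lambda>v. level c v * deg G v + scanned c v"]
  unfolding progress_def ops by simp

lemma progress_grow: "progress (grow c) = progress c"
  unfolding progress_def ops by simp

text \<open>From level 0 nothing can be pushed. This scan only adds the degree of the node to
  \<open>seen\<close> before the node may rise.\<close>

lemma inv_scan_saturated:
  assumes I: "inv c" and r: "running c" and a: "active c"
    and lev: "level c (node c) = 0" and T: "T (node c) < deg G (node c)"
    and full: "absorbed c (node c) = T (node c)" and s: "scanned c (node c) < deg G (node c)"
  shows "inv (grow (advance c)) \<and> progress c < progress (grow (advance c))"
proof -
  note x = node_V[OF I r]
  have "flow_inv (grow (advance c))"
    using I lev T full s unfolding inv_def flow_inv_def ops by auto
  moreover have "queue_inv (grow (advance c))"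
    using I r by (intro queue_inv_grow) (auto simp: inv_def queue_inv_advance running_def)
  ultimately show ?thesis
    using count_inv_scan_0[of c] I x lev progress_scan[OF x] progress_grow unfolding inv_def by simp
qed

lemma inv_scan_absorb:
  assumes I: "inv c" and r: "running c" and a: "active c"
    and lev: "level c (node c) = 0" and T: "T (node c) = deg G (node c)"
    and s: "scanned c (node c) < deg G (node c)"
  shows "inv (absorb (grow (advance c))) \<and> progress c < progress (absorb (grow (advance c)))"
proof -
  note x = node_V[OF I r]
  let ?c = "grow (advance c)"
  have nd: "node ?c = node c" unfolding ops by simp
  have r': "running ?c" "active ?c"
    using r a unfolding running_def active_def ops by (auto intro: less_le_trans)
  have "flow_inv (absorb ?c)"
    using I lev T s a unfolding inv_def flow_inv_def active_def ops by auto
  moreover have "queue_inv ?c"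
    using I r by (intro queue_inv_grow) (auto simp: inv_def queue_inv_advance running_def)
  moreover have "count_inv (absorb ?c)"
    using count_inv_scan_0[of c] I x lev unfolding inv_def count_inv_absorb by simp
  moreover have "progress ?c < progress (absorb ?c)" using progress_absorb[of ?c] x lev by simp
  ultimately show ?thesis
    using queue_inv_absorb[OF _ r'] progress_scan[OF x] progress_grow unfolding inv_def by simp
qed

text \<open>Skipping the cell is sound in all cases: a neighbour one level lower is covered by
  \<open>adm\<close>, one that is lower still by the invariant, and any other needs no saturated
  edge.\<close>

lemma inv_scan:
  assumes I: "inv c" and r: "running c" and a: "active c"
    and lev: "0 < level c (node c)" and s: "scanned c (node c) < deg G (node c)"
    and adm: "Suc (level c (nb (node c) (scanned c (node c)))) = level c (node c) \<Longrightarrow>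
       ef c (inc (node c) (scanned c (node c))) (node c) (nb (node c) (scanned c (node c))) = U"
  shows "inv (advance c) \<and> progress c < progress (advance c)"
proof -
  note x = node_V[OF I r]
  have "flow_inv (advance c)"
  proof -
    have "ef c (inc v j) v (nb v j) = U" if "v \<in> V" "j < deg G v" "j < scanned (advance c) v"
      "level c (nb v j) < level c v" for v j
    proof (cases "v = node c \<and> j = scanned c v")
      case True
      show ?thesis
      proof (cases "Suc (level c (nb v j)) = level c v")
        case True
        then show ?thesis using adm \<open>v = node c \<and> j = scanned c v\<close> by simp
      next
        case False
        then show ?thesis using I that unfolding inv_def flow_inv_def by auto
      qed
    next
      case False
      then have "j < scanned c v" using that(3) unfolding ops by (auto split: if_splits)
      then show ?thesis using I that unfolding inv_def flow_inv_def by blast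
    qed
    then show ?thesis
      using I s lev unfolding inv_def flow_inv_def ops by auto
  qed
  moreover have "queue_inv (advance c)" "count_inv (advance c)"
  proof -
    show "queue_inv (advance c)"
      using I unfolding inv_def queue_inv_advance by simp
    have "visited (level c) (scanned (advance c)) = visited (level c) (scanned c)"
      using lev unfolding visited_def ops by (intro sum.cong) auto
    then show "count_inv (advance c)"
      using I unfolding inv_def count_inv_def ops by auto
  qed
  ultimately show ?thesis using progress_scan[OF x] unfolding inv_def by simp
qed

text \<open>After a complete scan all edges from the node to lower levels are saturated, which is
  what is required of edges dropping two levels once the node is raised. Raising it only shortens
  the drops of edges towards it.\<close>

lemma inv_relabel:
  assumes I: "inv c" and r: "running c" and a: "active c"
    and s: "scanned c (node c) = deg G (node c)"
    and full: "absorbed c (node c) = T (node c)"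
  shows "inv (relabel c) \<and> progress c < progress (relabel c)"
proof -
  note x = node_V[OF I r]
  define x where "x = node c"
  have xV: "x \<in> V" using x x_def by simp
  obtain v Q where q: "queue c = v # Q" using r unfolding running_def by (cases "queue c") auto
  have lv: "level (relabel c) = (level c)(x := Suc (level c x))"
    and sc: "scanned (relabel c) = (scanned c)(x := 0)"
    and same: "absorbed (relabel c) = absorbed c" "pile (relabel c) = pile c" "flow (relabel c) = flow c"
      "base (relabel c) = base c" "seen (relabel c) = seen c" "expo (relabel c) = expo c"
      "pops (relabel c) = pops c"
    and mk: "marked (relabel c) = (if level c x = 0 then marked c @ [x] else marked c)"
    unfolding relabel_def Let_def x_def by auto
  have fi: "flow_inv c" using I unfolding inv_def by simp
  have "flow_inv (relabel c)"
  proof -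
    have 1: "ef c (inc w j) w (nb w j) = U"
      if "w \<in> V" "j < deg G w" and l: "level (relabel c) (nb w j) + 2 \<le> level (relabel c) w \<or>
          j < scanned (relabel c) w \<and> level (relabel c) (nb w j) < level (relabel c) w" for w j
    proof (cases "w = x")
      case True
      then have "nb w j \<noteq> x" using nb_V(2)[OF that(1,2)] by simp
      then have "level c (nb w j) < level c w" "j < scanned c w"
        using l True s that(2) unfolding lv sc x_def by auto
      then show ?thesis using fi that unfolding flow_inv_def by blast
    next
      case False
      then have "level c (nb w j) + 2 \<le> level c w \<or> j < scanned c w \<and> level c (nb w j) < level c w"
        using l unfolding lv sc by (auto split: if_splits)
      then show ?thesis using fi that unfolding flow_inv_def by blast
    qed
    have d: "0 < deg G x" using deg_node[OF I r a] unfolding x_def .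
    show ?thesis
      unfolding flow_inv_def same
    proof (intro conjI ballI)
      fix w assume w: "w \<in> V"
      show "\<forall>j<deg G w. level (relabel c) (nb w j) + 2 \<le> level (relabel c) w \<or>
          j < scanned (relabel c) w \<and> level (relabel c) (nb w j) < level (relabel c) w \<longrightarrow>
          ef c (inc w j) w (nb w j) = U"
        using 1[OF w] by blast
      show "0 < level (relabel c) w \<longrightarrow> absorbed c w = T w \<and> 0 < deg G w" 
        using fi w d full unfolding flow_inv_def lv x_def by auto
    qed (use fi in \<open>auto simp: flow_inv_def lv sc\<close>)
  qed
  moreover have "queue_inv (relabel c)"
  proof -
    have Q: "queue_inv c" using I unfolding inv_def by simp
    show ?thesis
    proof (cases "level c x < base c")
      case True
      then have *: "queue (relabel c) = v # Q" "node (relabel c) = x"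
        using q unfolding relabel_def Let_def x_def by auto
      have xv: "x \<noteq> v" "x \<notin> set Q" using Q True unfolding queue_inv_def q by auto
      have "sorted_wrt (\<lambda>y z. level (relabel c) y \<le> level (relabel c) z) Q"
        using Q xv unfolding queue_inv_def q lv by (auto elim!: sorted_wrt_mono_rel[rotated])
      then show ?thesis
        using Q r True xv unfolding queue_inv_def * same q running_def lv x_def by auto
    next
      case False
      then have lx: "level c x = base c" using a unfolding active_def x_def by simp
      have *: "queue (relabel c) = v # (Q @ [x])" "node (relabel c) = v"
        using q False unfolding relabel_def Let_def x_def by auto
      have xQ: "x \<notin> set Q" using Q lx unfolding queue_inv_def q x_def by auto
      have "sorted_wrt (\<lambda>y z. level (relabel c) y \<le> level (relabel c) z) Q"
        using Q xQ unfolding queue_inv_def q lv by (auto elim!: sorted_wrt_mono_rel[rotated])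
      then have "sorted_wrt (\<lambda>y z. level (relabel c) y \<le> level (relabel c) z) (Q @ [x])"
        using Q xQ lx unfolding queue_inv_def q sorted_wrt_append lv by auto
      then show ?thesis
        using Q r lx xQ xV a unfolding queue_inv_def * same q running_def lv active_def x_def
        by auto
    qed
  qed
  moreover have slv: "(\<Sum>v\<in>V. level (relabel c) v) = Suc (\<Sum>v\<in>V. level c v)"
    using sum_V_change[OF xV, of "level (relabel c)" "level c"] unfolding lv by simp
  moreover have "count_inv (relabel c)"
  proof -
    \<comment> \<open>At level 0 the complete scan has already counted the whole degree, so leaving
      that level changes nothing.\<close>
    have "visited (level (relabel c)) (scanned (relabel c)) = visited (level c) (scanned c)"
      using s unfolding visited_def lv sc x_def by (intro sum.cong) auto
    moreover have "level (relabel c) y \<le> 8 * h * expo c" if "y \<in> V" for y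
      using I that r a unfolding inv_def count_inv_def running_def active_def lv x_def by auto
    moreover have "length (queue (relabel c)) \<le> Suc (length (queue c))"
      unfolding relabel_def Let_def by auto
    moreover have "distinct (marked (relabel c)) \<and> set (marked (relabel c)) = {v \<in> V. 0 < level (relabel c) v}"
      using I xV unfolding inv_def count_inv_def mk lv by (auto split: if_splits)
    ultimately show ?thesis
      using I unfolding inv_def count_inv_def same slv by auto
  qed
  moreover have "progress c < progress (relabel c)"
  proof -
    have "(\<Sum>v\<in>V. level (relabel c) v * deg G v + scanned (relabel c) v) =
        (\<Sum>v\<in>V. level c v * deg G v + scanned c v)"
      using s unfolding lv sc x_def by (intro sum.cong) auto
    moreover have "(\<Sum>v\<in>V. (F * deg G v - pile c v) * level c v) \<le>
        (\<Sum>v\<in>V. (F * deg G v - pile c v) * level (relabel c) v)"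
      unfolding lv by (intro sum_mono) auto
    ultimately show ?thesis unfolding progress_def same slv by simp
  qed
  ultimately show ?thesis unfolding inv_def by simp
qed

lemma edge_flow_push:
  assumes "e \<in> E" "ends G e = {x, u}" "x \<noteq> u"
  shows "edge_flow G (fl(e := (if x < u then fl e + 1 else fl e - 1))) e' a b =
     edge_flow G fl e' a b + (if e' = e \<and> a = x \<and> b = u then 1 else if e' = e \<and> a = u \<and> b = x then - 1 else 0)"
  using assms unfolding edge_flow_def by (auto simp: doubleton_eq_iff)

lemma amount_push:
  assumes "e \<in> E" "ends G e = {x, u}" "x \<noteq> u" "x \<in> V" "u \<in> V"
  shows "amount G \<Delta> (edge_flow G (fl(e := (if x < u then fl e + 1 else fl e - 1)))) v =
     amount G \<Delta> (edge_flow G fl) v + (if v = u then 1 else if v = x then - 1 else 0)"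
proof -
  have "(\<Sum>w\<in>V. \<Sum>e'\<in>E. if e' = e \<and> w = x \<and> v = u then 1 else if e' = e \<and> w = u \<and> v = x then - 1 else (0::int)) =
     (\<Sum>w\<in>V. if w = x \<and> v = u then 1 else if w = u \<and> v = x then - 1 else 0)"
  proof (intro sum.cong refl)
    fix w
    have "(\<Sum>e'\<in>E. if e' = e \<and> w = x \<and> v = u then 1 else if e' = e \<and> w = u \<and> v = x then - 1 else (0::int)) =
      (\<Sum>e'\<in>E. if e' = e then (if w = x \<and> v = u then 1 else if w = u \<and> v = x then - 1 else 0) else 0)"
      by (intro sum.cong) auto
    then show "(\<Sum>e'\<in>E. if e' = e \<and> w = x \<and> v = u then 1 else if e' = e \<and> w = u \<and> v = x then - 1 else (0::int)) =
      (if w = x \<and> v = u then 1 else if w = u \<and> v = x then - 1 else 0)" using assms(1) by simp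
  qed
  also have "\<dots> = (if v = u then 1 else if v = x then - 1 else 0)"
  proof (cases "v = u")
    case True
    then have "(\<Sum>w\<in>V. if w = x \<and> v = u then 1 else if w = u \<and> v = x then - 1 else (0::int)) =
       (\<Sum>w\<in>V. if w = x then 1 else 0)" using assms(3) by (intro sum.cong) auto
    then show ?thesis using assms True by simp
  next
    case False
    then have "(\<Sum>w\<in>V. if w = x \<and> v = u then 1 else if w = u \<and> v = x then - 1 else (0::int)) =
       (\<Sum>w\<in>V. if w = u then (if v = x then - 1 else 0) else 0)" by (intro sum.cong) auto
    then show ?thesis using assms False by simp
  qed
  finally show ?thesis
    unfolding amount_def edge_flow_push[OF assms(1-3)] by (simp add: sum.distrib)
qed

text \<open>The target lies below \<open>base\<close>, where no node except the current one holds
  units. It receives the unit on an empty pile, and its positive degree keeps the pile bound. The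
  edge loses saturation only in the uphill direction, on which the invariant imposes
  nothing.\<close>

lemma inv_push:
  fixes c
  defines "x \<equiv> node c"
  defines "e \<equiv> inc x (scanned c x)" and "u \<equiv> nb x (scanned c x)"
  assumes I: "inv c" and r: "running c" and a: "active c"
    and s: "scanned c x < deg G x" and lev: "Suc (level c u) = level c x"
    and res: "ef c e x u < U"
  shows "inv (push e u c) \<and> progress c < progress (push e u c)"
proof -
  have xV: "x \<in> V" using node_V[OF I r] unfolding x_def .
  have eE: "e \<in> E" and en: "ends G e = {x, u}" and uV: "u \<in> V" and xu: "x \<noteq> u"
    using inc_E[OF xV s] ends_inc[OF xV s] nb_V[OF xV s] unfolding e_def u_def by auto
  obtain v Q where q: "queue c = v # Q" using r unfolding running_def by (cases "queue c") auto
  have fi: "flow_inv c" and Q: "queue_inv c" using I unfolding inv_def by auto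
  have px: "0 < pile c x" "level c x \<le> base c" using a unfolding active_def x_def by auto
  have uvQ: "u \<noteq> v" "u \<notin> set Q"
    using Q px(2) lev unfolding queue_inv_def q by auto
  then have pu: "pile c u = 0" using Q xu uV unfolding queue_inv_def q x_def by auto
  have fl: "flow (push e u c) = (flow c)(e := (if x < u then flow c e + 1 else flow c e - 1))"
    and pl: "pile (push e u c) = (pile c)(x := pile c x - 1, u := 1)"
    and same: "level (push e u c) = level c" "scanned (push e u c) = scanned c" "absorbed (push e u c) = absorbed c"
      "queue (push e u c) = queue c" "base (push e u c) = base c" "seen (push e u c) = seen c"
      "expo (push e u c) = expo c" "pops (push e u c) = pops c" "marked (push e u c) = marked c"
      "node (push e u c) = u"
    using pu xu unfolding push_def Let_def x_def by auto
  have ef': "ef (push e u c) e' w y = ef c e' w y +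
      (if e' = e \<and> w = x \<and> y = u then 1 else if e' = e \<and> w = u \<and> y = x then - 1 else 0)" for e' w y
    unfolding fl by (rule edge_flow_push[OF eE en xu])
  have du: "0 < deg G u"
    unfolding deg_def using eE en finite_E by (auto simp: card_gt_0_iff)
  have "flow_inv (push e u c)"
    unfolding flow_inv_def same
  proof (intro conjI ballI)
    fix w assume w: "w \<in> V"
    show "amount G \<Delta> (ef (push e u c)) w = int (absorbed c w + pile (push e u c) w)"
      using fi w px(1) pu xu unfolding fl amount_push[OF eE en xu xV uV] flow_inv_def pl by auto
    show "pile (push e u c) w \<le> F * deg G w"
      using fi w du F unfolding flow_inv_def pl by (auto simp: le_diff_conv2 intro: le_trans[OF diff_le_self])
    show "\<forall>j<deg G w. level c (nb w j) + 2 \<le> level c w \<or> j < scanned c w \<and> level c (nb w j) < level c w \<longrightarrow>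
      ef (push e u c) (inc w j) w (nb w j) = U"
    proof (intro allI impI)
      fix j assume j: "j < deg G w"
        "level c (nb w j) + 2 \<le> level c w \<or> j < scanned c w \<and> level c (nb w j) < level c w"
      then have "ef c (inc w j) w (nb w j) = U" using fi w unfolding flow_inv_def by blast
      moreover from this have "\<not> (inc w j = e \<and> w = x \<and> nb w j = u)" using res by auto
      moreover have "\<not> (inc w j = e \<and> w = u \<and> nb w j = x)" using j lev by auto
      ultimately show "ef (push e u c) (inc w j) w (nb w j) = U" unfolding ef' by simp
    qed
    show "\<forall>j<deg G w. level c w = 0 \<longrightarrow> level c (nb w j) = 0 \<longrightarrow> flow (push e u c) (inc w j) = 0"
    proof (intro allI impI)
      fix j assume j: "j < deg G w" "level c w = 0" "level c (nb w j) = 0"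
      have "inc w j \<noteq> e"
      proof
        assume "inc w j = e"
        then have "{w, nb w j} = {x, u}" using en ends_inc[OF w j(1)] by simp
        then have "level c x = 0" using j by (auto simp: doubleton_eq_iff)
        then show False using lev by simp
      qed
      then show "flow (push e u c) (inc w j) = 0" using fi w j unfolding flow_inv_def fl by simp
    qed
  next
    show "\<forall>e'. \<bar>flow (push e u c) e'\<bar> \<le> U"
    proof
      fix e'
      have "\<bar>flow c e'\<bar> \<le> U" using fi unfolding flow_inv_def by blast
      moreover have "x < u \<Longrightarrow> flow c e < U" "\<not> x < u \<Longrightarrow> - U < flow c e"
        using res eE en xu unfolding edge_flow_def by (auto split: if_splits)
      ultimately show "\<bar>flow (push e u c) e'\<bar> \<le> U" unfolding fl by auto
    qed
  qed (use fi in \<open>auto simp: flow_inv_def\<close>)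
  moreover have "queue_inv (push e u c)"
    using Q uvQ uV px lev xu r unfolding queue_inv_def same q pl x_def running_def by auto
  moreover have "count_inv (push e u c)"
    using I unfolding inv_def count_inv_def same by blast
  moreover have "progress c < progress (push e u c)"
  proof -
    \<comment> \<open>The potential gains \<open>level c x\<close> at \<open>x\<close> and loses
      \<open>level c u\<close> at \<open>u\<close>, a net gain of 1. The intermediate piles
      \<open>p1\<close> separate the two changes.\<close>
    define p1 where "p1 = (pile c)(x := pile c x - 1)"
    have px2: "pile c x \<le> F * deg G x" using fi xV unfolding flow_inv_def by blast
    have "1 \<le> F * deg G u" using F du by (simp add: Suc_le_eq)
    then have 2: "(F * deg G u - 1) * level c u + level c u = F * deg G u * level c u"
      by (metis (no_types) add.commute le_add_diff_inverse mult.commute mult_1_right distrib_left)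
    have 1: "(F * deg G x - (pile c x - 1)) * level c x = (F * deg G x - pile c x) * level c x + level c x"
    proof -
      have "F * deg G x - (pile c x - 1) = Suc (F * deg G x - pile c x)" using px px2 by linarith
      then show ?thesis by simp
    qed
    have "(\<Sum>v\<in>V. (F * deg G v - p1 v) * level c v) + (F * deg G x - pile c x) * level c x =
        (\<Sum>v\<in>V. (F * deg G v - pile c v) * level c v) + (F * deg G x - (pile c x - 1)) * level c x"
      using sum_V_change[OF xV, of "\<lambda>v. (F * deg G v - p1 v) * level c v"
        "\<lambda>v. (F * deg G v - pile c v) * level c v"] unfolding p1_def by simp
    moreover have "(\<Sum>v\<in>V. (F * deg G v - pile (push e u c) v) * level c v) + F * deg G u * level c u =
        (\<Sum>v\<in>V. (F * deg G v - p1 v) * level c v) + (F * deg G u - 1) * level c u"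
      using sum_V_change[OF uV, of "\<lambda>v. (F * deg G v - pile (push e u c) v) * level c v"
        "\<lambda>v. (F * deg G v - p1 v) * level c v"] xu pu unfolding pl p1_def by simp
    ultimately have "(\<Sum>v\<in>V. (F * deg G v - pile c v) * level c v) <
       (\<Sum>v\<in>V. (F * deg G v - pile (push e u c) v) * level c v)"
      using 1 2 lev by linarith
    then show ?thesis unfolding progress_def same by simp
  qed
  ultimately show ?thesis unfolding inv_def by simp
qed

end


section \<open>Bounds and cuts from the final configuration\<close>

context flow_instance
begin

section \<open>Local volume bounds behind the running time\<close>

definition size_bound :: nat where
  "size_bound = (\<Sum>v\<in>V. \<Delta> v) + (\<Sum>v\<in>V. deg G v - T v)"

lemma sum_absorbed_pile:
  assumes "inv c"
  shows "(\<Sum>v\<in>V. absorbed c v) + (\<Sum>v\<in>V. pile c v) = (\<Sum>v\<in>V. \<Delta> v)"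
proof -
  have "(\<Sum>v\<in>V. int (\<Delta> v)) = (\<Sum>v\<in>V. amount G \<Delta> (ef c) v)"
    using sum_amount[OF preflow_edge_flow] by simp
  also have "\<dots> = (\<Sum>v\<in>V. int (absorbed c v + pile c v))"
    using assms unfolding inv_def flow_inv_def by (intro sum.cong) auto
  finally have "int (\<Sum>v\<in>V. \<Delta> v) = int ((\<Sum>v\<in>V. absorbed c v) + (\<Sum>v\<in>V. pile c v))"
    by (simp add: sum.distrib)
  then show ?thesis by linarith
qed

text \<open>The degree splits into \<open>T v\<close>, which full sinks have absorbed and the supply
  therefore bounds, and \<open>deg G v - T v\<close>. This is what makes the algorithm
  local.\<close>

lemma saturated_volume:
  assumes I: "inv c" and S: "S \<subseteq> V" "\<And>v. v \<in> S \<Longrightarrow> absorbed c v = T v"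
  shows "(\<Sum>v\<in>S. deg G v) \<le> size_bound"
proof -
  have "(\<Sum>v\<in>S. deg G v) = (\<Sum>v\<in>S. absorbed c v) + (\<Sum>v\<in>S. deg G v - T v)"
    using S T by (subst sum.distrib[symmetric]) (auto intro!: sum.cong)
  moreover have "(\<Sum>v\<in>S. absorbed c v) \<le> (\<Sum>v\<in>V. absorbed c v)"
    using S by (intro sum_mono2) auto
  moreover have "(\<Sum>v\<in>S. deg G v - T v) \<le> (\<Sum>v\<in>V. deg G v - T v)"
    using S by (intro sum_mono2) auto
  ultimately show ?thesis using sum_absorbed_pile[OF I] unfolding size_bound_def by linarith
qed

lemma saturated_sum:
  assumes I: "inv c"
  shows "(\<Sum>v\<in>V. if absorbed c v = T v then deg G v else 0) \<le> size_bound"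
proof -
  have "(\<Sum>v\<in>V. if absorbed c v = T v then deg G v else 0) = (\<Sum>v\<in>{v \<in> V. absorbed c v = T v}. deg G v)"
    by (rule sum.inter_filter[symmetric]) simp
  also have "\<dots> \<le> size_bound" by (rule saturated_volume[OF I]) auto
  finally show ?thesis .
qed

text \<open>A scan is paid for by absorbed units if \<open>T v = deg G v\<close>, and by the degree
  of a node with full sink otherwise.\<close>

lemma scanned_le:
  assumes "inv c" "v \<in> V"
  shows "scanned c v \<le> absorbed c v + (if absorbed c v = T v then deg G v else 0)"
proof -
  have f: "scanned c v \<le> deg G v" "T v \<le> deg G v" "0 < level c v \<longrightarrow> absorbed c v = T v"
    "level c v = 0 \<longrightarrow> T v = deg G v \<longrightarrow> absorbed c v = scanned c v"
    "level c v = 0 \<longrightarrow> T v < deg G v \<longrightarrow> 0 < scanned c v \<longrightarrow> absorbed c v = T v"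
    using assms T unfolding inv_def flow_inv_def by auto
  then show ?thesis by (cases "level c v = 0"; cases "T v = deg G v"; cases "scanned c v = 0") auto
qed

lemma seen_le:
  assumes I: "inv c"
  shows "seen c \<le> 2 * size_bound"
proof -
  have "seen c = visited (level c) (scanned c)" using I unfolding inv_def count_inv_def by blast
  also have "\<dots> \<le> (\<Sum>v\<in>V. absorbed c v + (if absorbed c v = T v then deg G v else 0))"
    unfolding visited_def
  proof (intro sum_mono)
    fix v assume v: "v \<in> V"
    then have "0 < level c v \<longrightarrow> absorbed c v = T v" using I unfolding inv_def flow_inv_def by auto
    then show "(if 0 < level c v then deg G v else scanned c v) \<le>
        absorbed c v + (if absorbed c v = T v then deg G v else 0)"
      using scanned_le[OF I v] by auto
  qed
  also have "\<dots> \<le> size_bound + size_bound"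
    unfolding sum.distrib using saturated_sum[OF I] sum_absorbed_pile[OF I]
    by (intro add_mono) (auto simp: size_bound_def)
  finally show ?thesis by simp
qed

text \<open>The height varies during the run, but \<open>K\<close> bounds it throughout and replaces
  \<open>expo\<close> in all running times.\<close>

lemma expo_le:
  assumes I: "inv c" and K: "2 * size_bound < 2 ^ K" "1 \<le> K"
  shows "expo c \<le> K"
proof -
  have "expo c = 1 \<or> 2 ^ (expo c - 1) \<le> seen c" "1 \<le> expo c"
    using I unfolding inv_def count_inv_def by auto
  moreover have "expo c - 1 < K" if "2 ^ (expo c - 1) \<le> seen c"
  proof -
    have "2 ^ (expo c - 1) < (2::nat) ^ K" using that seen_le[OF I] K by linarith
    then show ?thesis by simp
  qed
  ultimately show ?thesis using K(2) by linarith
qed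

lemma level_sum_le:
  assumes I: "inv c"
  shows "(\<Sum>v\<in>V. level c v * deg G v) \<le> 8 * h * expo c * size_bound"
    and "(\<Sum>v\<in>V. level c v) \<le> 8 * h * expo c * size_bound"
proof -
  let ?H = "8 * h * expo c"
  have 1: "level c v * deg G v \<le> ?H * (if absorbed c v = T v then deg G v else 0)" 
     "level c v \<le> level c v * deg G v" if v: "v \<in> V" for v
  proof -
    have f: "level c v \<le> ?H" "0 < level c v \<longrightarrow> absorbed c v = T v \<and> 0 < deg G v"
      using I v unfolding inv_def count_inv_def flow_inv_def by auto
    show "level c v \<le> level c v * deg G v" using f by (cases "level c v = 0") auto
    show "level c v * deg G v \<le> ?H * (if absorbed c v = T v then deg G v else 0)"
      using f by (cases "level c v = 0") (auto intro: mult_right_mono)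
  qed
  have "(\<Sum>v\<in>V. level c v * deg G v) \<le> (\<Sum>v\<in>V. ?H * (if absorbed c v = T v then deg G v else 0))"
    using 1 by (intro sum_mono) auto
  also have "\<dots> = ?H * (\<Sum>v\<in>V. if absorbed c v = T v then deg G v else 0)"
    by (rule sum_distrib_left[symmetric])
  also have "\<dots> \<le> ?H * size_bound" using saturated_sum[OF I] by (rule mult_left_mono) simp
  finally show A: "(\<Sum>v\<in>V. level c v * deg G v) \<le> ?H * size_bound" .
  have "(\<Sum>v\<in>V. level c v) \<le> (\<Sum>v\<in>V. level c v * deg G v)" using 1 by (intro sum_mono) auto
  then show "(\<Sum>v\<in>V. level c v) \<le> ?H * size_bound" using A by linarith
qed

lemma progress_le:
  assumes I: "inv c" and K: "2 * size_bound < 2 ^ K" "1 \<le> K"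
  shows "progress c \<le> 40 * h * F * K * size_bound"
proof -
  let ?X = "h * K * size_bound"
  have X: "8 * h * expo c * size_bound \<le> 8 * ?X" 
    using expo_le[OF assms] by (simp add: mult_le_mono)
  have 1: "(\<Sum>v\<in>V. scanned c v) \<le> 2 * size_bound"
  proof -
    have "(\<Sum>v\<in>V. scanned c v) \<le> (\<Sum>v\<in>V. absorbed c v + (if absorbed c v = T v then deg G v else 0))"
      using scanned_le[OF I] by (intro sum_mono) auto
    also have "\<dots> \<le> size_bound + size_bound"
      unfolding sum.distrib using saturated_sum[OF I] sum_absorbed_pile[OF I]
      by (intro add_mono) (auto simp: size_bound_def)
    finally show ?thesis by simp
  qed
  have 2: "(\<Sum>v\<in>V. (F * deg G v - pile c v) * level c v) \<le> F * (8 * ?X)"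
  proof -
    have "(\<Sum>v\<in>V. (F * deg G v - pile c v) * level c v) \<le> (\<Sum>v\<in>V. F * (level c v * deg G v))"
      by (intro sum_mono) (metis diff_le_self mult.assoc mult.commute mult_le_mono1)
    also have "\<dots> = F * (\<Sum>v\<in>V. level c v * deg G v)" by (rule sum_distrib_left[symmetric])
    also have "\<dots> \<le> F * (8 * ?X)" using level_sum_le(1)[OF I] X by (intro mult_left_mono) linarith+
    finally show ?thesis .
  qed
  have 3: "pops c \<le> size_bound + (\<Sum>v\<in>V. level c v)"
    using I unfolding inv_def count_inv_def size_bound_def by linarith
  have 4: "(\<Sum>v\<in>V. absorbed c v) \<le> size_bound"
    using sum_absorbed_pile[OF I] unfolding size_bound_def by linarith
  \<comment> \<open>Pops, absorptions and scans use \<open>size_bound\<close> once, once and twice.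
    The three terms \<open>8 * ?X\<close> are the level sums of scans, relabellings and
    pops.\<close>
  have "progress c \<le> 4 * size_bound + 3 * (8 * ?X) + F * (8 * ?X)"
    unfolding progress_def sum.distrib using level_sum_le[OF I] X 1 2 3 4 by linarith
  moreover have "size_bound \<le> ?X" using h K by (simp add: Suc_le_eq)
  moreover have "?X \<le> F * ?X" using F by simp
  ultimately have "progress c \<le> 40 * (F * ?X)" by linarith
  then show ?thesis by (simp add: algebra_simps)
qed

section \<open>Level volumes and the sparse level cut\<close>

definition lvol :: "conf \<Rightarrow> nat \<Rightarrow> nat" where
  "lvol c i = (\<Sum>v | v \<in> V \<and> level c v = i. deg G v)"

definition drops :: "conf \<Rightarrow> nat \<Rightarrow> nat" where
  "drops c i = (\<Sum>v | v \<in> V \<and> level c v = i. card {j. j < deg G v \<and> Suc (level c (nb v j)) = i})"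

definition above :: "conf \<Rightarrow> nat \<Rightarrow> nat" where
  "above c i = vol G {v \<in> V. i \<le> level c v}"

lemma above_Suc: "above c i = above c (Suc i) + lvol c i"
proof -
  have "{v \<in> V. i \<le> level c v} = {v \<in> V. Suc i \<le> level c v} \<union> {v. v \<in> V \<and> level c v = i}" by auto
  moreover have "{v \<in> V. Suc i \<le> level c v} \<inter> {v. v \<in> V \<and> level c v = i} = {}" by auto
  ultimately show ?thesis
    unfolding above_def vol_def lvol_def by (simp add: sum.union_disjoint)
qed

text \<open>An edge that drops from level \<open>i + 1\<close> to level \<open>i\<close> is counted at its lower end in the volume of
  level \<open>i\<close>.\<close>

lemma drops_le_lvol: "drops c (Suc i) \<le> lvol c i"
proof -
  let ?A = "SIGMA v:{v. v \<in> V \<and> level c v = Suc i}. {j. j < deg G v \<and> Suc (level c (nb v j)) = Suc i}"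
  let ?B = "SIGMA w:{w. w \<in> V \<and> level c w = i}. {e \<in> E. w \<in> ends G e}"
  have "inj_on (\<lambda>(v, j). (nb v j, inc v j)) ?A"
  proof (rule inj_onI, clarify)
    fix v j v' j'
    assume *: "v \<in> V" "j < deg G v" "v' \<in> V" "j' < deg G v'" "nb v j = nb v' j'" "inc v j = inc v' j'"
    then have "{v, nb v j} = {v', nb v j}" using ends_inc by metis
    then have "v = v'" by (metis doubleton_eq_iff)
    then show "v = v' \<and> j = j'"
      using * inc_bij[of v] unfolding bij_betw_def by (auto dest: inj_onD)
  qed
  moreover have "(\<lambda>(v, j). (nb v j, inc v j)) ` ?A \<subseteq> ?B"
    using nb_V inc_E ends_inc by auto
  moreover have "finite ?B" by (intro finite_SigmaI) auto
  ultimately have "card ?A \<le> card ?B" by (rule card_inj_on_le)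
  then show ?thesis unfolding drops_def lvol_def deg_def by simp
qed

lemma above_le_seen: assumes "inv c" shows "above c 1 \<le> seen c"
proof -
  have "above c 1 = (\<Sum>v\<in>V. if 0 < level c v then deg G v else 0)"
    unfolding above_def vol_def by (subst sum.inter_filter[symmetric]) (auto simp: Suc_le_eq)
  also have "\<dots> \<le> visited (level c) (scanned c)" unfolding visited_def by (intro sum_mono) auto
  finally show ?thesis using assms unfolding inv_def count_inv_def by simp
qed

text \<open>When the loop ends, units are piled only at positive levels, where the sinks are full.
  Hence no pile still has room in its sink and every pile is excess.\<close>

lemma excess_eq:
  assumes I: "inv c" and r: "\<not> running c" and v: "v \<in> V"
  shows "excess G \<Delta> T (ef c) v = int (pile c v)"
proof -
  have a: "amount G \<Delta> (ef c) v = int (absorbed c v + pile c v)" "absorbed c v \<le> T v"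
    "0 < level c v \<longrightarrow> absorbed c v = T v"
    using I v unfolding inv_def flow_inv_def by auto
  have "pile c v = 0 \<or> 0 < level c v"
  proof (cases "queue c")
    case Nil
    then show ?thesis using I v unfolding inv_def queue_inv_def by auto
  next
    case (Cons w Q)
    then have "0 < base c"
      using I r h unfolding inv_def queue_inv_def running_def count_inv_def by auto
    then show ?thesis
      using Cons I r v unfolding inv_def queue_inv_def running_def by fastforce
  qed
  then show ?thesis unfolding excess_def using a by auto
qed

lemma total_excess_eq:
  assumes "inv c" "\<not> running c"
  shows "total_excess G \<Delta> T (ef c) = int (\<Sum>v\<in>V. pile c v)"
  unfolding total_excess_def using excess_eq[OF assms] by simp

lemma source_feasible_ef: "inv c \<Longrightarrow> source_feasible G \<Delta> (ef c)"
  unfolding source_feasible_iff[OF preflow_edge_flow] inv_def flow_inv_def by simp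

lemma abs_ef_le: "inv c \<Longrightarrow> \<bar>ef c e u v\<bar> \<le> U"
  unfolding edge_flow_def inv_def flow_inv_def by (auto simp: abs_le_iff)

lemma congestion_ef: assumes "inv c" shows "congestion G (ef c) \<le> U"
proof -
  let ?X = "{ef c e u v | e u v. e \<in> E \<and> u \<in> V \<and> v \<in> V}"
  have "?X = (\<lambda>(e, u, v). ef c e u v) ` (E \<times> V \<times> V)" by force
  moreover have "finite (E \<times> V \<times> V)" by simp
  ultimately have "finite ?X" by simp
  moreover have "x \<le> U" if "x \<in> ?X" for x using that abs_ef_le[OF assms] by (auto simp: abs_le_iff)
  ultimately show ?thesis unfolding congestion_def by (subst Max_le_iff) auto
qed

lemma is_flow_ef:
  assumes I: "inv c" and "\<not> running c" "(\<Sum>v\<in>V. pile c v) = 0"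
  shows "is_flow G \<Delta> T (ef c)"
  using assms preflow_edge_flow source_feasible_ef[OF I]
  unfolding is_flow_def sink_feasible_def inv_def flow_inv_def by simp

text \<open>With units left the queue is nonempty, so the loop has stopped in the last case of
  \<open>queue_inv\<close>, with the front at the height and all other units at least as
  high.\<close>

lemma finished_base:
  assumes I: "inv c" and r: "\<not> running c" and p: "0 < (\<Sum>v\<in>V. pile c v)"
  shows "base c = 8 * h * expo c" and "\<And>v. v \<in> V \<Longrightarrow> 0 < pile c v \<Longrightarrow> base c \<le> level c v"
proof -
  have "\<exists>v\<in>V. 0 < pile c v" using p by (metis neq0_conv sum.neutral less_irrefl)
  then obtain w Q where q: "queue c = w # Q"
    using I unfolding inv_def queue_inv_def by (cases "queue c") auto
  show "base c = 8 * h * expo c"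
    using I r unfolding inv_def queue_inv_def q running_def by auto
  show "base c \<le> level c v" if "v \<in> V" "0 < pile c v" for v
    using I r that unfolding inv_def queue_inv_def q running_def by auto
qed

text \<open>The second inequality uses a computable lower bound for the volume of the complement,
  with 1 in place of level 0.\<close>

definition good :: "conf \<Rightarrow> nat \<Rightarrow> bool" where
  "good c i \<longleftrightarrow> 4 * h * drops c i < above c i \<and> 4 * h * drops c i < 1 + above c 1 - above c i"

text \<open>Region growing with rate \<open>4 * h\<close> and \<open>expo c\<close> doublings: the
  \<open>8 * h * expo c\<close> levels are just enough, as the volume at positive levels is at most
  \<open>seen c\<close>.\<close>

lemma exists_good:
  assumes I: "inv c" and r: "\<not> running c" and p: "0 < (\<Sum>v\<in>V. pile c v)"
  shows "\<exists>i. 1 \<le> i \<and> i \<le> base c \<and> good c i"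
  unfolding good_def
proof (rule good_level)
  show "above c (Suc i) + drops c (Suc i) \<le> above c i" for i
    using above_Suc[of c i] drops_le_lvol[of c i] by simp
  obtain v where v: "v \<in> V" "0 < pile c v" using p by (metis neq0_conv sum.neutral less_irrefl)
  have l: "base c \<le> level c v" using finished_base(2)[OF assms v] .
  have "pile c v \<le> F * deg G v" using I v unfolding inv_def flow_inv_def by blast
  then have "0 < deg G v" using v by (cases "deg G v") auto
  moreover have "deg G v \<le> (\<Sum>v | v \<in> V \<and> base c \<le> level c v. deg G v)"
    using v l by (intro member_le_sum) auto
  ultimately show "1 \<le> above c (base c)" unfolding above_def vol_def by linarith
  show "above c 1 < 2 ^ expo c"
    using above_le_seen[OF I] I unfolding inv_def count_inv_def by linarith
  show "2 * (4 * h * expo c) \<le> base c" using finished_base(1)[OF assms] by simp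
  show "0 < 4 * h" using h by simp
  show "0 < expo c" using I unfolding inv_def count_inv_def by linarith
qed

lemma good_cut:
  assumes I: "inv c" and r: "\<not> running c" and p: "0 < (\<Sum>v\<in>V. pile c v)"
    and i: "1 \<le> i" "i \<le> base c" and g: "good c i"
  defines "S \<equiv> {v \<in> V. i \<le> level c v}"
  shows "S \<subseteq> V" and "vol G S > 0" and "vol G (V - S) > 0" and "conductance G S < 1 / real h"
    and "(\<Sum>v\<in>V. pile c v) \<le> F * vol G S"
proof -
  have fi: "flow_inv c" using I unfolding inv_def by simp
  show SV: "S \<subseteq> V" unfolding S_def by auto
  have g1: "4 * h * drops c i < vol G S" using g unfolding good_def above_def S_def by simp
  then show "vol G S > 0" by simp
  \<comment> \<open>If level 0 had volume 0, all sinks would be full, and the absorbed units alone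
    would match the total sink capacity, leaving no supply for the piles.\<close>
  have pos: "0 < vol G {v \<in> V. level c v = 0}"
  proof (rule ccontr)
    assume "\<not> ?thesis"
    then have z: "deg G v = 0" if "v \<in> V" "level c v = 0" for v
      using that by (auto simp: vol_def)
    have "T v \<le> absorbed c v" if v: "v \<in> V" for v
      using fi T[OF v] z[OF v] v unfolding flow_inv_def by (cases "level c v = 0") auto
    then have "(\<Sum>v\<in>V. T v) \<le> (\<Sum>v\<in>V. absorbed c v)" by (intro sum_mono)
    then show False using p sum_absorbed_pile[OF I] \<Delta>T by linarith
  qed
  have "above c 1 - above c i + vol G {v \<in> V. level c v = 0} \<le> vol G (V - S)"
  proof -
    have "vol G V = vol G S + vol G (V - S)"
      unfolding vol_def using SV by (subst sum.subset_diff[of S V]) auto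
    moreover have "vol G V = above c 1 + vol G {v \<in> V. level c v = 0}"
    proof -
      have "V = {v \<in> V. 1 \<le> level c v} \<union> {v \<in> V. level c v = 0}" by auto
      then have "vol G V = vol G ({v \<in> V. 1 \<le> level c v} \<union> {v \<in> V. level c v = 0})" by simp
      also have "\<dots> = above c 1 + vol G {v \<in> V. level c v = 0}"
        unfolding above_def vol_def by (rule sum.union_disjoint) auto
      finally show ?thesis .
    qed
    moreover have "vol G S \<le> above c 1"
      unfolding above_def vol_def S_def using i(1) by (intro sum_mono2) auto
    ultimately show ?thesis unfolding above_def S_def by linarith
  qed
  then have "1 + above c 1 - above c i \<le> vol G (V - S)" using pos by linarith
  then have g2: "4 * h * drops c i < vol G (V - S)" using g unfolding good_def by linarith
  then show "vol G (V - S) > 0" by simp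
  show "conductance G S < 1 / real h"
    unfolding S_def
  proof (rule level_cut_sparse[where f = "ef c" and F = F and \<Delta> = \<Delta> and T = T])
    show "- U \<le> ef c e u v" for e u v using abs_ef_le[OF I, of e u v] by (auto simp: abs_le_iff)
    show "ef c (inc v j) v (nb v j) = U" if "v \<in> V" "j < deg G v" "level c (nb v j) + 2 \<le> level c v" for v j
      using fi that unfolding flow_inv_def by blast
    show "int (T v) \<le> amount G \<Delta> (ef c) v" if "v \<in> {v \<in> V. i \<le> level c v}" for v
      using fi that i(1) unfolding flow_inv_def by auto
  qed (use h F i \<Delta> T \<Delta>T g1 g2 preflow_edge_flow in \<open>auto simp: drops_def S_def\<close>)
  \<comment> \<open>All piles lie at level \<open>base c\<close> or higher, hence inside
    \<open>S\<close>, whichever good level is chosen.\<close>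
  have "(\<Sum>v\<in>V. pile c v) = (\<Sum>v\<in>S. pile c v)"
    using SV finished_base(2)[OF I r p] i(2) unfolding S_def
    by (intro sum.mono_neutral_right) (auto intro: ccontr dest: le_trans)
  also have "\<dots> \<le> (\<Sum>v\<in>S. F * deg G v)"
    using fi SV unfolding flow_inv_def by (intro sum_mono) auto
  finally show "(\<Sum>v\<in>V. pile c v) \<le> F * vol G S" unfolding vol_def sum_distrib_left .
qed

lemma marked_bounds:
  assumes I: "inv c"
  shows "(\<Sum>v | v \<in> V \<and> 0 < level c v. deg G v) \<le> size_bound"
    and "card {v \<in> V. 0 < level c v} \<le> size_bound"
proof -
  have fi: "flow_inv c" using I unfolding inv_def by simp
  show 1: "(\<Sum>v | v \<in> V \<and> 0 < level c v. deg G v) \<le> size_bound"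
    using fi unfolding flow_inv_def by (intro saturated_volume[OF I]) auto
  have "card {v \<in> V. 0 < level c v} = (\<Sum>v | v \<in> V \<and> 0 < level c v. 1)" by simp
  also have "\<dots> \<le> (\<Sum>v | v \<in> V \<and> 0 < level c v. deg G v)"
    using fi unfolding flow_inv_def by (intro sum_mono) (auto simp: Suc_le_eq)
  finally show "card {v \<in> V. 0 < level c v} \<le> size_bound" using 1 by linarith
qed

lemma unmarked_flow_zero:
  assumes I: "inv c" and "ef c e u v \<noteq> 0"
  shows "0 < level c u \<or> 0 < level c v"
proof (rule ccontr)
  assume n: "\<not> ?thesis"
  have e: "e \<in> E" "ends G e = {u, v}" "flow c e \<noteq> 0"
    using assms(2) unfolding edge_flow_def by (auto split: if_splits)
  then have u: "u \<in> V" "e \<in> {e \<in> E. u \<in> ends G e}"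
    using multigraph unfolding multigraph_def by auto
  moreover have "inc u ` {..<deg G u} = {e \<in> E. u \<in> ends G e}"
    using inc_bij[OF u(1)] unfolding bij_betw_def by blast
  ultimately obtain j where j: "j < deg G u" "e = inc u j" by auto
  have "{u, nb u j} = {u, v}" using ends_inc[OF u(1) j(1)] e j by simp
  then have "nb u j = v" by (metis doubleton_eq_iff)
  then show False using I u(1) j e(3) n unfolding inv_def flow_inv_def by auto
qed

text \<open>The handshake identity turns a logarithm of the local size into a logarithm of the
  number of edges.\<close>

lemma size_bound_le: "size_bound \<le> 4 * card E"
proof -
  have "(\<Sum>v\<in>V. deg G v) = (\<Sum>v\<in>V. \<Sum>e\<in>E. if v \<in> ends G e then 1 else 0)"
    unfolding deg_def by (intro sum.cong refl) (simp add: sum.If_cases Int_def)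
  also have "\<dots> = (\<Sum>e\<in>E. \<Sum>v\<in>V. if v \<in> ends G e then 1 else 0)" by (rule sum.swap)
  also have "\<dots> = (\<Sum>e\<in>E. 2)"
  proof (intro sum.cong refl)
    fix e assume "e \<in> E"
    then have "ends G e \<subseteq> V" "card (ends G e) = 2" using multigraph unfolding multigraph_def by auto
    moreover from this have "V \<inter> {v. v \<in> ends G e} = ends G e" by auto
    ultimately show "(\<Sum>v\<in>V. if v \<in> ends G e then 1 else 0) = (2::nat)" by (simp add: sum.If_cases)
  qed
  finally have d: "(\<Sum>v\<in>V. deg G v) = 2 * card E" by simp
  have "(\<Sum>v\<in>V. T v) \<le> (\<Sum>v\<in>V. deg G v)" using T by (intro sum_mono) auto
  moreover have "(\<Sum>v\<in>V. deg G v - T v) \<le> (\<Sum>v\<in>V. deg G v)" by (intro sum_mono) auto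
  ultimately show ?thesis unfolding size_bound_def using \<Delta>T d by linarith
qed

end


section \<open>Machine code of the main loop\<close>

notation Seq (infixr ";;" 60)

abbreviation "num k \<equiv> Const k"
abbreviation "eq p q \<equiv> And (Not (Less p q)) (Not (Less q p))"
abbreviation "at_cur a \<equiv> Read a (Reg ''cur'')"
abbreviation "add_reg x p \<equiv> Assign x (Add (Reg x) p)"
abbreviation "add_arr a i p \<equiv> Write a i (Add (Read a i) p)"

definition absorb_com :: com where
  "absorb_com = add_arr ''pile'' (Reg ''cur'') (num (-1)) ;; add_arr ''absorbed'' (Reg ''cur'') (num 1) ;;
     add_reg ''excess'' (num (-1)) ;; Assign ''cur'' (Read ''queue'' (Reg ''qh''))"

definition advance_com :: com where
  "advance_com = add_arr ''scanned'' (Reg ''cur'') (num 1) ;;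
     Write ''ptr'' (Reg ''cur'') (Read ''next'' (Reg ''p''))"

text \<open>\<open>pow\<close> and \<open>H\<close> follow \<open>2 ^ expo\<close> and
  \<open>8 * h * expo\<close> by additions only.\<close>

definition grow_com :: com where
  "grow_com = add_reg ''seen'' (num 1) ;;
     Cond (Less (Reg ''seen'') (Reg ''pow'')) Skip
       (add_reg ''pow'' (Reg ''pow'') ;; add_reg ''H'' (Add (Reg ''h4'') (Reg ''h4'')))"

definition relabel_com :: com where
  "relabel_com =
     Cond (eq (at_cur ''level'') (num 0))
       (Write ''marked'' (Reg ''marked_len'') (Reg ''cur'') ;; add_reg ''marked_len'' (num 1)) Skip ;;
     add_arr ''level'' (Reg ''cur'') (num 1) ;;
     Write ''scanned'' (Reg ''cur'') (num 0) ;;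
     Cond (Less (Reg ''base'') (at_cur ''level''))
       (Write ''queue'' (Reg ''qt'') (Reg ''cur'') ;; add_reg ''qt'' (num 1) ;;
        Assign ''cur'' (Read ''queue'' (Reg ''qh''))) Skip"

definition push_com :: com where
  "push_com =
     Cond (Less (Reg ''cur'') (Reg ''u'')) (add_arr ''fl'' (Reg ''e'') (num 1)) (add_arr ''fl'' (Reg ''e'') (num (-1))) ;;
     add_arr ''pile'' (Reg ''cur'') (num (-1)) ;; add_arr ''pile'' (Reg ''u'') (num 1) ;;
     Assign ''cur'' (Reg ''u'')"

definition pop_com :: com where
  "pop_com = add_reg ''qh'' (num 1) ;;
     Cond (Less (Reg ''qh'') (Reg ''qt''))
       (Assign ''cur'' (Read ''queue'' (Reg ''qh'')) ;; Assign ''base'' (at_cur ''level'')) Skip"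

text \<open>The pointer of a node is valid only if \<open>scanned\<close> is positive; otherwise the scan starts at the head
  of the list. Thus neither the zero-initialized memory nor relabelling requires a pointer to be set.\<close>

definition load_com :: com where
  "load_com = Cond (Less (num 0) (at_cur ''scanned''))
     (Assign ''p'' (at_cur ''ptr'')) (Assign ''p'' (at_cur ''head''))"

definition edge_com :: com where
  "edge_com = Assign ''e'' (Read ''edge'' (Reg ''p'')) ;; Assign ''u'' (Read ''nbr'' (Reg ''p'')) ;;
     Cond (Less (Reg ''cur'') (Reg ''u'')) (Assign ''g'' (Read ''fl'' (Reg ''e'')))
       (Assign ''g'' (Sub (num 0) (Read ''fl'' (Reg ''e''))))"

text \<open>A node that is not in the sink list has \<open>T v = deg v\<close>, but its degree is too expensive to compute in
  advance. Its scan at level \<open>0\<close> therefore advances by one cell per absorbed unit, and the node is full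
  when the end of the list is reached.\<close>

definition bottom_com :: com where
  "bottom_com =
     Cond (Less (at_cur ''absorbed'') (at_cur ''limit'')) absorb_com
       (Cond (eq (Reg ''p'') (num 0)) relabel_com
          (advance_com ;; grow_com ;; Cond (eq (at_cur ''listed'') (num 0)) absorb_com Skip))"

definition upper_com :: com where
  "upper_com =
     Cond (eq (Reg ''p'') (num 0)) relabel_com
       (edge_com ;;
        Cond (And (eq (Add (Read ''level'' (Reg ''u'')) (num 1)) (at_cur ''level''))
                  (Less (Reg ''g'') (Reg ''U'')))
          push_com advance_com)"

definition main_body :: com where
  "main_body =
     Cond (And (Less (num 0) (at_cur ''pile'')) (Not (Less (Reg ''base'') (at_cur ''level''))))
       (load_com ;; Cond (eq (at_cur ''level'') (num 0)) bottom_com upper_com)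
       pop_com"

definition main_guard :: bexp where
  "main_guard = And (Less (Reg ''qh'') (Reg ''qt'')) (Less (Reg ''base'') (Reg ''H''))"

section \<open>Representation of configurations in memory\<close>

locale machine = flow_instance +
  fixes cell :: "nat \<Rightarrow> nat \<Rightarrow> int"
  assumes cell_0: "v \<in> verts G \<Longrightarrow> j \<le> deg G v \<Longrightarrow> cell v j = 0 \<longleftrightarrow> j = deg G v"
begin

definition graph_stored :: "state \<Rightarrow> bool" where
  "graph_stored \<sigma> \<longleftrightarrow> (\<forall>v\<in>V. arr \<sigma> ''head'' (int v) = cell v 0 \<and>
     (\<forall>j<deg G v. arr \<sigma> ''next'' (cell v j) = cell v (Suc j) \<and>
        arr \<sigma> ''edge'' (cell v j) = int (inc v j) \<and> arr \<sigma> ''nbr'' (cell v j) = int (nb v j)))"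

text \<open>The array behind the queue is never compacted, so \<open>pops\<close> is also the index
  of its front.\<close>

definition vars_stored :: "conf \<Rightarrow> state \<Rightarrow> bool" where
  "vars_stored c \<sigma> \<longleftrightarrow>
     reg \<sigma> ''cur'' = int (node c) \<and> reg \<sigma> ''base'' = int (base c) \<and> reg \<sigma> ''seen'' = int (seen c) \<and>
     reg \<sigma> ''pow'' = 2 ^ expo c \<and> reg \<sigma> ''H'' = int (8 * h * expo c) \<and> reg \<sigma> ''h4'' = int (4 * h) \<and>
     reg \<sigma> ''U'' = U \<and> reg \<sigma> ''qh'' = int (pops c) \<and> reg \<sigma> ''qt'' = int (pops c + length (queue c)) \<and>
     reg \<sigma> ''marked_len'' = int (length (marked c)) \<and>
     reg \<sigma> ''excess'' = (\<Sum>v\<in>V. int (pile c v))"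

text \<open>\<open>limit\<close> is 0 for unlisted nodes, so that the test for room fails there.
  \<open>count\<close> and \<open>drop\<close> are recorded as untouched because the output pass
  relies on zeros.\<close>

definition arrays_stored :: "conf \<Rightarrow> state \<Rightarrow> bool" where
  "arrays_stored c \<sigma> \<longleftrightarrow>
     (\<forall>v. arr \<sigma> ''level'' (int v) = int (level c v)) \<and>
     (\<forall>v. arr \<sigma> ''scanned'' (int v) = int (scanned c v)) \<and>
     (\<forall>v. arr \<sigma> ''absorbed'' (int v) = int (absorbed c v)) \<and>
     (\<forall>v. arr \<sigma> ''pile'' (int v) = int (pile c v)) \<and>
     (\<forall>e. arr \<sigma> ''fl'' (int e) = flow c e) \<and>
     (\<forall>v\<in>V. 0 < scanned c v \<longrightarrow> arr \<sigma> ''ptr'' (int v) = cell v (scanned c v)) \<and>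
     (\<forall>i<length (queue c). arr \<sigma> ''queue'' (int (pops c + i)) = int (queue c ! i)) \<and>
     (\<forall>i<length (marked c). arr \<sigma> ''marked'' (int i) = int (marked c ! i)) \<and>
     (\<forall>v\<in>V. arr \<sigma> ''listed'' (int v) = (if T v < deg G v then 1 else 0) \<and>
        arr \<sigma> ''limit'' (int v) = (if T v < deg G v then int (T v) else 0)) \<and>
     arr \<sigma> ''count'' = (\<lambda>_. 0) \<and> arr \<sigma> ''drop'' = (\<lambda>_. 0)"

definition repr :: "conf \<Rightarrow> state \<Rightarrow> bool" where
  "repr c \<sigma> \<longleftrightarrow> graph_stored \<sigma> \<and> vars_stored c \<sigma> \<and> arrays_stored c \<sigma>"

lemmas repr_defs = repr_def graph_stored_def vars_stored_def arrays_stored_def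

lemma repr_cong:
  assumes "repr c \<sigma>" "arr \<sigma>' = arr \<sigma>"
    "\<And>y. y \<notin> {''p'', ''e'', ''u'', ''g''} \<Longrightarrow> reg \<sigma>' y = reg \<sigma> y"
  shows "repr c \<sigma>'"
  using assms unfolding repr_defs by simp

lemma sum_pile_upd:
  assumes "x \<in> V" "\<And>v. v \<noteq> x \<Longrightarrow> p' v = p v"
  shows "(\<Sum>v\<in>V. int (p' v)) = (\<Sum>v\<in>V. int (p v)) + int (p' x) - int (p x)"
proof -
  have "sum p' V + p x = sum p V + p' x" using sum_V_change[OF assms] .
  then have "int (sum p' V + p x) = int (sum p V + p' x)" by simp
  then show ?thesis by simp
qed

lemma queue_front:
  assumes "repr c \<sigma>" "queue c \<noteq> []"
  shows "arr \<sigma> ''queue'' (reg \<sigma> ''qh'') = int (hd (queue c))"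
proof -
  have "\<forall>i<length (queue c). arr \<sigma> ''queue'' (int (pops c + i)) = int (queue c ! i)"
    "reg \<sigma> ''qh'' = int (pops c)"
    using assms(1) unfolding repr_def arrays_stored_def vars_stored_def by blast+
  then show ?thesis using assms(2) by (cases "queue c") force+
qed

lemma repr_absorb:
  assumes R: "repr c \<sigma>" and q: "queue c \<noteq> []" and x: "node c \<in> V" and p: "0 < pile c (node c)"
  shows "repr (absorb c) (effect absorb_com \<sigma>)"
proof -
  have "(\<Sum>v\<in>V. int (pile (absorb c) v)) = (\<Sum>v\<in>V. int (pile c v)) - 1"
    using sum_pile_upd[OF x, of "pile (absorb c)" "pile c"] p by simp
  moreover have cur: "reg \<sigma> ''cur'' = int (node c)" using R unfolding repr_defs by blast
  ultimately have "vars_stored (absorb c) (effect absorb_com \<sigma>)"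
    using R queue_front[OF R q] unfolding absorb_com_def repr_def vars_stored_def by simp
  moreover have "arrays_stored (absorb c) (effect absorb_com \<sigma>)"
    using R cur p unfolding absorb_com_def repr_def arrays_stored_def by auto
  moreover have "graph_stored (effect absorb_com \<sigma>)"
    using R unfolding absorb_com_def repr_def graph_stored_def by simp
  ultimately show ?thesis unfolding repr_def by simp
qed

lemma repr_advance:
  assumes R: "repr c \<sigma>" and x: "node c \<in> V" and s: "scanned c (node c) < deg G (node c)"
    and p: "reg \<sigma> ''p'' = cell (node c) (scanned c (node c))"
  shows "repr (advance c) (effect advance_com \<sigma>)"
proof -
  have cur: "reg \<sigma> ''cur'' = int (node c)" using R unfolding repr_defs by blast
  have nx: "arr \<sigma> ''next'' (reg \<sigma> ''p'') = cell (node c) (Suc (scanned c (node c)))"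
    using R x s unfolding p repr_def graph_stored_def by blast
  have "vars_stored (advance c) (effect advance_com \<sigma>)"
    using R unfolding advance_com_def repr_def vars_stored_def by simp
  moreover have "arrays_stored (advance c) (effect advance_com \<sigma>)"
    using R cur nx unfolding advance_com_def repr_def arrays_stored_def by auto
  moreover have "graph_stored (effect advance_com \<sigma>)"
    using R unfolding advance_com_def repr_def graph_stored_def by simp
  ultimately show ?thesis unfolding repr_def by simp
qed

lemma repr_grow:
  assumes R: "repr c \<sigma>"
  shows "repr (grow c) (effect grow_com \<sigma>)"
proof -
  have v: "reg \<sigma> ''seen'' = int (seen c)" "reg \<sigma> ''pow'' = 2 ^ expo c"
    using R unfolding repr_def vars_stored_def by blast+
  have "(int (seen c) + 1 < 2 ^ expo c) \<longleftrightarrow> int (Suc (seen c)) < int (2 ^ expo c)"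
    by (simp add: add.commute)
  also have "\<dots> \<longleftrightarrow> \<not> 2 ^ expo c \<le> Suc (seen c)" by (simp only: of_nat_less_iff not_le)
  finally have lt: "(int (seen c) + 1 < 2 ^ expo c) \<longleftrightarrow> \<not> 2 ^ expo c \<le> Suc (seen c)" .
  have "vars_stored (grow c) (effect grow_com \<sigma>)"
    using R lt unfolding grow_com_def repr_def vars_stored_def by (simp add: algebra_simps)
  moreover have "arrays_stored (grow c) (effect grow_com \<sigma>)"
    using R unfolding grow_com_def repr_def arrays_stored_def by simp
  moreover have "graph_stored (effect grow_com \<sigma>)"
    using R unfolding grow_com_def repr_def graph_stored_def by simp
  ultimately show ?thesis unfolding repr_def by simp
qed

lemma repr_relabel:
  assumes R: "repr c \<sigma>" and q: "queue c \<noteq> []" and a: "level c (node c) \<le> base c"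
  shows "repr (relabel c) (effect relabel_com \<sigma>)"
proof -
  have v: "reg \<sigma> ''cur'' = int (node c)" "reg \<sigma> ''base'' = int (base c)"
    "arr \<sigma> ''level'' (int (node c)) = int (level c (node c))"
    using R unfolding repr_defs by blast+
  have v2: "reg \<sigma> ''qt'' = int (pops c + length (queue c))" "reg \<sigma> ''marked_len'' = int (length (marked c))"
     "reg \<sigma> ''qh'' = int (pops c)"
    using R unfolding repr_defs by blast+
  have lt: "int (base c) < int (level c (node c)) + 1 \<longleftrightarrow> \<not> level c (node c) < base c" by auto
  note qf = queue_front[OF R q]
  have qf': "arr \<sigma> ''queue'' (int (pops c)) = int (hd (queue c))" using qf v2 by simp
  have "vars_stored (relabel c) (effect relabel_com \<sigma>)"
    using R v lt qf q unfolding relabel_com_def relabel_def Let_def repr_def vars_stored_def by simp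
  moreover have "arrays_stored (relabel c) (effect relabel_com \<sigma>)"
    using R v v2 lt unfolding relabel_com_def relabel_def Let_def repr_def arrays_stored_def
    by (auto simp: nth_append less_Suc_eq)
  moreover have "graph_stored (effect relabel_com \<sigma>)"
    using R unfolding relabel_com_def repr_def graph_stored_def by simp
  ultimately show ?thesis unfolding repr_def by simp
qed

lemma repr_push:
  assumes R: "repr c \<sigma>" and x: "node c \<in> V" "u \<in> V" "node c \<noteq> u" and p: "0 < pile c (node c)"
    and e: "reg \<sigma> ''e'' = int e" and u: "reg \<sigma> ''u'' = int u"
  shows "repr (push e u c) (effect push_com \<sigma>)"
proof -
  have v: "reg \<sigma> ''cur'' = int (node c)" using R unfolding repr_defs by blast
  define p1 where "p1 = (pile c)(node c := pile c (node c) - 1)"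
  have "(\<Sum>v\<in>V. int (pile (push e u c) v)) = (\<Sum>v\<in>V. int (p1 v)) + 1"
    using sum_pile_upd[OF x(2), of "pile (push e u c)" p1] x(3) unfolding push_def Let_def p1_def by simp
  also have "(\<Sum>v\<in>V. int (p1 v)) = (\<Sum>v\<in>V. int (pile c v)) - 1"
    using sum_pile_upd[OF x(1), of p1 "pile c"] p unfolding p1_def by simp
  finally have "(\<Sum>v\<in>V. int (pile (push e u c) v)) = (\<Sum>v\<in>V. int (pile c v))" by simp
  then have "vars_stored (push e u c) (effect push_com \<sigma>)"
    using R v u unfolding push_com_def repr_def vars_stored_def by (simp add: push_def Let_def)
  moreover have "arrays_stored (push e u c) (effect push_com \<sigma>)"
    using R v e u p x unfolding push_com_def repr_def arrays_stored_def push_def Let_def by auto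
  moreover have "graph_stored (effect push_com \<sigma>)"
    using R unfolding push_com_def repr_def graph_stored_def by simp
  ultimately show ?thesis unfolding repr_def by simp
qed

lemma repr_pop:
  assumes R: "repr c \<sigma>" and q: "queue c \<noteq> []"
  shows "repr (pop c) (effect pop_com \<sigma>)"
proof -
  have v: "reg \<sigma> ''qt'' = int (pops c + length (queue c))" "reg \<sigma> ''qh'' = int (pops c)"
    using R unfolding repr_defs by blast+
  obtain w Q where wQ: "queue c = w # Q" using q by (cases "queue c") auto
  have A: "\<forall>i<length (queue c). arr \<sigma> ''queue'' (int (pops c + i)) = int (queue c ! i)"
    using R unfolding repr_def arrays_stored_def by blast
  have A': "\<forall>i<length Q. arr \<sigma> ''queue'' (int (Suc (pops c) + i)) = int (Q ! i)"
  proof (intro allI impI)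
    fix i assume "i < length Q"
    then show "arr \<sigma> ''queue'' (int (Suc (pops c) + i)) = int (Q ! i)" using A[rule_format, of "Suc i"] wQ by simp
  qed
  have hdQ: "arr \<sigma> ''queue'' (int (pops c) + 1) = int (hd Q)" if "Q \<noteq> []"
    using A'[rule_format, of 0] that by (cases Q) (auto simp: add.commute)
  have lv: "\<forall>v. arr \<sigma> ''level'' (int v) = int (level c v)" using R unfolding repr_defs by blast
  have lt: "int (pops c) + 1 < int (pops c) + (1 + int (length Q)) \<longleftrightarrow> Q \<noteq> []" by (cases Q) auto
  have "vars_stored (pop c) (effect pop_com \<sigma>)"
    using R hdQ lv wQ unfolding pop_com_def repr_def vars_stored_def
    by (cases Q) (auto simp: pop_def Let_def)
  moreover have "arrays_stored (pop c) (effect pop_com \<sigma>)"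
    using R A' wQ unfolding pop_com_def repr_def arrays_stored_def by simp
  moreover have "graph_stored (effect pop_com \<sigma>)"
    using R unfolding pop_com_def repr_def graph_stored_def by simp
  ultimately show ?thesis unfolding repr_def by simp
qed

lemma repr_load:
  assumes R: "repr c \<sigma>" and x: "node c \<in> V"
  shows "repr c (effect load_com \<sigma>)" and "reg (effect load_com \<sigma>) ''p'' = cell (node c) (scanned c (node c))"
proof -
  have v: "reg \<sigma> ''cur'' = int (node c)" "arr \<sigma> ''scanned'' (int (node c)) = int (scanned c (node c))"
    "0 < scanned c (node c) \<Longrightarrow> arr \<sigma> ''ptr'' (int (node c)) = cell (node c) (scanned c (node c))"
    "arr \<sigma> ''head'' (int (node c)) = cell (node c) 0"
    using R x unfolding repr_defs by blast+
  show "repr c (effect load_com \<sigma>)" 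
    by (rule repr_cong[OF R]) (auto simp: load_com_def)
  show "reg (effect load_com \<sigma>) ''p'' = cell (node c) (scanned c (node c))"
    using v by (simp add: load_com_def)
qed

lemma effect_edge_com:
  assumes "graph_stored \<sigma>" "\<And>e. arr \<sigma> ''fl'' (int e) = fl e" and x: "x \<in> V" "j < deg G x"
    and p: "reg \<sigma> ''p'' = cell x j" and cur: "reg \<sigma> ''cur'' = int x"
  defines "\<sigma>' \<equiv> effect edge_com \<sigma>"
  shows "reg \<sigma>' ''e'' = int (inc x j)" and "reg \<sigma>' ''u'' = int (nb x j)"
    and "reg \<sigma>' ''g'' = edge_flow G fl (inc x j) x (nb x j)"
    and "\<And>y. y \<notin> {''e'', ''u'', ''g''} \<Longrightarrow> reg \<sigma>' y = reg \<sigma> y" and "arr \<sigma>' = arr \<sigma>"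
proof -
  have v: "arr \<sigma> ''edge'' (cell x j) = int (inc x j)" "arr \<sigma> ''nbr'' (cell x j) = int (nb x j)"
    using assms(1) x unfolding graph_stored_def by blast+
  have e: "inc x j \<in> E" "ends G (inc x j) = {x, nb x j}" "x \<noteq> nb x j"
    using inc_E[OF x] ends_inc[OF x] nb_V(2)[OF x] by auto
  show "reg \<sigma>' ''e'' = int (inc x j)" "reg \<sigma>' ''u'' = int (nb x j)"
    using v p unfolding \<sigma>'_def by (simp_all add: edge_com_def)
  show "reg \<sigma>' ''g'' = edge_flow G fl (inc x j) x (nb x j)"
    using v p cur e assms(2) unfolding \<sigma>'_def edge_flow_def by (simp add: edge_com_def)
  show "\<And>y. y \<notin> {''e'', ''u'', ''g''} \<Longrightarrow> reg \<sigma>' y = reg \<sigma> y" "arr \<sigma>' = arr \<sigma>"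
    unfolding \<sigma>'_def by (auto simp: edge_com_def)
qed

lemma main_guard_iff:
  assumes "repr c \<sigma>"
  shows "bval main_guard \<sigma> \<longleftrightarrow> running c"
proof -
  have "reg \<sigma> ''base'' = int (base c)" "reg \<sigma> ''H'' = int (8 * h * expo c)"
    "reg \<sigma> ''qh'' = int (pops c)" "reg \<sigma> ''qt'' = int (pops c + length (queue c))"
    using assms unfolding repr_def vars_stored_def by blast+
  then show ?thesis unfolding main_guard_def running_def by (simp del: of_nat_mult)
qed

text \<open>Forward simulation: the case split follows the tests in the code, and each leaf joins a
  representation lemma to the matching preservation lemma.\<close>

lemma main_step:
  assumes I: "inv c" and R: "repr c \<sigma>" and r: "running c"
  shows "\<exists>c'. inv c' \<and> progress c < progress c' \<and> repr c' (effect main_body \<sigma>)"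
proof -
  define x where "x = node c"
  have q: "queue c \<noteq> []" using r unfolding running_def by simp
  have xV: "x \<in> V" using node_V[OF I r] unfolding x_def .
  have fi: "flow_inv c" using I unfolding inv_def by simp
  have val: "reg \<sigma> ''cur'' = int x" "arr \<sigma> ''pile'' (int x) = int (pile c x)"
    "reg \<sigma> ''base'' = int (base c)" "arr \<sigma> ''level'' (int x) = int (level c x)"
    using R unfolding repr_defs x_def by blast+
  show ?thesis
  proof (cases "active c")
    case False
    then have "effect main_body \<sigma> = effect pop_com \<sigma>"
      using val unfolding active_def x_def[symmetric] by (auto simp: main_body_def)
    then show ?thesis using inv_pop[OF I r False] repr_pop[OF R q] by metis
  next
    case a: True
    define \<sigma>1 where "\<sigma>1 = effect load_com \<sigma>"
    define s where "s = scanned c x"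
    have R1: "repr c \<sigma>1" and p: "reg \<sigma>1 ''p'' = cell x s"
      using repr_load[OF R] xV unfolding \<sigma>1_def x_def s_def by auto
    have val1: "reg \<sigma>1 ''cur'' = int x" "arr \<sigma>1 ''level'' (int x) = int (level c x)"
      "arr \<sigma>1 ''absorbed'' (int x) = int (absorbed c x)"
      using R1 unfolding repr_defs x_def by blast+
    have lim: "arr \<sigma>1 ''limit'' (int x) = (if T x < deg G x then int (T x) else 0)"
      using R1 xV unfolding repr_defs by blast
    have sle: "s \<le> deg G x" using fi xV unfolding flow_inv_def s_def by blast
    have p0: "reg \<sigma>1 ''p'' = 0 \<longleftrightarrow> s = deg G x" unfolding p using cell_0[OF xV sle] .
    have a': "0 < pile c x" "level c x \<le> base c" using a unfolding active_def x_def by auto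
    have e1: "effect main_body \<sigma> = effect (if level c x = 0 then bottom_com else upper_com) \<sigma>1"
      using val a' val1 unfolding \<sigma>1_def by (simp add: main_body_def)
    show ?thesis
    proof (cases "level c x = 0")
      case l0: True
      have ab: "absorbed c x \<le> T x" "T x = deg G x \<longrightarrow> absorbed c x = s"
        "T x < deg G x \<longrightarrow> 0 < s \<longrightarrow> absorbed c x = T x"
        using fi xV l0 unfolding flow_inv_def s_def by auto
      show ?thesis
      proof (cases "T x < deg G x \<and> absorbed c x < T x")
        case True
        then have "effect main_body \<sigma> = effect absorb_com \<sigma>1"
          using l0 val1 lim unfolding e1 bottom_com_def upper_com_def by simp
        then show ?thesis
          using inv_absorb[OF I r a] repr_absorb[OF R1 q] True l0 a' xV unfolding x_def by metis
      next
        case nab: False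
        then have nl: "\<not> int (absorbed c x) < arr \<sigma>1 ''limit'' (int x)" unfolding lim by auto
        show ?thesis
        proof (cases "s = deg G x")
          case True
          then have "effect main_body \<sigma> = effect relabel_com \<sigma>1"
            using l0 val1 nl p0 unfolding e1 bottom_com_def upper_com_def by simp
          \<comment> \<open>At the end of its list an unlisted node has absorbed
            \<open>deg G x = T x\<close> units, and a listed one has just failed the test for
            room.\<close>
          moreover have "absorbed c x = T x"
            using ab nab True T[OF xV] by (cases "T x = deg G x") auto
          ultimately show ?thesis
            using inv_relabel[OF I r a] repr_relabel[OF R1 q] True a' unfolding x_def s_def by metis
        next
          case False
          then have sl: "s < deg G x" using sle by simp
          define \<sigma>2 where "\<sigma>2 = effect grow_com (effect advance_com \<sigma>1)"
          have R2: "repr (grow (advance c)) \<sigma>2"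
            using repr_grow[OF repr_advance[OF R1]] xV sl p unfolding \<sigma>2_def x_def s_def by simp
          have l2: "reg \<sigma>2 ''cur'' = int x" 
            "arr \<sigma>2 ''listed'' (int x) = (if T x < deg G x then 1 else 0)"
            using R2 xV unfolding repr_def vars_stored_def arrays_stored_def x_def by auto
          have e2: "effect main_body \<sigma> = (if T x < deg G x then \<sigma>2 else effect absorb_com \<sigma>2)"
            using l0 val1 nl p0 False l2 unfolding e1 \<sigma>2_def bottom_com_def by auto
          show ?thesis
          proof (cases "T x < deg G x")
            case True
            then have "absorbed c x = T x" using nab ab by simp
            then show ?thesis
              using inv_scan_saturated[OF I r a] R2 e2 True l0 sl unfolding x_def s_def by metis
          next
            case False
            then have "T x = deg G x" using T[OF xV] by simp
            moreover have "repr (absorb (grow (advance c))) (effect absorb_com \<sigma>2)"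
              using R2 q xV a' by (intro repr_absorb) (auto simp: x_def)
            ultimately show ?thesis
              using inv_scan_absorb[OF I r a] e2 False l0 sl unfolding x_def s_def by metis
          qed
        qed
      qed
    next
      case l1: False
      show ?thesis
      proof (cases "s = deg G x")
        case True
        then have "effect main_body \<sigma> = effect relabel_com \<sigma>1"
          using l1 val1 p0 unfolding e1 bottom_com_def upper_com_def by simp
        moreover have "absorbed c x = T x" using fi xV l1 unfolding flow_inv_def by simp
        ultimately show ?thesis
          using inv_relabel[OF I r a] repr_relabel[OF R1 q] True a' unfolding x_def s_def by metis
      next
        case False
        then have sl: "s < deg G x" using sle by simp
        define \<sigma>2 where "\<sigma>2 = effect edge_com \<sigma>1"
        have "graph_stored \<sigma>1" "\<And>e. arr \<sigma>1 ''fl'' (int e) = flow c e"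
          using R1 unfolding repr_def arrays_stored_def by blast+
        note E = effect_edge_com[OF this xV sl p val1(1), folded \<sigma>2_def]
        have R2: "repr c \<sigma>2" by (rule repr_cong[OF R1 E(5)]) (auto intro!: E(4))
        have val2: "reg \<sigma>2 ''cur'' = int x" "\<And>v. arr \<sigma>2 ''level'' (int v) = int (level c v)" "reg \<sigma>2 ''U'' = U"
          using R2 unfolding repr_defs x_def by blast+
        have e2: "effect main_body \<sigma> = (if Suc (level c (nb x s)) = level c x \<and> ef c (inc x s) x (nb x s) < U
            then effect push_com \<sigma>2 else effect advance_com \<sigma>2)"
          using l1 val1 p0 False val2 E(2,3) unfolding e1 upper_com_def by (auto simp: \<sigma>2_def[symmetric])
        show ?thesis
        proof (cases "Suc (level c (nb x s)) = level c x \<and> ef c (inc x s) x (nb x s) < U")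
          case True
          have "repr (push (inc x s) (nb x s) c) (effect push_com \<sigma>2)"
            using R2 E(1,2) nb_V[OF xV sl] xV a' by (intro repr_push) (auto simp: x_def)
          then show ?thesis
            using inv_push[OF I r a] True sl e2 unfolding x_def s_def by metis
        next
          case nadm: False
          have "\<bar>ef c (inc x s) x (nb x s)\<bar> \<le> U" by (rule abs_ef_le[OF I])
          then have "Suc (level c (nb x s)) = level c x \<Longrightarrow> ef c (inc x s) x (nb x s) = U"
            using nadm by auto
          moreover have "repr (advance c) (effect advance_com \<sigma>2)"
            using R2 E(4) xV sl p by (intro repr_advance) (auto simp: x_def s_def)
          ultimately show ?thesis
            using inv_scan[OF I r a] l1 sl e2 nadm unfolding x_def s_def by (metis neq0_conv)
        qed
      qed
    qed
  qed
qed

lemma loop_free_main: "loop_free main_body"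
  by (simp add: main_body_def bottom_com_def upper_com_def load_com_def absorb_com_def relabel_com_def advance_com_def grow_com_def
      edge_com_def push_com_def pop_com_def)

text \<open>\<open>progress\<close> rises in every round and never exceeds \<open>?B\<close>, which
  does not depend on the current height; the gap is the variant.\<close>

lemma main_loop:
  assumes I: "inv c" and R: "repr c \<sigma>" and K: "2 * size_bound < 2 ^ K" "1 \<le> K"
  shows "reaches (While main_guard main_body) \<sigma> (40 * h * F * K * size_bound * Suc (steps main_body) + 1)
     (\<lambda>\<sigma>'. \<exists>c'. inv c' \<and> repr c' \<sigma>' \<and> \<not> running c')"
proof -
  let ?B = "40 * h * F * K * size_bound"
  define \<mu> where "\<mu> c = ?B - progress c" for c
  let ?I = "\<lambda>c \<sigma>. inv c \<and> repr c \<sigma>"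
  have "reaches (While main_guard main_body) \<sigma> (\<mu> c * Suc (steps main_body) + 1)
     (\<lambda>\<sigma>'. \<not> bval main_guard \<sigma>' \<and> (\<exists>c'. ?I c' \<sigma>'))"
  proof (rule reaches_While[where I = ?I])
    fix c \<sigma> assume *: "?I c \<sigma>" "bval main_guard \<sigma>"
    then have "running c" using main_guard_iff by blast
    then obtain c' where c': "inv c'" "progress c < progress c'" "repr c' (effect main_body \<sigma>)"
      using main_step * by blast
    have "\<mu> c' < \<mu> c" unfolding \<mu>_def using progress_le[OF c'(1) K] c'(2) by linarith
    then show "reaches main_body \<sigma> (steps main_body) (\<lambda>\<sigma>'. \<exists>c'. ?I c' \<sigma>' \<and> \<mu> c' < \<mu> c)"
      using c' by (intro reaches_loop_free loop_free_main) blast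
  qed (use I R in blast)
  then show ?thesis
  proof (rule reaches_weaken)
    show "\<mu> c * Suc (steps main_body) + 1 \<le> ?B * Suc (steps main_body) + 1"
      unfolding \<mu>_def by (intro add_mono mult_right_mono) auto
  qed (use main_guard_iff in blast)
qed

end


section \<open>Output and cut extraction\<close>

definition emit_com :: "aexp \<Rightarrow> aexp \<Rightarrow> aexp \<Rightarrow> com" where
  "emit_com a b g =
     Write ''flow_edge'' (Reg ''flow_len'') (Reg ''e'') ;; Write ''flow_from'' (Reg ''flow_len'') a ;;
     Write ''flow_to'' (Reg ''flow_len'') b ;; Write ''flow_val'' (Reg ''flow_len'') g ;;
     add_reg ''flow_len'' (num 1)"

text \<open>Only marked nodes are visited, and every edge with nonzero flow has a marked end. An edge with two
  marked ends is output once from each of them.\<close>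

definition output_com :: com where
  "output_com = Cond (eq (Reg ''g'') (num 0)) Skip
     (emit_com (Reg ''cur'') (Reg ''u'') (Reg ''g'') ;;
      Cond (eq (Read ''level'' (Reg ''u'')) (num 0))
        (emit_com (Reg ''u'') (Reg ''cur'') (Sub (num 0) (Reg ''g''))) Skip)"

text \<open>Adding \<open>h4\<close> instead of 1 stores the multiple \<open>4 * h * drops\<close>
  that the search compares, without a multiplication.\<close>

definition count_com :: com where
  "count_com = add_reg ''total'' (num 1) ;; add_arr ''count'' (at_cur ''level'') (num 1) ;;
     Cond (eq (Add (Read ''level'' (Reg ''u'')) (num 1)) (at_cur ''level''))
       (add_arr ''drop'' (at_cur ''level'') (Reg ''h4'')) Skip"

text \<open>Two nested loops, over marked nodes and over their cells, are flattened into one. A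
  round handles one cell or moves to the next node, so the body is loop-free.\<close>

definition pass_body :: com where
  "pass_body = Cond (eq (Reg ''p'') (num 0))
     (add_reg ''i'' (num 1) ;; Assign ''cur'' (Read ''marked'' (Reg ''i'')) ;; Assign ''p'' (at_cur ''head''))
     (edge_com ;; output_com ;; count_com ;; Assign ''p'' (Read ''next'' (Reg ''p'')))"

definition pass_init :: com where
  "pass_init = Assign ''i'' (num 0) ;; Assign ''cur'' (Read ''marked'' (num 0)) ;;
     Assign ''p'' (at_cur ''head'') ;; Assign ''total'' (num 0) ;; Assign ''flow_len'' (num 0)"

definition pass_com :: com where
  "pass_com = pass_init ;; While (Less (Reg ''i'') (Reg ''marked_len'')) pass_body"

text \<open>While \<open>i\<close> climbs, \<open>total\<close> and \<open>below\<close> hold the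
  two volumes of \<open>good\<close>. There is no range check, since a good level is known to
  exist.\<close>

definition find_com :: com where
  "find_com = (Assign ''i'' (num 1) ;; Assign ''below'' (num 1)) ;;
     While (Not (And (Less (Read ''drop'' (Reg ''i'')) (Reg ''total''))
                     (Less (Read ''drop'' (Reg ''i'')) (Reg ''below''))))
       (add_reg ''below'' (Read ''count'' (Reg ''i'')) ;;
        Assign ''total'' (Sub (Reg ''total'') (Read ''count'' (Reg ''i''))) ;; add_reg ''i'' (num 1))"

definition cut_body :: com where
  "cut_body = Cond (Less (Read ''level'' (Read ''marked'' (Reg ''j''))) (Reg ''i'')) Skip
       (Write ''cut'' (Reg ''cut_len'') (Read ''marked'' (Reg ''j'')) ;; add_reg ''cut_len'' (num 1)) ;;
     add_reg ''j'' (num 1)"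

definition cut_com :: com where
  "cut_com = (Assign ''j'' (num 0) ;; Assign ''cut_len'' (num 0)) ;;
     While (Less (Reg ''j'') (Reg ''marked_len'')) cut_body"

context machine
begin

text \<open>The part of the representation that the output and the cut search still need; scan state
  and queue may be lost.\<close>

definition final_stored :: "conf \<Rightarrow> state \<Rightarrow> bool" where
  "final_stored c \<sigma> \<longleftrightarrow> graph_stored \<sigma> \<and> reg \<sigma> ''h4'' = int (4 * h) \<and>
     reg \<sigma> ''marked_len'' = int (length (marked c)) \<and>
     reg \<sigma> ''excess'' = (\<Sum>v\<in>V. int (pile c v)) \<and>
     (\<forall>v. arr \<sigma> ''level'' (int v) = int (level c v)) \<and>
     (\<forall>e. arr \<sigma> ''fl'' (int e) = flow c e) \<and>
     (\<forall>i<length (marked c). arr \<sigma> ''marked'' (int i) = int (marked c ! i))"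

definition flow_output :: "(nat \<times> nat \<times> nat) list \<Rightarrow> nat \<Rightarrow> (nat, nat) flow_fun \<Rightarrow> state \<Rightarrow> bool" where
  "flow_output xs n f \<sigma> \<longleftrightarrow> reg \<sigma> ''flow_len'' = int n \<and> n = length xs \<and>
     (\<forall>i<length xs. case xs ! i of (e, u, v) \<Rightarrow> arr \<sigma> ''flow_edge'' (int i) = int e \<and>
        arr \<sigma> ''flow_from'' (int i) = int u \<and> arr \<sigma> ''flow_to'' (int i) = int v \<and>
        arr \<sigma> ''flow_val'' (int i) = f e u v)"

text \<open>\<open>D\<close> is the set of cells already passed. A triple belongs to the cell at its
  source \<open>u\<close>, and to the one at \<open>v\<close> only if \<open>u\<close> has level 0
  and is never visited; this rules out repetitions.\<close>

definition emitted :: "conf \<Rightarrow> (nat \<times> nat) set \<Rightarrow> (nat \<times> nat \<times> nat) set" where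
  "emitted c D = {(e, u, v). ef c e u v \<noteq> 0 \<and>
     ((\<exists>j. (u, j) \<in> D \<and> inc u j = e) \<or> level c u = 0 \<and> (\<exists>j. (v, j) \<in> D \<and> inc v j = e))}"

definition flows_done :: "conf \<Rightarrow> (nat \<times> nat) set \<Rightarrow> state \<Rightarrow> bool" where
  "flows_done c D \<sigma> \<longleftrightarrow> (\<exists>xs. distinct xs \<and> set xs = emitted c D \<and> flow_output xs (length xs) (ef c) \<sigma>)"

definition counts_done :: "conf \<Rightarrow> (nat \<times> nat) set \<Rightarrow> state \<Rightarrow> bool" where
  "counts_done c D \<sigma> \<longleftrightarrow> reg \<sigma> ''total'' = int (card D) \<and>
     (\<forall>k. arr \<sigma> ''count'' (int k) = int (card {(v, j) \<in> D. level c v = k})) \<and>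
     (\<forall>k. arr \<sigma> ''drop'' (int k) = int (4 * h * card {(v, j) \<in> D. level c v = k \<and> Suc (level c (nb v j)) = k}))"

definition marked_cells :: "conf \<Rightarrow> (nat \<times> nat) set" where
  "marked_cells c = (SIGMA v:{v \<in> V. 0 < level c v}. {..<deg G v})"

text \<open>The operands are registers up to sign, so the writes to the output arrays cannot change
  their values.\<close>

lemma flow_output_append:
  assumes "flow_output xs n f \<sigma>" "aval (Reg ''e'') \<sigma> = int e" "aval a \<sigma> = int u" "aval b \<sigma> = int v"
    "aval g \<sigma> = f e u v" "a = Reg a'" "b = Reg b'" "g = Reg g' \<or> g = Sub (num 0) (Reg g')"
  shows "flow_output (xs @ [(e, u, v)]) (Suc n) f (effect (emit_com a b g) \<sigma>)"
  using assms unfolding flow_output_def emit_com_def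
  by (auto simp: nth_append less_Suc_eq split: prod.splits)

lemma effect_emit_com:
  "reg (effect (emit_com a b g) \<sigma>) = (reg \<sigma>)(''flow_len'' := reg \<sigma> ''flow_len'' + 1)"
  "x \<notin> {''flow_edge'', ''flow_from'', ''flow_to'', ''flow_val''} \<Longrightarrow> arr (effect (emit_com a b g) \<sigma>) x = arr \<sigma> x"
  by (auto simp: emit_com_def)

lemma emitted_insert:
  assumes "x \<in> V" "0 < level c x" "j < deg G x"
  shows "emitted c (insert (x, j) D) = emitted c D \<union>
     (if ef c (inc x j) x (nb x j) = 0 then {}
      else insert (inc x j, x, nb x j) (if level c (nb x j) = 0 then {(inc x j, nb x j, x)} else {}))"
proof -
  have e: "ends G (inc x j) = {x, nb x j}" "inc x j \<in> E" using ends_inc inc_E assms by auto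
  have z: "ef c (inc x j) x v \<noteq> 0 \<Longrightarrow> v = nb x j" "ef c (inc x j) v x \<noteq> 0 \<Longrightarrow> v = nb x j" for v
    unfolding edge_flow_def using e by (auto split: if_splits simp: doubleton_eq_iff)
  have a: "ef c (inc x j) (nb x j) x = - ef c (inc x j) x (nb x j)"
    by (rule preflow_antisym[OF preflow_edge_flow])
  have ex: "(\<exists>j'. (w, j') \<in> insert (x, j) D \<and> inc w j' = e) \<longleftrightarrow>
      (\<exists>j'. (w, j') \<in> D \<and> inc w j' = e) \<or> w = x \<and> e = inc x j" for w e
    by auto
  have out: "ef c e u v \<noteq> 0 \<and> u = x \<and> e = inc x j \<longleftrightarrow>
      ef c (inc x j) x (nb x j) \<noteq> 0 \<and> e = inc x j \<and> u = x \<and> v = nb x j" for e u v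
    using z(1) by auto
  have inw: "ef c e u v \<noteq> 0 \<and> v = x \<and> e = inc x j \<longleftrightarrow>
      ef c (inc x j) x (nb x j) \<noteq> 0 \<and> e = inc x j \<and> u = nb x j \<and> v = x" for e u v
    using z(2) a by (metis neg_0_equal_iff_equal)
  show ?thesis
  proof (rule set_eqI, clarify)
    fix e u v
    have "(e, u, v) \<in> emitted c (insert (x, j) D) \<longleftrightarrow> (e, u, v) \<in> emitted c D \<or>
        (ef c e u v \<noteq> 0 \<and> u = x \<and> e = inc x j) \<or> (ef c e u v \<noteq> 0 \<and> v = x \<and> e = inc x j) \<and> level c u = 0"
      unfolding emitted_def mem_Collect_eq prod.case ex by blast
    then show "(e, u, v) \<in> emitted c (insert (x, j) D) \<longleftrightarrow> (e, u, v) \<in> emitted c D \<union>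
      (if ef c (inc x j) x (nb x j) = 0 then {}
       else insert (inc x j, x, nb x j) (if level c (nb x j) = 0 then {(inc x j, nb x j, x)} else {}))"
      unfolding out inw by auto
  qed
qed

text \<open>The outgoing triple can come only from the cell \<open>(x, j)\<close>, as
  \<open>inc x\<close> is injective. The reverse one is due at \<open>x\<close> only if the other
  end has level 0, whose own cells never enter \<open>D\<close>.\<close>

lemma not_emitted:
  assumes D: "D \<subseteq> marked_cells c" and n: "(x, j) \<notin> D" and x: "x \<in> V" "0 < level c x" "j < deg G x"
  shows "(inc x j, x, nb x j) \<notin> emitted c D"
    and "level c (nb x j) = 0 \<Longrightarrow> (inc x j, nb x j, x) \<notin> emitted c D"
proof -
  have inj: "inc x j' = inc x j \<Longrightarrow> j' < deg G x \<Longrightarrow> j' = j" for j'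
    using inc_bij[OF x(1)] x(3) unfolding bij_betw_def by (auto dest: inj_onD)
  have nx: "\<not> (\<exists>j'. (x, j') \<in> D \<and> inc x j' = inc x j)"
  proof
    assume "\<exists>j'. (x, j') \<in> D \<and> inc x j' = inc x j"
    then obtain j' where "(x, j') \<in> D" "inc x j' = inc x j" by blast
    moreover from this have "j' < deg G x" using D unfolding marked_cells_def by auto
    ultimately show False using inj n by metis
  qed
  show "(inc x j, x, nb x j) \<notin> emitted c D" using nx x(2) unfolding emitted_def by simp
  show "(inc x j, nb x j, x) \<notin> emitted c D" if "level c (nb x j) = 0"
  proof -
    have "(nb x j, j') \<notin> D" for j' using D that unfolding marked_cells_def by auto
    then show ?thesis using nx unfolding emitted_def by simp
  qed
qed

lemma flows_step:
  assumes D: "D \<subseteq> marked_cells c" and n: "(x, j) \<notin> D" and x: "x \<in> V" "0 < level c x" "j < deg G x"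
    and F: "flows_done c D \<sigma>"
    and r: "reg \<sigma> ''cur'' = int x" "reg \<sigma> ''e'' = int (inc x j)" "reg \<sigma> ''u'' = int (nb x j)"
      "reg \<sigma> ''g'' = ef c (inc x j) x (nb x j)"
    and lev: "\<And>v. arr \<sigma> ''level'' (int v) = int (level c v)"
  shows "flows_done c (insert (x, j) D) (effect output_com \<sigma>)"
proof -
  obtain xs where xs: "distinct xs" "set xs = emitted c D" "flow_output xs (length xs) (ef c) \<sigma>"
    using F unfolding flows_done_def by blast
  define e u where "e = inc x j" and "u = nb x j"
  note r' = r[folded e_def u_def]
  note ne = not_emitted[OF D n x, folded e_def u_def]
  note ei = emitted_insert[OF x, of D, folded e_def u_def]
  have xu: "x \<noteq> u" using nb_V(2)[OF x(1,3)] unfolding u_def by simp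
  show ?thesis
  proof (cases "ef c e x u = 0")
    case True
    then have "effect output_com \<sigma> = \<sigma>" using r' by (simp add: output_com_def)
    then show ?thesis using F ei True unfolding flows_done_def by simp
  next
    case nz: False
    define \<sigma>1 where "\<sigma>1 = effect (emit_com (Reg ''cur'') (Reg ''u'') (Reg ''g'')) \<sigma>"
    have o1: "flow_output (xs @ [(e, x, u)]) (Suc (length xs)) (ef c) \<sigma>1"
      unfolding \<sigma>1_def using r' by (intro flow_output_append[OF xs(3)]) auto
    have r1: "reg \<sigma>1 ''cur'' = int x" "reg \<sigma>1 ''e'' = int e" "reg \<sigma>1 ''u'' = int u"
      "reg \<sigma>1 ''g'' = ef c e x u" "arr \<sigma>1 ''level'' (int u) = int (level c u)"
      using r' lev unfolding \<sigma>1_def by (simp_all add: effect_emit_com)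
    have eq1: "effect output_com \<sigma> = (if level c u = 0
        then effect (emit_com (Reg ''u'') (Reg ''cur'') (Sub (num 0) (Reg ''g''))) \<sigma>1 else \<sigma>1)"
      using r' nz r1 by (auto simp: output_com_def \<sigma>1_def)
    show ?thesis
    proof (cases "level c u = 0")
      case True
      have "ef c e u x = - ef c e x u" by (rule preflow_antisym[OF preflow_edge_flow])
      then have "flow_output ((xs @ [(e, x, u)]) @ [(e, u, x)]) (Suc (Suc (length xs))) (ef c) (effect output_com \<sigma>)"
        unfolding eq1 if_P[OF True] using r1 True
        by (intro flow_output_append[OF o1]) auto
      moreover have "distinct ((xs @ [(e, x, u)]) @ [(e, u, x)])" using xs ne True xu by auto
      moreover have "set ((xs @ [(e, x, u)]) @ [(e, u, x)]) = emitted c (insert (x, j) D)"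
        using xs ei nz True by auto
      ultimately show ?thesis unfolding flows_done_def by (metis length_append_singleton)
    next
      case False
      then have "flow_output (xs @ [(e, x, u)]) (Suc (length xs)) (ef c) (effect output_com \<sigma>)"
        using o1 unfolding eq1 by simp
      moreover have "distinct (xs @ [(e, x, u)])" using xs ne by auto
      moreover have "set (xs @ [(e, x, u)]) = emitted c (insert (x, j) D)"
        using xs ei nz False by auto
      ultimately show ?thesis unfolding flows_done_def by (metis length_append_singleton)
    qed
  qed
qed

lemma effect_output_com:
  "x \<noteq> ''flow_len'' \<Longrightarrow> reg (effect output_com \<sigma>) x = reg \<sigma> x"
  "x \<notin> {''flow_edge'', ''flow_from'', ''flow_to'', ''flow_val''} \<Longrightarrow> arr (effect output_com \<sigma>) x = arr \<sigma> x"
  by (auto simp: output_com_def effect_emit_com)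

lemma effect_count_com:
  "x \<noteq> ''total'' \<Longrightarrow> reg (effect count_com \<sigma>) x = reg \<sigma> x"
  "x \<notin> {''count'', ''drop''} \<Longrightarrow> arr (effect count_com \<sigma>) x = arr \<sigma> x"
  by (auto simp: count_com_def)

lemma counts_step:
  assumes D: "finite D" and n: "(x, j) \<notin> D" and C: "counts_done c D \<sigma>"
    and r: "reg \<sigma> ''cur'' = int x" "reg \<sigma> ''u'' = int (nb x j)" "reg \<sigma> ''h4'' = int (4 * h)"
    and lev: "\<And>v. arr \<sigma> ''level'' (int v) = int (level c v)"
  shows "counts_done c (insert (x, j) D) (effect count_com \<sigma>)"
proof -
  have 1: "{(v, j') \<in> insert (x, j) D. P v j'} =
     (if P x j then insert (x, j) {(v, j') \<in> D. P v j'} else {(v, j') \<in> D. P v j'})" for P by auto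
  have 2: "finite {(v, j') \<in> D. P v j'}" for P using D by (rule finite_subset[rotated]) auto
  have "int (level c (nb x j)) + 1 = int (level c x) \<longleftrightarrow> Suc (level c (nb x j)) = level c x" by linarith
  then show ?thesis
    using C r n D lev unfolding counts_done_def 1 count_com_def
    by (auto simp: 2 algebra_simps)
qed

lemma final_stored_cong:
  assumes "final_stored c \<sigma>"
    "\<And>x. x \<in> {''h4'', ''marked_len'', ''excess''} \<Longrightarrow> reg \<sigma>' x = reg \<sigma> x"
    "\<And>a. a \<in> {''head'', ''next'', ''edge'', ''nbr'', ''level'', ''fl'', ''marked''} \<Longrightarrow> arr \<sigma>' a = arr \<sigma> a"
  shows "final_stored c \<sigma>'"
  using assms unfolding final_stored_def graph_stored_def by simp

definition pass_inv :: "conf \<Rightarrow> nat \<times> nat \<Rightarrow> state \<Rightarrow> bool" where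
  "pass_inv c = (\<lambda>(i, j) \<sigma>. final_stored c \<sigma> \<and> reg \<sigma> ''i'' = int i \<and> i \<le> length (marked c) \<and>
     (i < length (marked c) \<longrightarrow> j \<le> deg G (marked c ! i) \<and> reg \<sigma> ''cur'' = int (marked c ! i) \<and>
        reg \<sigma> ''p'' = cell (marked c ! i) j) \<and>
     (let D = (SIGMA v:set (take i (marked c)). {..<deg G v}) \<union>
        (if i < length (marked c) then {marked c ! i} \<times> {..<j} else {}) in
      flows_done c D \<sigma> \<and> counts_done c D \<sigma>))"

text \<open>The \<open>Suc\<close> pays for the round that moves on to the next node.\<close>

definition pass_measure :: "conf \<Rightarrow> nat \<times> nat \<Rightarrow> nat" where
  "pass_measure c = (\<lambda>(i, j). (\<Sum>v\<leftarrow>drop i (marked c). Suc (deg G v)) - (if i < length (marked c) then j else 0))"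

lemma pass_step:
  assumes m: "distinct (marked c)" "set (marked c) = {v \<in> V. 0 < level c v}"
    and P: "pass_inv c (i, j) \<sigma>" and i: "i < length (marked c)"
  shows "\<exists>s. pass_inv c s (effect pass_body \<sigma>) \<and> pass_measure c s < pass_measure c (i, j)"
proof -
  define x where "x = marked c ! i"
  have x: "x \<in> V" "0 < level c x" using m i nth_mem[of i "marked c"] unfolding x_def by auto
  define D where "D = (SIGMA v:set (take i (marked c)). {..<deg G v}) \<union> {x} \<times> {..<j}"
  have S: "final_stored c \<sigma>" "reg \<sigma> ''i'' = int i" "j \<le> deg G x" "reg \<sigma> ''cur'' = int x"
    "reg \<sigma> ''p'' = cell x j" "flows_done c D \<sigma>" "counts_done c D \<sigma>"
    using P i unfolding pass_inv_def D_def x_def by (auto simp: Let_def)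
  have p0: "reg \<sigma> ''p'' = 0 \<longleftrightarrow> j = deg G x" using cell_0[OF x(1) S(3)] S(5) by simp
  have dr: "drop i (marked c) = x # drop (Suc i) (marked c)"
    using i unfolding x_def by (rule Cons_nth_drop_Suc[symmetric])
  have tk: "take (Suc i) (marked c) = take i (marked c) @ [x]"
    using i unfolding x_def by (rule take_Suc_conv_app_nth)
  show ?thesis
  proof (cases "j = deg G x")
    case True
    define \<sigma>' where "\<sigma>' = effect pass_body \<sigma>"
    have e: "\<sigma>' = effect (add_reg ''i'' (num 1) ;; Assign ''cur'' (Read ''marked'' (Reg ''i'')) ;;
       Assign ''p'' (at_cur ''head'')) \<sigma>"
      using True p0 unfolding \<sigma>'_def by (simp add: pass_body_def)
    have F: "final_stored c \<sigma>'" by (rule final_stored_cong[OF S(1)]) (auto simp: e)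
    \<comment> \<open>Moving on adds no cells: the completed list of \<open>x\<close> passes from
      the partial to the finished part.\<close>
    have D': "(SIGMA v:set (take (Suc i) (marked c)). {..<deg G v}) \<union>
        (if Suc i < length (marked c) then {marked c ! Suc i} \<times> {..<0} else {}) = D"
      unfolding D_def tk True by auto
    have fd: "flows_done c D \<sigma>'" "counts_done c D \<sigma>'"
      using S(6,7) unfolding flows_done_def counts_done_def flow_output_def e by simp_all
    have "reg \<sigma>' ''cur'' = int (marked c ! Suc i) \<and> reg \<sigma>' ''p'' = cell (marked c ! Suc i) 0"
      if "Suc i < length (marked c)"
    proof -
      have "marked c ! Suc i \<in> V" using m(2) nth_mem[OF that] by auto
      then have "arr \<sigma> ''head'' (int (marked c ! Suc i)) = cell (marked c ! Suc i) 0"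
        "arr \<sigma> ''marked'' (int (Suc i)) = int (marked c ! Suc i)"
        using S(1) that unfolding final_stored_def graph_stored_def by auto
      then show ?thesis using S(2) by (simp add: e add.commute)
    qed
    then have "pass_inv c (Suc i, 0) \<sigma>'"
      using F S(2) i fd D' unfolding pass_inv_def by (auto simp: e Let_def)
    moreover have "pass_measure c (Suc i, 0) < pass_measure c (i, j)"
      using i True unfolding pass_measure_def by (simp add: dr)
    ultimately show ?thesis unfolding \<sigma>'_def by blast
  next
    case False
    then have jl: "j < deg G x" using S(3) by simp
    define \<sigma>1 where "\<sigma>1 = effect edge_com \<sigma>"
    define \<sigma>2 where "\<sigma>2 = effect output_com \<sigma>1"
    define \<sigma>3 where "\<sigma>3 = effect count_com \<sigma>2"
    define \<sigma>' where "\<sigma>' = effect pass_body \<sigma>"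
    have e: "\<sigma>' = \<sigma>3\<lparr>reg := (reg \<sigma>3)(''p'' := arr \<sigma>3 ''next'' (reg \<sigma>3 ''p''))\<rparr>"
      using False p0 unfolding \<sigma>'_def \<sigma>3_def \<sigma>2_def \<sigma>1_def by (auto simp: pass_body_def)
    have "graph_stored \<sigma>" "\<And>e. arr \<sigma> ''fl'' (int e) = flow c e"
      using S(1) unfolding final_stored_def by blast+
    note E = effect_edge_com[OF this x(1) jl S(5) S(4), folded \<sigma>1_def]
    have lev: "\<And>v. arr \<sigma>1 ''level'' (int v) = int (level c v)" "reg \<sigma>1 ''h4'' = int (4 * h)"
      using S(1) E(4,5) unfolding final_stored_def by auto
    have Dm: "D \<subseteq> marked_cells c"
      unfolding D_def marked_cells_def using m(2) x jl by (auto dest: in_set_takeD)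
    have fin: "finite D" unfolding D_def by auto
    have nD: "(x, j) \<notin> D"
    proof -
      have "x \<notin> set (take i (marked c))"
        using m(1) i unfolding x_def by (auto simp: in_set_conv_nth nth_eq_iff_index_eq)
      then show ?thesis unfolding D_def by auto
    qed
    have f1: "flows_done c D \<sigma>1" "counts_done c D \<sigma>1"
      using S(6,7) E(4,5) unfolding flows_done_def counts_done_def flow_output_def by simp_all
    have f2: "flows_done c (insert (x, j) D) \<sigma>2"
      unfolding \<sigma>2_def using E(4) S(4) lev
      by (intro flows_step[OF Dm nD x jl f1(1) _ E(1-3)]) auto
    have c2: "counts_done c D \<sigma>2"
      using f1(2) unfolding \<sigma>2_def counts_done_def by (simp add: effect_output_com)
    have c3: "counts_done c (insert (x, j) D) \<sigma>3"
      unfolding \<sigma>3_def using E(2,4) S(4) lev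
      by (intro counts_step[OF fin nD c2]) (auto simp: \<sigma>2_def effect_output_com)
    have f3: "flows_done c (insert (x, j) D) \<sigma>3"
      using f2 unfolding \<sigma>3_def flows_done_def flow_output_def by (simp add: effect_count_com)
    have fd: "flows_done c (insert (x, j) D) \<sigma>'" "counts_done c (insert (x, j) D) \<sigma>'"
      using c3 f3 unfolding flows_done_def counts_done_def flow_output_def e by simp_all
    have rr: "reg \<sigma>3 y = reg \<sigma> y" if "y \<notin> {''total'', ''flow_len'', ''e'', ''u'', ''g''}" for y
      using that E(4)[of y] unfolding \<sigma>3_def \<sigma>2_def by (simp add: effect_count_com effect_output_com)
    have aa: "arr \<sigma>3 a = arr \<sigma> a"
      if "a \<notin> {''count'', ''drop'', ''flow_edge'', ''flow_from'', ''flow_to'', ''flow_val''}" for a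
      using that E(5) unfolding \<sigma>3_def \<sigma>2_def by (simp add: effect_count_com effect_output_com)
    have F: "final_stored c \<sigma>'" by (rule final_stored_cong[OF S(1)]) (auto simp: e rr aa)
    have nx: "arr \<sigma> ''next'' (cell x j) = cell x (Suc j)"
      using S(1) x jl unfolding final_stored_def graph_stored_def by blast
    have D': "(SIGMA v:set (take i (marked c)). {..<deg G v}) \<union>
        (if i < length (marked c) then {marked c ! i} \<times> {..<Suc j} else {}) = insert (x, j) D"
      using i unfolding D_def x_def by auto
    have "pass_inv c (i, Suc j) \<sigma>'"
      using F S(2,4,5) i fd D' jl nx unfolding pass_inv_def x_def[symmetric]
      by (auto simp: e Let_def rr aa x_def)
    moreover have "pass_measure c (i, Suc j) < pass_measure c (i, j)"
      using i jl unfolding pass_measure_def by (simp add: dr) linarith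
    ultimately show ?thesis unfolding \<sigma>'_def by blast
  qed
qed

lemma pass_correct:
  assumes I: "inv c" and R: "repr c \<sigma>"
  shows "reaches pass_com \<sigma> (5 + (2 * size_bound * Suc (steps pass_body) + 1))
     (\<lambda>\<sigma>'. final_stored c \<sigma>' \<and> flows_done c (marked_cells c) \<sigma>' \<and> counts_done c (marked_cells c) \<sigma>')"
proof -
  have m: "distinct (marked c)" "set (marked c) = {v \<in> V. 0 < level c v}"
    using I unfolding inv_def count_inv_def by blast+
  define \<sigma>0 where "\<sigma>0 = effect pass_init \<sigma>"
  have F0: "final_stored c \<sigma>"
    using R unfolding repr_def vars_stored_def arrays_stored_def final_stored_def by simp
  have c0: "arr \<sigma> ''count'' = (\<lambda>_. 0)" "arr \<sigma> ''drop'' = (\<lambda>_. 0)"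
    using R unfolding repr_def arrays_stored_def by blast+
  have P0: "pass_inv c (0, 0) \<sigma>0"
  proof -
    have "final_stored c \<sigma>0" by (rule final_stored_cong[OF F0]) (auto simp: \<sigma>0_def pass_init_def)
    moreover have "reg \<sigma>0 ''cur'' = int (marked c ! 0) \<and> reg \<sigma>0 ''p'' = cell (marked c ! 0) 0"
      if "0 < length (marked c)"
    proof -
      have "marked c ! 0 \<in> V" using m(2) nth_mem[OF that] by auto
      then have "arr \<sigma> ''head'' (int (marked c ! 0)) = cell (marked c ! 0) 0"
        "arr \<sigma> ''marked'' (int 0) = int (marked c ! 0)"
        using F0 that unfolding final_stored_def graph_stored_def by blast+
      then show ?thesis by (simp add: \<sigma>0_def pass_init_def)
    qed
    moreover have "flows_done c {} \<sigma>0"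
      unfolding flows_done_def flow_output_def emitted_def
      by (intro exI[of _ "[]"]) (simp add: \<sigma>0_def pass_init_def)
    moreover have "counts_done c {} \<sigma>0"
      using c0 unfolding counts_done_def by (simp add: \<sigma>0_def pass_init_def)
    ultimately show ?thesis unfolding pass_inv_def by (auto simp: Let_def \<sigma>0_def pass_init_def)
  qed
  have "pass_measure c (0, 0) = (\<Sum>v | v \<in> V \<and> 0 < level c v. Suc (deg G v))"
    unfolding pass_measure_def using m by (simp add: sum_list_distinct_conv_sum_set)
  also have "\<dots> = (\<Sum>v | v \<in> V \<and> 0 < level c v. deg G v) + card {v \<in> V. 0 < level c v}"
    by (simp only: Suc_eq_plus1 sum.distrib card_eq_sum)
  also have "\<dots> \<le> 2 * size_bound" using marked_bounds[OF I] by linarith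
  finally have \<mu>: "pass_measure c (0, 0) \<le> 2 * size_bound" .
  have L: "reaches (While (Less (Reg ''i'') (Reg ''marked_len'')) pass_body) \<sigma>0
     (pass_measure c (0, 0) * Suc (steps pass_body) + 1)
     (\<lambda>\<sigma>'. \<not> bval (Less (Reg ''i'') (Reg ''marked_len'')) \<sigma>' \<and> (\<exists>s. pass_inv c s \<sigma>'))"
  proof (rule reaches_While[where I = "pass_inv c"])
    fix s \<sigma> assume *: "pass_inv c s \<sigma>" "bval (Less (Reg ''i'') (Reg ''marked_len'')) \<sigma>"
    obtain i j where s: "s = (i, j)" by force
    have "i < length (marked c)" using * unfolding s pass_inv_def final_stored_def by simp
    then have "\<exists>s'. pass_inv c s' (effect pass_body \<sigma>) \<and> pass_measure c s' < pass_measure c s"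
      using pass_step[OF m] * unfolding s by blast
    moreover have "loop_free pass_body"
      by (simp add: pass_body_def edge_com_def output_com_def emit_com_def count_com_def)
    ultimately show "reaches pass_body \<sigma> (steps pass_body)
      (\<lambda>\<sigma>'. \<exists>s'. pass_inv c s' \<sigma>' \<and> pass_measure c s' < pass_measure c s)"
      by (intro reaches_loop_free)
  qed (rule P0)
  have "reaches pass_com \<sigma> (steps pass_init + (pass_measure c (0, 0) * Suc (steps pass_body) + 1))
     (\<lambda>\<sigma>'. \<not> bval (Less (Reg ''i'') (Reg ''marked_len'')) \<sigma>' \<and> (\<exists>s. pass_inv c s \<sigma>'))"
    unfolding pass_com_def
    by (rule reaches_loop_free_Seq) (use L in \<open>simp_all add: pass_init_def \<sigma>0_def\<close>)
  then show ?thesis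
  proof (rule reaches_weaken)
    have "steps pass_init = 5" by (simp add: pass_init_def)
    moreover have "pass_measure c (0, 0) * Suc (steps pass_body) \<le> 2 * size_bound * Suc (steps pass_body)"
      using \<mu> by (rule mult_right_mono) simp
    ultimately show "steps pass_init + (pass_measure c (0, 0) * Suc (steps pass_body) + 1) \<le>
      5 + (2 * size_bound * Suc (steps pass_body) + 1)" by linarith
  next
    fix \<sigma>' assume "\<not> bval (Less (Reg ''i'') (Reg ''marked_len'')) \<sigma>' \<and> (\<exists>s. pass_inv c s \<sigma>')"
    then obtain i j where s: "pass_inv c (i, j) \<sigma>'" "\<not> reg \<sigma>' ''i'' < reg \<sigma>' ''marked_len''" by auto
    then have "i = length (marked c)" unfolding pass_inv_def final_stored_def by auto
    moreover have "(SIGMA v:set (marked c). {..<deg G v}) = marked_cells c"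
      unfolding marked_cells_def m(2) ..
    ultimately show "final_stored c \<sigma>' \<and> flows_done c (marked_cells c) \<sigma>' \<and> counts_done c (marked_cells c) \<sigma>'"
      using s(1) unfolding pass_inv_def by (simp add: Let_def)
  qed
qed

lemma emitted_marked:
  assumes I: "inv c"
  shows "emitted c (marked_cells c) = {(e, u, v) | e u v. ef c e u v \<noteq> 0}"
proof -
  have 1: "\<exists>j. (w, j) \<in> marked_cells c \<and> inc w j = e"
    if "0 < level c w" "ef c e u v \<noteq> 0" "w = u \<or> w = v" for e u v w
  proof -
    have e: "e \<in> E" "ends G e = {u, v}" using that(2) unfolding edge_flow_def by (auto split: if_splits)
    then have w: "w \<in> V" "e \<in> {e \<in> E. w \<in> ends G e}"
      using multigraph that(3) unfolding multigraph_def by auto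
    moreover have "inc w ` {..<deg G w} = {e \<in> E. w \<in> ends G e}"
      using inc_bij[OF w(1)] unfolding bij_betw_def by blast
    ultimately obtain j where "j < deg G w" "e = inc w j" by auto
    then show ?thesis using w that(1) unfolding marked_cells_def by auto
  qed
  show ?thesis
    unfolding emitted_def using 1 unmarked_flow_zero[OF I] by (auto; metis neq0_conv)
qed

lemma flows_done_outputs:
  assumes "inv c" "flows_done c (marked_cells c) \<sigma>"
  shows "outputs_preflow (ef c) \<sigma>"
proof -
  obtain xs where xs: "distinct xs" "set xs = emitted c (marked_cells c)" "flow_output xs (length xs) (ef c) \<sigma>"
    using assms(2) unfolding flows_done_def by blast
  have "\<forall>i<length xs. arr \<sigma> ''flow_edge'' (int i) = int (fst (xs ! i)) \<and>
     arr \<sigma> ''flow_from'' (int i) = int (fst (snd (xs ! i))) \<and> arr \<sigma> ''flow_to'' (int i) = int (snd (snd (xs ! i)))"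
    using xs(3) unfolding flow_output_def by (simp add: case_prod_beta)
  then show ?thesis
    using xs emitted_marked[OF assms(1)] unfolding outputs_preflow_def holds_list_def flow_output_def
    by (intro exI[of _ xs]) (simp add: case_prod_beta)
qed

lemma counts_marked:
  assumes C: "counts_done c (marked_cells c) \<sigma>"
  shows "reg \<sigma> ''total'' = int (above c 1)"
    and "1 \<le> k \<Longrightarrow> arr \<sigma> ''count'' (int k) = int (lvol c k)"
    and "1 \<le> k \<Longrightarrow> arr \<sigma> ''drop'' (int k) = int (4 * h * drops c k)"
proof -
  have "card (marked_cells c) = above c 1"
    unfolding marked_cells_def above_def vol_def by (simp add: Suc_le_eq)
  then show "reg \<sigma> ''total'' = int (above c 1)" using C unfolding counts_done_def by simp
  assume k: "1 \<le> k"
  have "{(v, j) \<in> marked_cells c. level c v = k} = (SIGMA v:{v. v \<in> V \<and> level c v = k}. {..<deg G v})"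
    using k unfolding marked_cells_def by auto
  then have "card {(v, j) \<in> marked_cells c. level c v = k} = lvol c k" unfolding lvol_def by simp
  then show "arr \<sigma> ''count'' (int k) = int (lvol c k)" using C unfolding counts_done_def by simp
  have "{(v, j) \<in> marked_cells c. level c v = k \<and> Suc (level c (nb v j)) = k} =
     (SIGMA v:{v. v \<in> V \<and> level c v = k}. {j. j < deg G v \<and> Suc (level c (nb v j)) = k})"
    using k unfolding marked_cells_def by auto
  then have "card {(v, j) \<in> marked_cells c. level c v = k \<and> Suc (level c (nb v j)) = k} = drops c k"
    unfolding drops_def by simp
  then show "arr \<sigma> ''drop'' (int k) = int (4 * h * drops c k)" using C unfolding counts_done_def by simp
qed

text \<open>The known good level \<open>m\<close> guarantees termination and bounds the cost, and
  the level found is at most \<open>m\<close>.\<close>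

lemma find_correct:
  assumes F: "final_stored c \<sigma>" and fl: "flows_done c D \<sigma>" and C: "counts_done c (marked_cells c) \<sigma>"
    and g: "1 \<le> m" "good c m"
  shows "reaches find_com \<sigma> (2 + (m * 4 + 1))
     (\<lambda>\<sigma>'. final_stored c \<sigma>' \<and> flows_done c D \<sigma>' \<and> (\<exists>k. reg \<sigma>' ''i'' = int k \<and> 1 \<le> k \<and> k \<le> m \<and> good c k))"
proof -
  define I where "I k \<tau> \<longleftrightarrow> final_stored c \<tau> \<and> flows_done c D \<tau> \<and> 1 \<le> k \<and> k \<le> m \<and> reg \<tau> ''i'' = int k \<and>
     reg \<tau> ''total'' = int (above c k) \<and> reg \<tau> ''below'' = 1 + int (above c 1) - int (above c k) \<and>
     (\<forall>l\<ge>1. arr \<tau> ''count'' (int l) = int (lvol c l) \<and> arr \<tau> ''drop'' (int l) = int (4 * h * drops c l))" for k \<tau>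
  let ?b = "Not (And (Less (Read ''drop'' (Reg ''i'')) (Reg ''total'')) (Less (Read ''drop'' (Reg ''i'')) (Reg ''below'')))"
  let ?c = "add_reg ''below'' (Read ''count'' (Reg ''i'')) ;;
        Assign ''total'' (Sub (Reg ''total'') (Read ''count'' (Reg ''i''))) ;; add_reg ''i'' (num 1)"
  have anti: "above c k \<le> above c 1" if "1 \<le> k" for k
    unfolding above_def vol_def using that by (intro sum_mono2) auto
  have bv: "bval ?b \<tau> \<longleftrightarrow> \<not> good c k" if "I k \<tau>" for k \<tau>
  proof -
    have v: "reg \<tau> ''i'' = int k" "arr \<tau> ''drop'' (int k) = int (4 * h * drops c k)"
      "reg \<tau> ''total'' = int (above c k)" "reg \<tau> ''below'' = int (1 + above c 1 - above c k)"
      using that anti[of k] unfolding I_def by auto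
    show ?thesis unfolding bval.simps aval.simps v good_def of_nat_less_iff ..
  qed
  define \<sigma>0 where "\<sigma>0 = effect (Assign ''i'' (num 1) ;; Assign ''below'' (num 1)) \<sigma>"
  have I0: "I 1 \<sigma>0"
  proof -
    have "final_stored c \<sigma>0" by (rule final_stored_cong[OF F]) (auto simp: \<sigma>0_def)
    moreover have "flows_done c D \<sigma>0" using fl unfolding flows_done_def flow_output_def \<sigma>0_def by simp
    ultimately show ?thesis
      using g(1) counts_marked[OF C] unfolding I_def by (simp add: \<sigma>0_def)
  qed
  have L: "reaches (While ?b ?c) \<sigma>0 ((m - 1) * Suc (steps ?c) + 1) (\<lambda>\<sigma>'. \<not> bval ?b \<sigma>' \<and> (\<exists>k. I k \<sigma>'))"
  proof (rule reaches_While[where \<mu> = "\<lambda>k. m - k" and I = I])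
    fix k \<tau> assume *: "I k \<tau>" "bval ?b \<tau>"
    then have "k \<noteq> m" using bv g(2) by auto
    then have km: "k < m" using *(1) unfolding I_def by simp
    define \<tau>' where "\<tau>' = effect ?c \<tau>"
    have "final_stored c \<tau>" "flows_done c D \<tau>" using *(1) unfolding I_def by auto
    then have "final_stored c \<tau>'" "flows_done c D \<tau>'"
      by (auto simp: \<tau>'_def flows_done_def flow_output_def intro!: final_stored_cong[of c \<tau>])
    moreover have "arr \<tau> ''count'' (int k) = int (lvol c k)" using *(1) unfolding I_def by auto
    ultimately have "I (Suc k) \<tau>'"
      using *(1) km above_Suc[of c k] unfolding I_def by (simp add: \<tau>'_def)
    moreover have "m - Suc k < m - k" using km by simp
    ultimately show "reaches ?c \<tau> (steps ?c) (\<lambda>\<sigma>'. \<exists>k'. I k' \<sigma>' \<and> m - k' < m - k)"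
      unfolding \<tau>'_def by (intro reaches_loop_free) (simp, blast)
  qed (rule I0)
  have "reaches find_com \<sigma> (2 + ((m - 1) * Suc (steps ?c) + 1)) (\<lambda>\<sigma>'. \<not> bval ?b \<sigma>' \<and> (\<exists>k. I k \<sigma>'))"
    using reaches_loop_free_Seq[OF _ L[unfolded \<sigma>0_def]] unfolding find_com_def by simp
  then show ?thesis
  proof (rule reaches_weaken)
    fix \<sigma>' assume "\<not> bval ?b \<sigma>' \<and> (\<exists>k. I k \<sigma>')"
    then obtain k where "I k \<sigma>'" "good c k" using bv by blast
    then show "final_stored c \<sigma>' \<and> flows_done c D \<sigma>' \<and> (\<exists>k. reg \<sigma>' ''i'' = int k \<and> 1 \<le> k \<and> k \<le> m \<and> good c k)"
      unfolding I_def by blast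
  qed simp
qed

lemma cut_correct:
  assumes I: "inv c" and F: "final_stored c \<sigma>" and fl: "flows_done c D \<sigma>" and i: "reg \<sigma> ''i'' = int k" "1 \<le> k"
  shows "reaches cut_com \<sigma> (2 + (size_bound * Suc (steps cut_body) + 1))
     (\<lambda>\<sigma>'. final_stored c \<sigma>' \<and> flows_done c D \<sigma>' \<and> outputs_set {v \<in> V. k \<le> level c v} \<sigma>')"
proof -
  have m: "distinct (marked c)" "set (marked c) = {v \<in> V. 0 < level c v}"
    using I unfolding inv_def count_inv_def by blast+
  let ?n = "length (marked c)" and ?f = "\<lambda>j. filter (\<lambda>v. k \<le> level c v) (take j (marked c))"
  define J where "J j \<tau> \<longleftrightarrow> final_stored c \<tau> \<and> flows_done c D \<tau> \<and> reg \<tau> ''j'' = int j \<and>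
     reg \<tau> ''i'' = int k \<and> reg \<tau> ''cut_len'' = int (length (?f j)) \<and> holds_list \<tau> ''cut'' (?f j)" for j \<tau>
  define \<sigma>0 where "\<sigma>0 = effect (Assign ''j'' (num 0) ;; Assign ''cut_len'' (num 0)) \<sigma>"
  have L: "reaches (While (Less (Reg ''j'') (Reg ''marked_len'')) cut_body) \<sigma>0 (?n * Suc (steps cut_body) + 1) (J ?n)"
  proof (rule reaches_for)
    show "bval (Less (Reg ''j'') (Reg ''marked_len'')) \<tau> \<longleftrightarrow> j < ?n" if "J j \<tau>" for j \<tau>
      using that unfolding J_def final_stored_def by simp
    have "final_stored c \<sigma>0" by (rule final_stored_cong[OF F]) (auto simp: \<sigma>0_def)
    moreover have "flows_done c D \<sigma>0" using fl unfolding flows_done_def flow_output_def \<sigma>0_def by simp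
    ultimately show "J 0 \<sigma>0" using i unfolding J_def holds_list_def by (simp add: \<sigma>0_def)
  next
    fix j \<tau> assume *: "J j \<tau>" and j: "j < ?n"
    define \<tau>' where "\<tau>' = effect cut_body \<tau>"
    have Ft: "final_stored c \<tau>" "flows_done c D \<tau>" using * unfolding J_def by auto
    have F': "final_stored c \<tau>'" by (rule final_stored_cong[OF Ft(1)]) (auto simp: \<tau>'_def cut_body_def)
    have fl': "flows_done c D \<tau>'" using Ft(2) by (auto simp: \<tau>'_def cut_body_def flows_done_def flow_output_def)
    have v: "reg \<tau> ''j'' = int j" "arr \<tau> ''marked'' (int j) = int (marked c ! j)"
      "arr \<tau> ''level'' (int (marked c ! j)) = int (level c (marked c ! j))" "reg \<tau> ''i'' = int k"
      using * j unfolding J_def final_stored_def by auto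
    have t: "take (Suc j) (marked c) = take j (marked c) @ [marked c ! j]"
      using j by (rule take_Suc_conv_app_nth)
    show "J (Suc j) (effect cut_body \<tau>)"
      using * j F' fl' v unfolding J_def t holds_list_def
      by (auto simp: \<tau>'_def cut_body_def nth_append less_Suc_eq)
  qed (simp add: cut_body_def)
  have "reaches cut_com \<sigma> (2 + (?n * Suc (steps cut_body) + 1)) (J ?n)"
    using reaches_loop_free_Seq[OF _ L[unfolded \<sigma>0_def]] unfolding cut_com_def by simp
  then show ?thesis
  proof (rule reaches_weaken)
    have "?n \<le> size_bound" using marked_bounds(2)[OF I] m by (metis distinct_card)
    then show "2 + (?n * Suc (steps cut_body) + 1) \<le> 2 + (size_bound * Suc (steps cut_body) + 1)"
      using mult_right_mono[of ?n size_bound "Suc (steps cut_body)"] by simp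
  next
    fix \<sigma>' assume J: "J ?n \<sigma>'"
    then have "outputs_set (set (filter (\<lambda>v. k \<le> level c v) (marked c))) \<sigma>'"
      using m(1) unfolding outputs_set_def J_def by (intro exI[of _ "filter (\<lambda>v. k \<le> level c v) (marked c)"]) simp
    \<comment> \<open>As \<open>k\<close> is positive, all nodes of level at least \<open>k\<close>
      are marked.\<close>
    moreover have "set (filter (\<lambda>v. k \<le> level c v) (marked c)) = {v \<in> V. k \<le> level c v}"
      unfolding set_filter m(2) using i(2) by auto
    ultimately show "final_stored c \<sigma>' \<and> flows_done c D \<sigma>' \<and> outputs_set {v \<in> V. k \<le> level c v} \<sigma>'"
      using J unfolding J_def by simp
  qed
qed

end


section \<open>Initialization and the main result\<close>

text \<open>\<open>h\<close> additions of \<open>2 F\<close> replace the product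
  \<open>2 h F\<close>.\<close>

definition cap_body :: com where
  "cap_body = add_reg ''U'' (Add (Reg ''F'') (Reg ''F'')) ;; add_reg ''i'' (num 1)"

definition sink_body :: com where
  "sink_body = Write ''listed'' (Read ''sink_node'' (Reg ''i'')) (num 1) ;;
     Write ''limit'' (Read ''sink_node'' (Reg ''i'')) (Read ''sink_val'' (Reg ''i'')) ;; add_reg ''i'' (num 1)"

definition source_body :: com where
  "source_body = Write ''pile'' (Read ''source_node'' (Reg ''i'')) (Read ''source_val'' (Reg ''i'')) ;;
     Write ''queue'' (Reg ''i'') (Read ''source_node'' (Reg ''i'')) ;;
     add_reg ''excess'' (Read ''source_val'' (Reg ''i'')) ;; add_reg ''i'' (num 1)"

definition start_com :: com where
  "start_com = Assign ''qt'' (Reg ''source_len'') ;; Assign ''cur'' (Read ''queue'' (num 0)) ;; Assign ''pow'' (num 2) ;;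
     Assign ''h4'' (Add (Add (Reg ''h'') (Reg ''h'')) (Add (Reg ''h'') (Reg ''h''))) ;;
     Assign ''H'' (Add (Reg ''h4'') (Reg ''h4''))"

definition init_com :: com where
  "init_com =
     While (Less (Reg ''i'') (Reg ''h'')) cap_body ;;
     Assign ''i'' (num 0) ;; While (Less (Reg ''i'') (Reg ''sink_len'')) sink_body ;;
     Assign ''i'' (num 0) ;; While (Less (Reg ''i'') (Reg ''source_len'')) source_body ;;
     start_com"

text \<open>Without sources the time bound may be constant, too little even for the loop that
  computes the capacity, hence the early exit.\<close>

definition flow_program :: com where
  "flow_program = Cond (Less (num 0) (Reg ''source_len''))
     (init_com ;; While main_guard main_body ;; pass_com ;;
      Cond (Less (num 0) (Reg ''excess'')) (find_com ;; cut_com) Skip)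
     Skip"

definition init_cost :: nat where
  "init_cost = (steps cap_body + 2) + 1 + (steps sink_body + 2) + 1 + (steps source_body + 2) + steps start_com"

text \<open>Additive constants are charged to \<open>h * F * K * size_bound\<close>, which is at
  least 1 once there is a source.\<close>

definition total_cost :: nat where
  "total_cost = init_cost + (40 * Suc (steps main_body) + 1) + (2 * Suc (steps pass_body) + 6) +
     (1 + (35 + (Suc (steps cut_body) + 3))) + 3"

section \<open>From the input to the initial configuration\<close>

lemma linked_list_nth:
  "linked_list nxt p cs \<Longrightarrow> p = (cs @ [0]) ! 0 \<and>
     (\<forall>j<length cs. cs ! j \<noteq> 0 \<and> nxt (cs ! j) = (cs @ [0]) ! Suc j)"
proof (induction cs arbitrary: p)
  case (Cons c cs)
  then show ?case by (auto simp: nth_Cons split: nat.split)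
qed simp

text \<open>The input predicate asserts for each node that suitable lists exist. Choosing them once
  gives the functions of the locales, with the null pointer as cell number
  \<open>deg G v\<close>.\<close>

lemma incidence_enumeration:
  assumes "multigraph G" "holds_incidence_lists G \<sigma>"
  obtains cell inc nb where "incidence G inc nb"
    and "\<And>v j. v \<in> verts G \<Longrightarrow> j \<le> deg G v \<Longrightarrow> cell v j = 0 \<longleftrightarrow> j = deg G v"
    and "\<And>v. v \<in> verts G \<Longrightarrow> arr \<sigma> ''head'' (int v) = cell v 0 \<and>
     (\<forall>j<deg G v. arr \<sigma> ''next'' (cell v j) = cell v (Suc j) \<and>
        arr \<sigma> ''edge'' (cell v j) = int (inc v j) \<and> arr \<sigma> ''nbr'' (cell v j) = int (nb v j))"
proof -
  let ?P = "\<lambda>v cs es. linked_list (arr \<sigma> ''next'') (arr \<sigma> ''head'' (int v)) cs \<and>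
        distinct es \<and> set es = {e \<in> edges G. v \<in> ends G e} \<and> length cs = length es \<and>
        (\<forall>i<length cs. arr \<sigma> ''edge'' (cs ! i) = int (es ! i) \<and>
           (\<exists>u. arr \<sigma> ''nbr'' (cs ! i) = int u \<and> ends G (es ! i) = {v, u}))"
  have "\<forall>v\<in>verts G. \<exists>cs es. ?P v cs es" using assms(2) unfolding holds_incidence_lists_def by blast
  then have "\<exists>cs. \<forall>v\<in>verts G. \<exists>es. ?P v (cs v) es" by (rule bchoice)
  then obtain cs where "\<forall>v\<in>verts G. \<exists>es. ?P v (cs v) es" by (rule exE)
  then have "\<exists>es. \<forall>v\<in>verts G. ?P v (cs v) (es v)" by (rule bchoice)
  then obtain es where "\<forall>v\<in>verts G. ?P v (cs v) (es v)" by (rule exE)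
  then have P: "\<And>v. v \<in> verts G \<Longrightarrow> ?P v (cs v) (es v)" by (rule bspec)
  define cell where "cell v j = (cs v @ [0]) ! j" for v j
  define inc where "inc v j = es v ! j" for v j
  define nb where "nb v j = nat (arr \<sigma> ''nbr'' (cs v ! j))" for v j
  have len: "length (cs v) = deg G v" "length (es v) = deg G v" if "v \<in> verts G" for v
    using P[OF that] distinct_card[of "es v"] unfolding deg_def by auto
  have cell_cs: "cell v j = cs v ! j" if "v \<in> verts G" "j < deg G v" for v j
    using len(1)[OF that(1)] that(2) unfolding cell_def by (simp add: nth_append)
  have nb: "arr \<sigma> ''nbr'' (cs v ! j) = int (nb v j) \<and> ends G (inc v j) = {v, nb v j}"
    if v: "v \<in> verts G" and j: "j < deg G v" for v j
  proof -
    have "\<forall>i<length (cs v). arr \<sigma> ''edge'' (cs v ! i) = int (es v ! i) \<and>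
        (\<exists>u. arr \<sigma> ''nbr'' (cs v ! i) = int u \<and> ends G (es v ! i) = {v, u})"
      using P[OF v] by (elim conjE)
    then obtain u where "arr \<sigma> ''nbr'' (cs v ! j) = int u" "ends G (es v ! j) = {v, u}"
      using len(1)[OF v] j by auto
    then show ?thesis unfolding nb_def inc_def by simp
  qed
  have "incidence G inc nb"
  proof
    show "multigraph G" by (rule assms(1))
    fix v assume v: "v \<in> verts G"
    have "bij_betw (\<lambda>j. es v ! j) {..<deg G v} {e \<in> edges G. v \<in> ends G e}"
      using P[OF v] len[OF v] by (intro bij_betw_nth) auto
    then show "bij_betw (inc v) {..<deg G v} {e \<in> edges G. v \<in> ends G e}"
      unfolding inc_def[abs_def] .
  qed (use nb in blast)
  moreover have "cell v j = 0 \<longleftrightarrow> j = deg G v" if v: "v \<in> verts G" and j: "j \<le> deg G v" for v j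
  proof (cases "j = deg G v")
    case True
    then show ?thesis using len(1)[OF v] unfolding cell_def by (simp add: nth_append)
  next
    case False
    then have "j < deg G v" using j by simp
    then show ?thesis using linked_list_nth[of _ _ "cs v"] P[OF v] len(1)[OF v] cell_cs[OF v] False by force
  qed
  moreover have "arr \<sigma> ''head'' (int v) = cell v 0 \<and>
     (\<forall>j<deg G v. arr \<sigma> ''next'' (cell v j) = cell v (Suc j) \<and>
        arr \<sigma> ''edge'' (cell v j) = int (inc v j) \<and> arr \<sigma> ''nbr'' (cell v j) = int (nb v j))"
    if v: "v \<in> verts G" for v
    using linked_list_nth[of "arr \<sigma> ''next''" "arr \<sigma> ''head'' (int v)" "cs v"] P[OF v] len[OF v] cell_cs[OF v] nb[OF v]
    unfolding inc_def by (auto simp: cell_def)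
  ultimately show ?thesis using that by blast
qed

context machine
begin

definition init_conf :: "nat list \<Rightarrow> conf" where
  "init_conf ns = \<lparr>level = (\<lambda>_. 0), scanned = (\<lambda>_. 0), absorbed = (\<lambda>_. 0),
     pile = (\<lambda>v. if v \<in> V then \<Delta> v else 0), flow = (\<lambda>_. 0), queue = ns, node = hd ns, base = 0,
     seen = 0, expo = 1, pops = 0, marked = []\<rparr>"

lemma inv_init:
  assumes ns: "ns \<noteq> []" "distinct ns" "set ns = {v \<in> V. 0 < \<Delta> v}"
  shows "inv (init_conf ns)"
proof -
  obtain w ws where w: "ns = w # ws" using ns(1) by (cases ns) auto
  have "length ns = card {v \<in> V. 0 < \<Delta> v}" using ns distinct_card by metis
  also have "\<dots> = (\<Sum>v | v \<in> V \<and> 0 < \<Delta> v. 1)" by simp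
  also have "\<dots> \<le> (\<Sum>v | v \<in> V \<and> 0 < \<Delta> v. \<Delta> v)" by (intro sum_mono) auto
  also have "\<dots> \<le> (\<Sum>v\<in>V. \<Delta> v)" by (intro sum_mono2) auto
  finally have len: "length ns \<le> (\<Sum>v\<in>V. \<Delta> v)" .
  have z: "edge_flow G (\<lambda>_. 0) = (\<lambda>_ _ _. 0)" unfolding edge_flow_def by (auto simp: fun_eq_iff)
  have "flow_inv (init_conf ns)"
    unfolding flow_inv_def init_conf_def using \<Delta> h F by (simp add: z amount_def)
  moreover have "w \<in> V" "set ws \<subseteq> V" "distinct ws" "w \<notin> set ws" "\<And>y. y \<in> set ws \<Longrightarrow> 0 < \<Delta> y"
     "\<And>y. y \<in> V \<Longrightarrow> 0 < \<Delta> y \<Longrightarrow> y = w \<or> y \<in> set ws"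
    using ns(2,3) unfolding w by auto
  then have "queue_inv (init_conf ns)"
    unfolding queue_inv_def init_conf_def w using h by (simp add: sorted_wrt_true) blast
  moreover have "count_inv (init_conf ns)"
    using len unfolding count_inv_def init_conf_def visited_def by simp
  ultimately show ?thesis unfolding inv_def by simp
qed

text \<open>\<open>K\<close> is arbitrary here and only gives the cost the same form as that of the
  later phases.\<close>

lemma init_correct:
  assumes in_: "is_input G h F \<Delta> T \<sigma>" and gs: "graph_stored \<sigma>" and len: "0 < reg \<sigma> ''source_len''"
    and K: "1 \<le> K"
  shows "reaches init_com \<sigma> (init_cost * (h * F * K * size_bound)) (\<lambda>\<tau>. \<exists>c. inv c \<and> repr c \<tau>)"
    and "1 \<le> size_bound"
proof -
  obtain ds where ds: "distinct ds" "set ds = {(v, \<Delta> v) | v. v \<in> V \<and> \<Delta> v > 0}"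
      "reg \<sigma> ''source_len'' = int (length ds)" "holds_list \<sigma> ''source_node'' (map fst ds)"
      "holds_list \<sigma> ''source_val'' (map snd ds)"
    using in_ unfolding is_input_def by (elim conjE exE) (rule that)
  obtain ts where ts: "distinct ts" "set ts = {(v, T v) | v. v \<in> V \<and> T v < deg G v}"
      "reg \<sigma> ''sink_len'' = int (length ts)" "holds_list \<sigma> ''sink_node'' (map fst ts)"
      "holds_list \<sigma> ''sink_val'' (map snd ts)"
    using in_ unfolding is_input_def by (elim conjE exE) (rule that)
  have rz: "reg \<sigma> ''h'' = int h" "reg \<sigma> ''F'' = int F"
    "\<And>x. x \<notin> {''h'', ''F'', ''nodes_len'', ''source_len'', ''sink_len''} \<Longrightarrow> reg \<sigma> x = 0"
    using in_ unfolding is_input_def by blast+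
  have "\<forall>a. a \<notin> {''head'', ''next'', ''edge'', ''nbr'', ''nodes'', ''source_node'', ''source_val'',
        ''sink_node'', ''sink_val''} \<longrightarrow> arr \<sigma> a = (\<lambda>i. 0)"
    using in_ unfolding is_input_def by (elim conjE)
  note az = this[rule_format]
  define ns where "ns = map fst ds"
  have injd: "inj_on fst (set ds)" unfolding ds(2) by (auto simp: inj_on_def)
  have ns: "ns \<noteq> []" "distinct ns" "set ns = {v \<in> V. 0 < \<Delta> v}"
    using len ds(1-3) injd unfolding ns_def by (auto simp: distinct_map image_iff)
  have nth_d: "ds ! i = (ns ! i, \<Delta> (ns ! i))" "ns ! i \<in> V" if "i < length ds" for i
    using nth_mem[OF that] that unfolding ds(2) ns_def by auto
  have nth_t: "ts ! i = (fst (ts ! i), T (fst (ts ! i)))" if "i < length ts" for i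
    using nth_mem[OF that] unfolding ts(2) by auto
  define c where "c = init_conf ns"
  have I: "inv c" unfolding c_def by (rule inv_init[OF ns])

  define J1 where "J1 i \<tau> \<longleftrightarrow> arr \<tau> = arr \<sigma> \<and> (\<forall>x. x \<notin> {''U'', ''i''} \<longrightarrow> reg \<tau> x = reg \<sigma> x) \<and>
     reg \<tau> ''i'' = int i \<and> reg \<tau> ''U'' = 2 * int i * int F" for i and \<tau> :: state
  have L1: "reaches (While (Less (Reg ''i'') (Reg ''h'')) cap_body) \<sigma> (h * Suc (steps cap_body) + 1) (J1 h)"
  proof (rule reaches_for)
    show "bval (Less (Reg ''i'') (Reg ''h'')) \<tau> \<longleftrightarrow> i < h" if "J1 i \<tau>" for i \<tau>
      using that rz unfolding J1_def by simp
    show "J1 (Suc i) (effect cap_body \<tau>)" if "J1 i \<tau>" for i \<tau>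
      using that rz unfolding J1_def cap_body_def by (simp add: algebra_simps)
  qed (use rz in \<open>simp_all add: J1_def cap_body_def\<close>)

  define J2 where "J2 i \<tau> \<longleftrightarrow> (\<forall>x. x \<notin> {''U'', ''i''} \<longrightarrow> reg \<tau> x = reg \<sigma> x) \<and>
     reg \<tau> ''i'' = int i \<and> reg \<tau> ''U'' = 2 * int h * int F \<and>
     (\<forall>a. a \<notin> {''listed'', ''limit''} \<longrightarrow> arr \<tau> a = arr \<sigma> a) \<and>
     (\<forall>v. arr \<tau> ''listed'' (int v) = (if v \<in> fst ` set (take i ts) then 1 else 0) \<and>
        arr \<tau> ''limit'' (int v) = (if v \<in> fst ` set (take i ts) then int (T v) else 0))" for i and \<tau> :: state
  have L2: "reaches (While (Less (Reg ''i'') (Reg ''sink_len'')) sink_body) (effect (Assign ''i'' (num 0)) \<tau>)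
     (length ts * Suc (steps sink_body) + 1) (J2 (length ts))" if t: "J1 h \<tau>" for \<tau>
  proof (rule reaches_for)
    show "bval (Less (Reg ''i'') (Reg ''sink_len'')) \<tau> \<longleftrightarrow> i < length ts" if "J2 i \<tau>" for i \<tau>
      using that ts(3) unfolding J2_def by simp
    show "J2 0 (effect (Assign ''i'' (num 0)) \<tau>)"
      using t az unfolding J1_def J2_def by simp
    show "J2 (Suc i) (effect sink_body \<tau>)" if J: "J2 i \<tau>" and i: "i < length ts" for i \<tau>
    proof -
      have v: "arr \<tau> ''sink_node'' (int i) = int (fst (ts ! i))" "arr \<tau> ''sink_val'' (int i) = int (T (fst (ts ! i)))"
      proof -
        have "arr \<tau> ''sink_node'' = arr \<sigma> ''sink_node''" "arr \<tau> ''sink_val'' = arr \<sigma> ''sink_val''"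
          using J unfolding J2_def by simp_all
        moreover have "arr \<sigma> ''sink_node'' (int i) = int (map fst ts ! i)"
          "arr \<sigma> ''sink_val'' (int i) = int (map snd ts ! i)"
          using ts(4,5) i unfolding holds_list_def by simp_all
        moreover have "snd (ts ! i) = T (fst (ts ! i))" by (subst nth_t[OF i]) simp
        ultimately show "arr \<tau> ''sink_node'' (int i) = int (fst (ts ! i))"
          "arr \<tau> ''sink_val'' (int i) = int (T (fst (ts ! i)))"
          using i by simp_all
      qed
      have tk: "take (Suc i) ts = take i ts @ [ts ! i]" using i by (rule take_Suc_conv_app_nth)
      show ?thesis
        using J v unfolding J2_def tk sink_body_def by auto
    qed
  qed (simp add: sink_body_def)

  define J3 where "J3 i \<tau> \<longleftrightarrow> (\<forall>x. x \<notin> {''U'', ''i'', ''excess''} \<longrightarrow> reg \<tau> x = reg \<sigma> x) \<and>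
     reg \<tau> ''i'' = int i \<and> reg \<tau> ''U'' = 2 * int h * int F \<and>
     reg \<tau> ''excess'' = (\<Sum>v\<in>set (take i ns). int (\<Delta> v)) \<and>
     (\<forall>a. a \<notin> {''listed'', ''limit'', ''pile'', ''queue''} \<longrightarrow> arr \<tau> a = arr \<sigma> a) \<and>
     (\<forall>v. arr \<tau> ''listed'' (int v) = (if v \<in> fst ` set ts then 1 else 0) \<and>
        arr \<tau> ''limit'' (int v) = (if v \<in> fst ` set ts then int (T v) else 0)) \<and>
     (\<forall>v. arr \<tau> ''pile'' (int v) = (if v \<in> set (take i ns) then int (\<Delta> v) else 0)) \<and>
     (\<forall>l<i. arr \<tau> ''queue'' (int l) = int (ns ! l))" for i and \<tau> :: state
  have L3: "reaches (While (Less (Reg ''i'') (Reg ''source_len'')) source_body) (effect (Assign ''i'' (num 0)) \<tau>)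
     (length ds * Suc (steps source_body) + 1) (J3 (length ds))" if t: "J2 (length ts) \<tau>" for \<tau>
  proof (rule reaches_for)
    show "bval (Less (Reg ''i'') (Reg ''source_len'')) \<tau> \<longleftrightarrow> i < length ds" if "J3 i \<tau>" for i \<tau>
      using that ds(3) unfolding J3_def by simp
    show "J3 0 (effect (Assign ''i'' (num 0)) \<tau>)"
      using t az rz unfolding J2_def J3_def by simp
    show "J3 (Suc i) (effect source_body \<tau>)" if J: "J3 i \<tau>" and i: "i < length ds" for i \<tau>
    proof -
      have v: "arr \<tau> ''source_node'' (int i) = int (ns ! i)" "arr \<tau> ''source_val'' (int i) = int (\<Delta> (ns ! i))"
      proof -
        have "arr \<tau> ''source_node'' = arr \<sigma> ''source_node''" "arr \<tau> ''source_val'' = arr \<sigma> ''source_val''"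
          using J unfolding J3_def by simp_all
        moreover have "arr \<sigma> ''source_node'' (int i) = int (map fst ds ! i)"
          "arr \<sigma> ''source_val'' (int i) = int (map snd ds ! i)"
          using ds(4,5) i unfolding holds_list_def by simp_all
        moreover have "fst (ds ! i) = ns ! i" using i unfolding ns_def by simp
        moreover have "snd (ds ! i) = \<Delta> (ns ! i)" using nth_d(1)[OF i] by (metis snd_conv)
        ultimately show "arr \<tau> ''source_node'' (int i) = int (ns ! i)"
          "arr \<tau> ''source_val'' (int i) = int (\<Delta> (ns ! i))"
          using i \<open>fst (ds ! i) = ns ! i\<close> \<open>snd (ds ! i) = \<Delta> (ns ! i)\<close> by simp_all
      qed
      have il: "i < length ns" using i unfolding ns_def by simp
      have tk: "take (Suc i) ns = take i ns @ [ns ! i]" using il by (rule take_Suc_conv_app_nth)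
      have "ns ! i \<notin> set (take i ns)"
        using ns(2) il by (auto simp: in_set_conv_nth nth_eq_iff_index_eq)
      then show ?thesis
        using J v unfolding J3_def tk source_body_def by (auto simp: less_Suc_eq)
    qed
  qed (simp add: source_body_def)

  have L4: "reaches start_com \<tau> (steps start_com) (\<lambda>\<tau>. \<exists>c. inv c \<and> repr c \<tau>)" if t: "J3 (length ds) \<tau>" for \<tau>
  proof -
    have tk: "take (length ds) ns = ns" unfolding ns_def by simp
    have sl: "reg \<tau> ''source_len'' = int (length ns)" "reg \<tau> ''h'' = int h"
      "\<And>x. x \<notin> {''h'', ''F'', ''nodes_len'', ''source_len'', ''sink_len'', ''U'', ''i'', ''excess''} \<Longrightarrow> reg \<tau> x = 0"
      using t ds(3) rz unfolding J3_def ns_def by auto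
    have hd: "arr \<tau> ''queue'' 0 = int (hd ns)"
    proof -
      have "0 < length ds" using ns(1) unfolding ns_def by simp
      then have "arr \<tau> ''queue'' (int 0) = int (ns ! 0)" using t unfolding J3_def by blast
      then show ?thesis using ns(1) by (simp add: hd_conv_nth)
    qed
    have ex: "reg \<tau> ''excess'' = (\<Sum>v\<in>V. int (\<Delta> v))"
    proof -
      have "(\<Sum>v\<in>set ns. int (\<Delta> v)) = (\<Sum>v\<in>V. int (\<Delta> v))"
        unfolding ns(3) by (intro sum.mono_neutral_left) auto
      then show ?thesis using t unfolding J3_def tk by simp
    qed
    have lst: "v \<in> fst ` set ts \<longleftrightarrow> T v < deg G v" if "v \<in> V" for v
      using that unfolding ts(2) by force
    have "vars_stored c (effect start_com \<tau>)"
      using t sl hd ex unfolding vars_stored_def c_def init_conf_def start_com_def J3_def by simp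
    moreover have "graph_stored (effect start_com \<tau>)"
      using gs t unfolding graph_stored_def start_com_def J3_def by simp
    moreover have "arrays_stored c (effect start_com \<tau>)"
      using t lst ns(3) az unfolding arrays_stored_def c_def init_conf_def start_com_def J3_def tk
      by (auto simp: ns_def)
    ultimately have "repr c (effect start_com \<tau>)" unfolding repr_def by simp
    then show ?thesis using I by (intro reaches_loop_free) (auto simp: start_com_def)
  qed

  let ?t = "(h * Suc (steps cap_body) + 1) + (1 + ((length ts * Suc (steps sink_body) + 1) +
     (1 + ((length ds * Suc (steps source_body) + 1) + steps start_com))))"
  have R: "reaches init_com \<sigma> ?t (\<lambda>\<tau>. \<exists>c. inv c \<and> repr c \<tau>)"
    unfolding init_com_def
  proof (rule reaches_Seq[OF L1])
    fix \<tau>1 assume 1: "J1 h \<tau>1"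
    have st: "steps (Assign ''i'' (num 0)) = 1" "loop_free (Assign ''i'' (num 0))" by simp_all
    have "reaches (While (Less (Reg ''i'') (Reg ''sink_len'')) sink_body ;;
        Assign ''i'' (num 0) ;; While (Less (Reg ''i'') (Reg ''source_len'')) source_body ;; start_com)
        (effect (Assign ''i'' (num 0)) \<tau>1)
        ((length ts * Suc (steps sink_body) + 1) + (1 + ((length ds * Suc (steps source_body) + 1) + steps start_com)))
        (\<lambda>\<tau>. \<exists>c. inv c \<and> repr c \<tau>)"
    proof (rule reaches_Seq[OF L2[OF 1]])
      fix \<tau>2 assume 2: "J2 (length ts) \<tau>2"
      show "reaches (Assign ''i'' (num 0) ;; While (Less (Reg ''i'') (Reg ''source_len'')) source_body ;; start_com) \<tau>2
         (1 + ((length ds * Suc (steps source_body) + 1) + steps start_com)) (\<lambda>\<tau>. \<exists>c. inv c \<and> repr c \<tau>)"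
        using reaches_loop_free_Seq[OF st(2) reaches_Seq[OF L3[OF 2] L4]] unfolding st(1) .
    qed
    from reaches_loop_free_Seq[OF st(2) this]
    show "reaches (Assign ''i'' (num 0) ;; While (Less (Reg ''i'') (Reg ''sink_len'')) sink_body ;;
        Assign ''i'' (num 0) ;; While (Less (Reg ''i'') (Reg ''source_len'')) source_body ;; start_com) \<tau>1
       (1 + ((length ts * Suc (steps sink_body) + 1) + (1 + ((length ds * Suc (steps source_body) + 1) + steps start_com))))
       (\<lambda>\<tau>. \<exists>c. inv c \<and> repr c \<tau>)" unfolding st(1) .
  qed
  have B: "?t \<le> init_cost * (h * F * K * size_bound)" and M: "1 \<le> size_bound"
  proof -
    have "length ds \<le> (\<Sum>v\<in>V. \<Delta> v)"
      using I unfolding inv_def count_inv_def c_def init_conf_def ns_def by simp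
    then have d: "length ds \<le> size_bound" unfolding size_bound_def by simp
    have "length ts = card (set ts)" using ts(1) by (rule distinct_card[symmetric])
    also have "\<dots> = card (fst ` set ts)" by (rule card_image[symmetric]) (auto simp: ts(2) inj_on_def)
    also have "fst ` set ts = {v \<in> V. T v < deg G v}" unfolding ts(2) by force
    also have "card \<dots> = (\<Sum>v | v \<in> V \<and> T v < deg G v. 1)" by simp
    also have "\<dots> \<le> (\<Sum>v | v \<in> V \<and> T v < deg G v. deg G v - T v)" by (intro sum_mono) auto
    also have "\<dots> \<le> (\<Sum>v\<in>V. deg G v - T v)" by (intro sum_mono2) auto
    finally have t: "length ts \<le> size_bound" unfolding size_bound_def by simp
    \<comment> \<open>A single source makes the bound positive, so the \<open>h\<close> rounds of
      the capacity loop can be charged to it.\<close>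
    show M: "1 \<le> size_bound" using d ns(1) unfolding ns_def by (cases ds) auto
    let ?X = "h * F * K * size_bound"
    have "size_bound \<le> ?X" using h F K by (simp add: Suc_le_eq)
    have "h \<le> ?X" using F K M by (simp add: Suc_le_eq mult.assoc)
    have X: "h \<le> ?X" "length ts \<le> ?X" "length ds \<le> ?X" "1 \<le> ?X"
      using t d M \<open>size_bound \<le> ?X\<close> \<open>h \<le> ?X\<close> by linarith+
    have "h * Suc (steps cap_body) \<le> ?X * Suc (steps cap_body)"
      "length ts * Suc (steps sink_body) \<le> ?X * Suc (steps sink_body)"
      "length ds * Suc (steps source_body) \<le> ?X * Suc (steps source_body)"
      "steps start_com \<le> ?X * steps start_com"
      using X by (auto intro!: mult_right_mono simp del: mult_Suc_right)
    then have "?t \<le> ?X * Suc (steps cap_body) + ?X + (?X + (?X * Suc (steps sink_body) + ?X +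
       (?X + (?X * Suc (steps source_body) + ?X + ?X * steps start_com))))"
      using X(4) by linarith
    also have "\<dots> = init_cost * ?X" unfolding init_cost_def by (simp add: algebra_simps)
    finally show "?t \<le> init_cost * ?X" .
  qed
  show "reaches init_com \<sigma> (init_cost * (h * F * K * size_bound)) (\<lambda>\<tau>. \<exists>c. inv c \<and> repr c \<tau>)"
    by (rule reaches_weaken[OF R B])
  show "1 \<le> size_bound" by (rule M)
qed

section \<open>Composition of the phases\<close>

definition solved :: "(nat, nat) flow_fun \<Rightarrow> state \<Rightarrow> bool" where
  "solved f \<sigma>' \<longleftrightarrow> preflow G f \<and> source_feasible G \<Delta> f \<and> congestion G f \<le> 2 * int h * int F \<and>
     outputs_preflow f \<sigma>' \<and> reg \<sigma>' ''excess'' = total_excess G \<Delta> T f \<and>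
     (total_excess G \<Delta> T f = 0 \<and> is_flow G \<Delta> T f \<or>
      (\<exists>S. S \<subseteq> V \<and> outputs_set S \<sigma>' \<and> vol G S > 0 \<and> vol G (V - S) > 0 \<and>
         conductance G S < 1 / real h \<and> real (vol G S) \<ge> real_of_int (total_excess G \<Delta> T f) / real F))"

lemma solved_ef:
  assumes I: "inv c" and r: "\<not> running c" and fin: "final_stored c \<sigma>" and fl: "flows_done c (marked_cells c) \<sigma>"
    and cut: "0 < (\<Sum>v\<in>V. pile c v) \<Longrightarrow>
       \<exists>k. 1 \<le> k \<and> k \<le> base c \<and> good c k \<and> outputs_set {v \<in> V. k \<le> level c v} \<sigma>"
  shows "solved (ef c) \<sigma>"
proof -
  let ?x = "\<Sum>v\<in>V. pile c v"
  have te: "total_excess G \<Delta> T (ef c) = int ?x" by (rule total_excess_eq[OF I r])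
  have ex: "reg \<sigma> ''excess'' = int ?x" using fin unfolding final_stored_def by simp
  have "total_excess G \<Delta> T (ef c) = 0 \<and> is_flow G \<Delta> T (ef c) \<or>
      (\<exists>S. S \<subseteq> V \<and> outputs_set S \<sigma> \<and> vol G S > 0 \<and> vol G (V - S) > 0 \<and>
         conductance G S < 1 / real h \<and> real (vol G S) \<ge> real_of_int (total_excess G \<Delta> T (ef c)) / real F)"
  proof (cases "?x = 0")
    case True
    then show ?thesis using te is_flow_ef[OF I r] by simp
  next
    case False
    then have p: "0 < ?x" by (rule neq0_conv[THEN iffD1])
    obtain k where k: "1 \<le> k" "k \<le> base c" "good c k" "outputs_set {v \<in> V. k \<le> level c v} \<sigma>"
      using cut[OF p] by blast
    note g = good_cut[OF I r p k(1-3)]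
    have "real ?x \<le> real (F * vol G {v \<in> V. k \<le> level c v})" using g(5) by (simp only: of_nat_le_iff)
    then have "real ?x / real F \<le> real (vol G {v \<in> V. k \<le> level c v})"
      using F by (simp add: divide_le_eq mult.commute)
    then show ?thesis using g k(4) unfolding te by (intro disjI2 exI[of _ "{v \<in> V. k \<le> level c v}"]) simp
  qed
  then show ?thesis
    unfolding solved_def using preflow_edge_flow source_feasible_ef[OF I] congestion_ef[OF I]
      flows_done_outputs[OF I fl] te ex by simp
qed

lemma cut_phase:
  assumes I: "inv c" and r: "\<not> running c" and F: "final_stored c \<sigma>" and fl: "flows_done c (marked_cells c) \<sigma>"
    and C: "counts_done c (marked_cells c) \<sigma>"
  shows "reaches (Cond (Less (num 0) (Reg ''excess'')) (find_com ;; cut_com) Skip) \<sigma>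
     (Suc (2 + (8 * h * expo c * 4 + 1) + (2 + (size_bound * Suc (steps cut_body) + 1)))) (solved (ef c))"
proof -
  let ?x = "\<Sum>v\<in>V. pile c v"
  have ex: "reg \<sigma> ''excess'' = int ?x" using F unfolding final_stored_def by simp
  show ?thesis
  proof (rule reaches_Cond)
    assume "bval (Less (num 0) (Reg ''excess'')) \<sigma>"
    then have "0 < int ?x" unfolding bval.simps aval.simps ex .
    then have p: "0 < ?x" by (simp only: of_nat_0_less_iff)
    obtain m where m: "1 \<le> m" "m \<le> base c" "good c m" using exists_good[OF I r p] by blast
    have b: "base c = 8 * h * expo c" by (rule finished_base(1)[OF I r p])
    have "reaches find_com \<sigma> (2 + (8 * h * expo c * 4 + 1))
       (\<lambda>\<sigma>'. final_stored c \<sigma>' \<and> flows_done c (marked_cells c) \<sigma>' \<and>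
          (\<exists>k. reg \<sigma>' ''i'' = int k \<and> 1 \<le> k \<and> k \<le> m \<and> good c k))"
      using m(2) b by (intro reaches_weaken[OF find_correct[OF F fl C m(1,3)]]) auto
    then show "reaches (find_com ;; cut_com) \<sigma>
       (2 + (8 * h * expo c * 4 + 1) + (2 + (size_bound * Suc (steps cut_body) + 1))) (solved (ef c))"
    proof (rule reaches_Seq)
      fix \<sigma>' assume s: "final_stored c \<sigma>' \<and> flows_done c (marked_cells c) \<sigma>' \<and>
          (\<exists>k. reg \<sigma>' ''i'' = int k \<and> 1 \<le> k \<and> k \<le> m \<and> good c k)"
      then obtain k where k: "reg \<sigma>' ''i'' = int k" "1 \<le> k" "k \<le> base c" "good c k" using m(2) by auto
      show "reaches cut_com \<sigma>' (2 + (size_bound * Suc (steps cut_body) + 1)) (solved (ef c))"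
        using s by (intro reaches_weaken[OF cut_correct[OF I _ _ k(1,2)]]) (use solved_ef[OF I r] k in blast)+
    qed
  next
    assume "\<not> bval (Less (num 0) (Reg ''excess'')) \<sigma>"
    then have "\<not> 0 < int ?x" unfolding bval.simps aval.simps ex .
    then have n: "\<not> 0 < ?x" by (simp only: of_nat_0_less_iff not_False_eq_True)
    have "solved (ef c) \<sigma>" by (rule solved_ef[OF I r F fl]) (erule notE[OF n])
    then show "reaches Skip \<sigma> (2 + (8 * h * expo c * 4 + 1) + (2 + (size_bound * Suc (steps cut_body) + 1))) (solved (ef c))"
      by (rule reaches_weaken[OF reaches_Skip]) auto
  qed
qed

lemma program_correct:
  assumes in_: "is_input G h F \<Delta> T \<sigma>" and gs: "graph_stored \<sigma>" and len: "0 < reg \<sigma> ''source_len''"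
    and K: "2 * size_bound < 2 ^ K" "1 \<le> K"
  shows "reaches flow_program \<sigma> (total_cost * (h * F * K * size_bound)) (\<lambda>\<sigma>'. \<exists>f. solved f \<sigma>')"
proof -
  let ?X = "h * F * K * size_bound"
  let ?Q = "\<lambda>\<sigma>'. \<exists>f. solved f \<sigma>'"
  let ?t1 = "40 * h * F * K * size_bound * Suc (steps main_body) + 1"
  let ?t2 = "5 + (2 * size_bound * Suc (steps pass_body) + 1)"
  let ?t3 = "Suc (2 + (8 * h * K * 4 + 1) + (2 + (size_bound * Suc (steps cut_body) + 1)))"
  have "reaches (init_com ;; While main_guard main_body ;; pass_com ;;
      Cond (Less (num 0) (Reg ''excess'')) (find_com ;; cut_com) Skip) \<sigma> (init_cost * ?X + (?t1 + (?t2 + ?t3))) ?Q"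
  proof (rule reaches_Seq[OF init_correct(1)[OF in_ gs len K(2)]], elim exE conjE)
    fix \<sigma>1 c1 assume 1: "inv c1" "repr c1 \<sigma>1"
    show "reaches (While main_guard main_body ;; pass_com ;;
      Cond (Less (num 0) (Reg ''excess'')) (find_com ;; cut_com) Skip) \<sigma>1 (?t1 + (?t2 + ?t3)) ?Q"
    proof (rule reaches_Seq[OF main_loop[OF 1 K]], elim exE conjE)
      fix \<sigma>2 c assume 2: "inv c" "repr c \<sigma>2" "\<not> running c"
      show "reaches (pass_com ;; Cond (Less (num 0) (Reg ''excess'')) (find_com ;; cut_com) Skip) \<sigma>2 (?t2 + ?t3) ?Q"
      proof (rule reaches_Seq[OF pass_correct[OF 2(1,2)]], elim conjE)
        fix \<sigma>3 assume 3: "final_stored c \<sigma>3" "flows_done c (marked_cells c) \<sigma>3" "counts_done c (marked_cells c) \<sigma>3"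
        have "8 * h * expo c \<le> 8 * h * K" using expo_le[OF 2(1) K] by simp
        then show "reaches (Cond (Less (num 0) (Reg ''excess'')) (find_com ;; cut_com) Skip) \<sigma>3 ?t3 ?Q"
          by (intro reaches_weaken[OF cut_phase[OF 2(1,3) 3]]) auto
      qed
    qed
  qed
  then have "reaches flow_program \<sigma> (Suc (init_cost * ?X + (?t1 + (?t2 + ?t3)))) ?Q"
    unfolding flow_program_def by (rule reaches_Cond) (use len in simp)
  then show ?thesis
  proof (rule reaches_weaken)
    have M: "1 \<le> size_bound" by (rule init_correct(2)[OF in_ gs len K(2)])
    define X where "X = ?X"
    have "size_bound \<le> X" unfolding X_def using h F K by (simp add: Suc_le_eq)
    moreover have "h * K * 1 \<le> h * K * (F * size_bound)" using F M by (intro mult_left_mono) auto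
    then have "h * K \<le> X" unfolding X_def by (simp add: algebra_simps)
    ultimately have X: "size_bound \<le> X" "h * K \<le> X" "1 \<le> X" using M by linarith+
    have 1: "size_bound * n \<le> X * n" for n using X(1) by (rule mult_right_mono) simp
    have t1: "?t1 = 40 * (X * Suc (steps main_body)) + 1"
      unfolding X_def by (simp only: ac_simps)
    have t2: "?t2 = 6 + 2 * (size_bound * Suc (steps pass_body))" by (simp only: ac_simps)
    have t3: "?t3 = 7 + 32 * (h * K) + size_bound * Suc (steps cut_body)" by simp
    have "Suc (init_cost * X + (?t1 + (?t2 + ?t3))) \<le>
      init_cost * X + 40 * (X * Suc (steps main_body)) + X + (6 * X + 2 * (X * Suc (steps pass_body))) +
      (8 * X + 32 * X + X * Suc (steps cut_body))"
      unfolding t1 t2 t3 using X 1[of "Suc (steps cut_body)"] 1[of "Suc (steps pass_body)"] by linarith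
    also have "\<dots> \<le> total_cost * X" unfolding total_cost_def by (simp add: algebra_simps)
    finally show "Suc (init_cost * ?X + (?t1 + (?t2 + ?t3))) \<le> total_cost * ?X" unfolding X_def .
  qed
qed

end

lemma exists_log_bound:
  assumes "1 \<le> (m::nat)"
  shows "\<exists>K\<ge>1. 8 * m < 2 ^ K \<and> real K \<le> 5 * max 1 (log 2 (real m))"
proof -
  define L where "L = nat \<lfloor>log 2 (real m)\<rfloor>"
  have l: "0 \<le> log 2 (real m)" using assms by simp
  have "log 2 (real m) < real (L + 1)" unfolding L_def using l by linarith
  then have "real m < 2 powr real (L + 1)" using assms by (subst (asm) log_less_iff) auto
  then have "real m < real (2 ^ (L + 1))" by (simp add: powr_realpow powr_add)
  then have "m < 2 ^ (L + 1)" by (simp only: of_nat_less_iff)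
  \<comment> \<open>The factor 8 covers \<open>2 * size_bound\<close> and adds 3 to the exponent;
    the summand 4 is absorbed by the factor 5 of the logarithm.\<close>
  then have "8 * m < 2 ^ (L + 4)" by (simp add: power_add)
  moreover have "real (L + 4) \<le> 5 * max 1 (log 2 (real m))"
  proof -
    have "real L \<le> log 2 (real m)" unfolding L_def using l by linarith
    then show ?thesis by (simp add: max_def)
  qed
  ultimately show ?thesis by (intro exI[of _ "L + 4"]) auto
qed

lemma one_le_time_bound: "1 \<le> time_bound G h F \<Delta> T"
  unfolding time_bound_def le_add_same_cancel1
  by (intro mult_nonneg_nonneg[OF of_nat_0_le_iff]) (simp add: le_max_iff_disj)

theorem theorem3p3:
  "\<exists>(P :: com) (C :: real).
     \<forall>(G :: (nat, nat) mgraph) (h :: nat) (F :: nat) (\<Delta> :: nat \<Rightarrow> nat) (T :: nat \<Rightarrow> nat) (\<sigma> :: state).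
       multigraph G \<longrightarrow> h \<ge> 1 \<longrightarrow> F \<ge> 1 \<longrightarrow>
       (\<forall>v\<in>verts G. \<Delta> v \<le> F * deg G v) \<longrightarrow>
       (\<forall>v\<in>verts G. T v \<le> deg G v) \<longrightarrow>
       (\<Sum>v\<in>verts G. \<Delta> v) \<le> (\<Sum>v\<in>verts G. T v) \<longrightarrow>
       is_input G h F \<Delta> T \<sigma> \<longrightarrow>
       (\<exists>t \<sigma>' f.
          exec P \<sigma> t \<sigma>' \<and>
          real t \<le> C * time_bound G h F \<Delta> T \<and>
          preflow G f \<and> source_feasible G \<Delta> f \<and>
          congestion G f \<le> 2 * int h * int F \<and>
          outputs_preflow f \<sigma>' \<and>
          reg \<sigma>' ''excess'' = total_excess G \<Delta> T f \<and>
          (total_excess G \<Delta> T f = 0 \<and> is_flow G \<Delta> T f \<or>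
           (\<exists>S. S \<subseteq> verts G \<and> outputs_set S \<sigma>' \<and>
              vol G S > 0 \<and> vol G (verts G - S) > 0 \<and>
              conductance G S < 1 / real h \<and>
              real (vol G S) \<ge> real_of_int (total_excess G \<Delta> T f) / real F)))"
proof (rule exI[of _ flow_program], rule exI[of _ "5 * real total_cost + 2"], intro allI impI)
  fix G :: "(nat, nat) mgraph" and h F :: nat and \<Delta> T :: "nat \<Rightarrow> nat" and \<sigma> :: state
  assume mg: "multigraph G" and h: "h \<ge> 1" and F: "F \<ge> 1"
    and \<Delta>: "\<forall>v\<in>verts G. \<Delta> v \<le> F * deg G v" and T: "\<forall>v\<in>verts G. T v \<le> deg G v"
    and \<Delta>T: "(\<Sum>v\<in>verts G. \<Delta> v) \<le> (\<Sum>v\<in>verts G. T v)" and in_: "is_input G h F \<Delta> T \<sigma>"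
  have hl: "holds_incidence_lists G \<sigma>" using in_ unfolding is_input_def by blast
  obtain cell inc nb where inc: "incidence G inc nb"
    and cell0: "\<And>v j. v \<in> verts G \<Longrightarrow> j \<le> deg G v \<Longrightarrow> cell v j = 0 \<longleftrightarrow> j = deg G v"
    and stored: "\<And>v. v \<in> verts G \<Longrightarrow> arr \<sigma> ''head'' (int v) = cell v 0 \<and>
     (\<forall>j<deg G v. arr \<sigma> ''next'' (cell v j) = cell v (Suc j) \<and>
        arr \<sigma> ''edge'' (cell v j) = int (inc v j) \<and> arr \<sigma> ''nbr'' (cell v j) = int (nb v j))"
    by (rule incidence_enumeration[OF mg hl]) (rule that; (assumption | blast))
  interpret machine G inc nb h F \<Delta> T cell
    using inc h F \<Delta> T \<Delta>T cell0
    by (auto simp: machine_def machine_axioms_def flow_instance_def flow_instance_axioms_def)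
  have gs: "graph_stored \<sigma>" using stored unfolding graph_stored_def by blast
  \<comment> \<open>The 5 stems from the bound on \<open>K\<close>, the 2 pays for the two steps of
    a run without sources.\<close>
  let ?C = "5 * real total_cost + 2"
  have "\<exists>t \<sigma>' f. exec flow_program \<sigma> t \<sigma>' \<and> real t \<le> ?C * time_bound G h F \<Delta> T \<and> solved f \<sigma>'"
  proof (cases "0 < reg \<sigma> ''source_len''")
    case True
    have M: "1 \<le> size_bound" using init_correct(2)[OF in_ gs True, of 1] by simp
    then have "1 \<le> card E" using size_bound_le by (cases "card E") auto
    then obtain K where K: "1 \<le> K" "8 * card E < 2 ^ K" "real K \<le> 5 * max 1 (log 2 (real (card E)))"
      using exists_log_bound by blast
    have "2 * size_bound < 2 ^ K" using size_bound_le K(2) by linarith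
    then obtain t \<sigma>' f where t: "exec flow_program \<sigma> t \<sigma>'" "t \<le> total_cost * (h * F * K * size_bound)" "solved f \<sigma>'"
      using program_correct[OF in_ gs True _ K(1)] unfolding reaches_def by blast
    let ?Y = "real (h * F * size_bound)"
    have "real t \<le> real (total_cost * (h * F * K * size_bound))" using t(2) by (simp only: of_nat_le_iff)
    also have "\<dots> = real total_cost * (?Y * real K)" by simp
    also have "\<dots> \<le> real total_cost * (?Y * (5 * max 1 (log 2 (real (card E)))))"
      using K(3) by (intro mult_left_mono) auto
    also have "\<dots> = 5 * real total_cost * (time_bound G h F \<Delta> T - 1)"
      unfolding time_bound_def size_bound_def by simp
    also have "\<dots> \<le> ?C * time_bound G h F \<Delta> T"
    proof -
      have "0 \<le> time_bound G h F \<Delta> T" using one_le_time_bound[of G h F \<Delta> T] by linarith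
      then show ?thesis by (simp add: algebra_simps)
    qed
    finally show ?thesis using t(1,3) by blast
  next
    case False
    then have ex: "exec flow_program \<sigma> (1 + 1) \<sigma>"
      unfolding flow_program_def by (intro exec.Cond_False exec.Skip) simp
    have "real (1 + 1) \<le> ?C * time_bound G h F \<Delta> T"
    proof -
      have "?C * 1 \<le> ?C * time_bound G h F \<Delta> T"
        by (intro mult_left_mono one_le_time_bound) auto
      moreover have "real (1 + 1) \<le> ?C * 1" by simp
      ultimately show ?thesis by linarith
    qed
    \<comment> \<open>With no supply the zero flow is feasible, and the registers
      \<open>flow_len\<close> and \<open>excess\<close>, initially 0, already describe it.\<close>
    moreover have "solved (\<lambda>_ _ _. 0) \<sigma>"
    proof -
      obtain ds where "set ds = {(v, \<Delta> v) | v. v \<in> V \<and> \<Delta> v > 0}" "reg \<sigma> ''source_len'' = int (length ds)"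
        using in_ unfolding is_input_def by (elim conjE exE) (rule that)
      then have "\<Delta> v = 0" if "v \<in> V" for v using False that by auto
      moreover have "reg \<sigma> ''flow_len'' = 0" "reg \<sigma> ''excess'' = 0" using in_ unfolding is_input_def by simp_all
      moreover have "{f e u v | e u v. e \<in> E \<and> u \<in> V \<and> v \<in> V} \<subseteq> {0}" if "f = (\<lambda>_ _ _. 0)" for f :: "(nat, nat) flow_fun"
        using that by auto
      ultimately show ?thesis
        unfolding solved_def preflow_def source_feasible_def congestion_def outputs_preflow_def holds_list_def
          total_excess_def excess_def amount_def is_flow_def sink_feasible_def
        by (auto simp: insert_absorb intro!: exI[of _ "[]"])
    qed
    ultimately show ?thesis using ex by blast
  qed
  then show "\<exists>t \<sigma>' f. exec flow_program \<sigma> t \<sigma>' \<and> real t \<le> ?C * time_bound G h F \<Delta> T \<and>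
          preflow G f \<and> source_feasible G \<Delta> f \<and>
          congestion G f \<le> 2 * int h * int F \<and>
          outputs_preflow f \<sigma>' \<and>
          reg \<sigma>' ''excess'' = total_excess G \<Delta> T f \<and>
          (total_excess G \<Delta> T f = 0 \<and> is_flow G \<Delta> T f \<or>
           (\<exists>S. S \<subseteq> verts G \<and> outputs_set S \<sigma>' \<and>
              vol G S > 0 \<and> vol G (verts G - S) > 0 \<and>
              conductance G S < 1 / real h \<and>
              real (vol G S) \<ge> real_of_int (total_excess G \<Delta> T f) / real F))"
    unfolding solved_def .
qed

end
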